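(* Let $d\ge2$, let $\mathcal{C}=\{Q_0,\dots,Q_{r-1}\}$ be a toric constellation with origin over $X=\mathbb{C}^d$, and let $P(\underline t)$ be the Poincaré series of the multi-index filtration on $\mathcal{O}_{\mathbb{C}^d,o}$ defined by the divisorial valuations $\nu_1,\dots,\nu_r$ of the exceptional components $E_1,\dots,E_r$. Then $$P(\underline t)=\sum_{\underline v\in\mathbb{Z}^r}\chi(D_{\underline v})\,\underline t^{\underline v},$$ where $\chi$ denotes the Euler characteristic.
   Context: Constellations: $X=X_0=\mathbb{C}^d$ carries the standard action of the torus $T=(\mathbb{C}^* )^d$; $o$ is the origin. A toric constellation with origin is a finite sequence $\mathcal{C}=\{Q_0,\dots,Q_{r-1}\}$, $r\ge 1$, where $Q_0=o\in X_0$, $X_j\to X_{j-1}$ is the blowing-up of the point $Q_{j-1}$ ($1\le j\le r$), and each $Q_j$ ($1\le j\le r-1$) is a $0$-dimensional $T$-orbit of $X_j$ mapping to $Q_0$. Put $Z=X_r$, $\pi:Z\to X$ the composition, $J=\{1,\dots,r\}$. For $j\in J$, $E_j\subset Z$ is the (strict transform in $Z$ of the) exceptional divisor of the blowing-up of $Q_{j-1}$, $\mathcal{D}=\bigcup_{j\in J}E_j$, and $\nu_j$ is the discrete valuation on $\mathcal{O}_{\mathbb{C}^d,o}$ given by the order of vanishing of $\pi^*g$ along $E_j$ (a monomial valuation). $\underline\nu=(\nu_1,\dots,\nu_r)$. Poincaré series: for $\underline v\in\mathbb{Z}^r$ put $I(\underline v)=\{g\in\mathcal{O}_{\mathbb{C}^d,o}\mid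 \nu_i(g)\ge v_i,\ 1\le i\le r\}$, $\underline 1=(1,\dots,1)$, $d(\underline v)=\dim_{\mathbb C} I(\underline v)/I(\underline v+\underline 1)$ (finite), $L=\sum_{\underline v\in\mathbb{Z}^r}d(\underline v)\,\underline t^{\underline v}$. Then $\prod_{i=1}^r(t_i-1)L\in\mathbb{Z}[[t_1,\dots,t_r]]$ and $P(\underline t)=\prod_{i=1}^r(t_i-1)L/(t_1\cdots t_r-1)\in\mathbb{Z}[[t_1,\dots,t_r]]$. The space $D_{\underline v}$: for $g\in\mathcal{O}_{\mathbb{C}^d,o}$ let $\{\hat g=0\}$ be the strict transform of $\{g=0\}$ in $Z$ (i.e. the divisor $\mathrm{div}(\pi^*g)-\sum_i\nu_i(g)E_i$ near $\mathcal{D}$). As a set, $$D_{\underline v}=\{\{\hat g=0\}\cap\mathcal{D}\mid g\in\mathcal{O}_{\mathbb{C}^d,o},\ \underline\nu(g)=\underline v,\ \{\hat g=0\}\text{ contains no non-empty intersection }E_a\cap E_b,\ a,b\in J,\ a\ne b\},$$ where intersections are taken as divisors, i.e. $\{\hat g=0\}\cap\mathcal{D}$ is recorded by the effective divisors (with multiplicities) cut out by $\hat g$ on the components $E_j$. Topology: with $E_{\underline v}=\sum_{i=1}^rv_iE_i$, let $R$ be the restriction to $\mathcal{D}$ of the line bundle $\mathcal{O}_Z(-E_{\underline v})$; since $\mathcal{D}$ is projective, $H^0(\mathcal{D},R)$ is finite-dimensional. For $g$ with $\underline\nu(g)=\underline v$, $\pi^*g$ is a section of $\mathcal{O}_Z(-E_{\underline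 v})$ near $\mathcal{D}$ and $\{\hat g=0\}\cap\mathcal{D}$ is the divisor of zeros of its restriction to $\mathcal{D}$, a global section of $R$. Assigning to $\{\hat g=0\}\cap\mathcal{D}$ the class of this section identifies $D_{\underline v}$ with a subset of the projective space $\mathbb{P}H^0(\mathcal{D},R)$, and $D_{\underline v}$ carries the induced topology. *)

theory Defs
  imports "HOL-Analysis.Analysis" "HOL-Homology.Homology"
begin

section \<open>Germs of holomorphic functions of several variables\<close>

text \<open>
  Holomorphic at \<open>p\<close>: sum of a convergent power series in a neighbourhood of \<open>p\<close>.
  The ring of germs at \<open>p\<close> consists of such functions up to equality near \<open>p\<close>; germs are
  represented by functions, and everything below depends only on the behaviour near the
  relevant points.
\<close>

definition holo_at :: "(complex^'d \<Rightarrow> complex) \<Rightarrow> complex^'d \<Rightarrow> bool" where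
  "holo_at u p \<longleftrightarrow>
     (\<exists>(a :: nat^'d \<Rightarrow> complex) e. e > 0 \<and>
        (\<forall>h. norm h < e \<longrightarrow>
          ((\<lambda>\<alpha>. a \<alpha> * (\<Prod>i\<in>UNIV. (h $ i) ^ (\<alpha> $ i))) has_sum u (p + h)) UNIV))"

section \<open>Toric constellations and their blow-ups\<close>

text \<open>
  Each \<open>X\<^sub>j\<close> is a smooth toric variety, covered by equivariant charts isomorphic to
  \<open>\<complex>\<^sup>d\<close>.  A chart is encoded by the unimodular matrix whose rows are the primitive
  generators of its cone: in chart \<open>A\<close>, with coordinates \<open>y\<close>, the projection to \<open>\<complex>\<^sup>d\<close> is
  \<open>x\<^sub>i = (\<Prod>k. y\<^sub>k ^ A\<^sub>k\<^sub>i)\<close>, and \<open>y\<^sub>k = 0\<close> is the invariant divisor of the ray \<open>A $ k\<close>.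
  Zero-dimensional orbits of \<open>X\<^sub>j\<close> are exactly the origins of its charts (all of them lie
  over \<open>o\<close>), so a point of the constellation is given by the chart of which it is the origin.
\<close>

type_synonym 'd chart = "int^'d^'d"

definition monomial_map :: "int^'d^'d \<Rightarrow> complex^'d \<Rightarrow> complex^'d" where
  "monomial_map M y = (\<chi> i. \<Prod>k\<in>UNIV. (y $ k) powi (M $ k $ i))"

text \<open>
  The \<open>l\<close>-th chart of the blow-up of the origin of chart \<open>A\<close>, given by \<open>y\<^sub>l = z\<^sub>l\<close> and
  \<open>y\<^sub>k = z\<^sub>k z\<^sub>l\<close> for \<open>k \<noteq> l\<close> (see the lemma below): star subdivision of the cone of \<open>A\<close>.
\<close>

definition blowup_ray :: "'d::finite chart \<Rightarrow> int^'d" where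
  "blowup_ray A = (\<Sum>k\<in>UNIV. A $ k)"

definition blowup_chart :: "'d::finite chart \<Rightarrow> 'd \<Rightarrow> 'd chart" where
  "blowup_chart A l = (\<chi> k. if k = l then blowup_ray A else A $ k)"

lemma monomial_map_blowup_chart:
  fixes A :: "'d::finite chart"
  assumes "\<And>k i. A $ k $ i \<ge> 0"
  shows "monomial_map (blowup_chart A l) z =
         monomial_map A (\<chi> k. if k = l then z $ l else z $ k * z $ l)"
proof -
  have pow_sum: "x powi (\<Sum>k\<in>S. f k) = (\<Prod>k\<in>S. x powi f k)"
    if "finite S" "\<And>k. f k \<ge> 0" for x :: complex and f :: "'d \<Rightarrow> int" and S
    using that
  proof (induction S rule: finite_induct)
    case (insert k S)
    have "0 \<le> (\<Sum>k\<in>S. f k)" using insert.prems by (simp add: sum_nonneg)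
    moreover have "0 \<le> f k" using insert.prems by simp
    ultimately have "x powi (f k + (\<Sum>k\<in>S. f k)) = x powi f k * x powi (\<Sum>k\<in>S. f k)"
      by (cases "x = 0") (auto simp: power_int_add power_int_0_left_if)
    then show ?case using insert by simp
  qed simp
  have "(\<Prod>k\<in>UNIV. z $ k powi (blowup_chart A l $ k $ i)) =
        (\<Prod>k\<in>UNIV. (if k = l then z $ l else z $ k * z $ l) powi (A $ k $ i))" for i
  proof -
    have U: "(UNIV :: 'd set) = insert l (UNIV - {l})" by auto
    have *: "blowup_ray A $ i = A $ l $ i + (\<Sum>k\<in>UNIV - {l}. A $ k $ i)"
      unfolding blowup_ray_def by (subst U, subst sum.insert) auto
    have "z $ l powi (blowup_ray A $ i) =
          z $ l powi (A $ l $ i) * (\<Prod>k\<in>UNIV - {l}. z $ l powi (A $ k $ i))"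
    proof -
      have "z $ l powi (blowup_ray A $ i) = (\<Prod>k\<in>UNIV. z $ l powi (A $ k $ i))"
        unfolding blowup_ray_def sum_component by (rule pow_sum) (auto simp: assms)
      also have "\<dots> = z $ l powi (A $ l $ i) * (\<Prod>k\<in>UNIV - {l}. z $ l powi (A $ k $ i))"
        by (subst U, subst prod.insert) auto
      finally show ?thesis .
    qed
    moreover have "(\<Prod>k\<in>UNIV. z $ k powi (blowup_chart A l $ k $ i)) =
        z $ l powi (blowup_ray A $ i) * (\<Prod>k\<in>UNIV - {l}. z $ k powi (A $ k $ i))"
      by (subst U, subst prod.insert) (auto simp: blowup_chart_def intro!: prod.cong)
    moreover have "(\<Prod>k\<in>UNIV. (if k = l then z $ l else z $ k * z $ l) powi (A $ k $ i)) =
        z $ l powi (A $ l $ i) * (\<Prod>k\<in>UNIV - {l}. (z $ k * z $ l) powi (A $ k $ i))"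
      by (subst U, subst prod.insert) (auto intro!: prod.cong)
    ultimately show ?thesis
      by (simp add: power_int_mult_distrib prod.distrib mult_ac)
  qed
  then show ?thesis
    by (simp add: monomial_map_def vec_eq_iff)
qed

text \<open>
  \<open>charts C j\<close> are the charts of \<open>X\<^sub>j\<close>.  Blowing up \<open>Q\<^sub>j\<close>, the origin of chart \<open>C ! j\<close>,
  replaces this chart by its \<open>d\<close> blow-up charts; the remaining charts do not contain \<open>Q\<^sub>j\<close>.
\<close>

primrec charts :: "'d::finite chart list \<Rightarrow> nat \<Rightarrow> 'd chart set" where
  "charts C 0 = {mat 1}"
| "charts C (Suc j) = (charts C j - {C ! j}) \<union> range (blowup_chart (C ! j))"

definition toric_constellation :: "'d::finite chart list \<Rightarrow> bool" where
  "toric_constellation C \<longleftrightarrow> C \<noteq> [] \<and> (\<forall>j < length C. C ! j \<in> charts C j)"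

abbreviation Z_charts :: "'d::finite chart list \<Rightarrow> 'd chart set" where
  "Z_charts C \<equiv> charts C (length C)"

text \<open>
  Points of \<open>Z\<close> are represented by pairs (chart, coordinates).  The intersection of two charts
  is the toric chart of the common face of their cones, i.e. a coordinate may vanish
  there only if its ray is common to both, and the change of coordinates is monomial.
\<close>

definition transition :: "'d::finite chart \<Rightarrow> 'd chart \<Rightarrow> int^'d^'d" where
  "transition A B = A ** matrix_inv B"

definition glued :: "'d::finite chart \<Rightarrow> 'd chart \<Rightarrow> complex^'d \<Rightarrow> complex^'d \<Rightarrow> bool" where
  "glued A B y z \<longleftrightarrow>
     (\<forall>k. y $ k = 0 \<longrightarrow> (\<exists>m. B $ m = A $ k)) \<and> z = monomial_map (transition A B) y"

text \<open>
  Components are numbered from \<open>0\<close>: \<open>E_in C j A\<close> is the trace on chart \<open>A\<close> of the strict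
  transform of the exceptional divisor of the blow-up of \<open>Q\<^sub>j\<close>.
\<close>

definition E_in :: "'d::finite chart list \<Rightarrow> nat \<Rightarrow> 'd chart \<Rightarrow> (complex^'d) set" where
  "E_in C j A = {y. \<exists>k. A $ k = blowup_ray (C ! j) \<and> y $ k = 0}"

definition D_in :: "'d::finite chart list \<Rightarrow> 'd chart \<Rightarrow> (complex^'d) set" where
  "D_in C A = (\<Union>j<length C. E_in C j A)"

definition E_int :: "'d::finite chart list \<Rightarrow> nat \<Rightarrow> nat \<Rightarrow> ('d chart \<times> (complex^'d)) set" where
  "E_int C a b = {(A, y). A \<in> Z_charts C \<and> y \<in> E_in C a A \<and> y \<in> E_in C b A}"

section \<open>Divisorial valuations and the Poincare series\<close>

text \<open>
  Order of vanishing of \<open>\<pi>\<^sup>* g\<close> along the \<open>j\<close>-th component: the largest power of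
  a local equation of the component that divides \<open>\<pi>\<^sup>* g\<close> in the local rings
  of \<open>Z\<close> at points of the component (infinite for \<open>g = 0\<close>).
\<close>

definition nu :: "'d::finite chart list \<Rightarrow> nat \<Rightarrow> (complex^'d \<Rightarrow> complex) \<Rightarrow> enat" where
  "nu C j g = Sup {enat n | n.
     \<forall>A \<in> Z_charts C. \<forall>k. A $ k = blowup_ray (C ! j) \<longrightarrow>
       (\<forall>y. y $ k = 0 \<longrightarrow>
          (\<exists>u. holo_at u y \<and>
             (\<forall>\<^sub>F w in nhds y. g (monomial_map A w) = (w $ k) ^ n * u w)))}"

text \<open>
  Elements of \<open>\<int>\<^sup>r\<close> are functions \<open>nat \<Rightarrow> int\<close> vanishing outside \<open>{..<r}\<close>; formal series
  are functions giving the coefficient of each exponent vector.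
\<close>

definition int_vecs :: "nat \<Rightarrow> (nat \<Rightarrow> int) set" where
  "int_vecs r = {v. \<forall>i\<ge>r. v i = 0}"

definition plus_one :: "nat \<Rightarrow> (nat \<Rightarrow> int) \<Rightarrow> (nat \<Rightarrow> int)" where
  "plus_one r v = (\<lambda>i. if i < r then v i + 1 else v i)"

definition minus_one :: "nat \<Rightarrow> (nat \<Rightarrow> int) \<Rightarrow> (nat \<Rightarrow> int)" where
  "minus_one r v = (\<lambda>i. if i < r then v i - 1 else v i)"

text \<open>The condition is void for negative \<open>v i\<close>, where \<open>nat (v i) = 0\<close>.\<close>

definition I_filt :: "'d::finite chart list \<Rightarrow> (nat \<Rightarrow> int) \<Rightarrow> (complex^'d \<Rightarrow> complex) set" where
  "I_filt C v = {g. holo_at g 0 \<and> (\<forall>i < length C. enat (nat (v i)) \<le> nu C i g)}"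

text \<open>
  Dimension of \<open>V / W\<close> for spaces of complex functions: the size of a finite set \<open>B\<close> whose classes
  form a basis.  Functions that vanish near the origin lie in every \<open>I_filt C v\<close>, so for
  these spaces it makes no difference whether one uses functions or germs.
\<close>

definition quot_dim :: "('a \<Rightarrow> complex) set \<Rightarrow> ('a \<Rightarrow> complex) set \<Rightarrow> nat" where
  "quot_dim V W = (THE n. \<exists>B. finite B \<and> card B = n \<and> B \<subseteq> V \<and>
     (\<forall>g\<in>V. \<exists>!c. (\<forall>b. b \<notin> B \<longrightarrow> c b = 0) \<and> (\<lambda>x. g x - (\<Sum>b\<in>B. c b * b x)) \<in> W))"

definition L_series :: "'d::finite chart list \<Rightarrow> (nat \<Rightarrow> int) \<Rightarrow> int" where
  "L_series C v = (if v \<in> int_vecs (length C)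
     then int (quot_dim (I_filt C v) (I_filt C (plus_one (length C) v))) else 0)"

text \<open>Multiplication by \<open>t\<^sub>i - 1\<close> and by \<open>t\<^sub>1 \<cdots> t\<^sub>r - 1\<close>.\<close>

definition mult_t_minus_1 :: "nat \<Rightarrow> ((nat \<Rightarrow> int) \<Rightarrow> int) \<Rightarrow> ((nat \<Rightarrow> int) \<Rightarrow> int)" where
  "mult_t_minus_1 i f = (\<lambda>v. f (v(i := v i - 1)) - f v)"

definition mult_prod_t_minus_1 :: "nat \<Rightarrow> ((nat \<Rightarrow> int) \<Rightarrow> int) \<Rightarrow> ((nat \<Rightarrow> int) \<Rightarrow> int)" where
  "mult_prod_t_minus_1 r f = (\<lambda>v. f (minus_one r v) - f v)"

definition power_series :: "nat \<Rightarrow> ((nat \<Rightarrow> int) \<Rightarrow> int) set" where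
  "power_series r = {f. \<forall>v. f v \<noteq> 0 \<longrightarrow> v \<in> int_vecs r \<and> (\<forall>i<r. 0 \<le> v i)}"

definition poincare_series :: "'d::finite chart list \<Rightarrow> (nat \<Rightarrow> int) \<Rightarrow> int" where
  "poincare_series C = (THE P. P \<in> power_series (length C) \<and>
     mult_prod_t_minus_1 (length C) P = fold mult_t_minus_1 [0..<length C] (L_series C))"

section \<open>Sections on the exceptional divisor and the space \<open>D\<^sub>v\<close>\<close>

text \<open>Multiplicity in \<open>E\<^sub>v\<close> of the divisor \<open>y\<^sub>k = 0\<close> of chart \<open>A\<close>.\<close>

definition E_mult :: "'d::finite chart list \<Rightarrow> (nat \<Rightarrow> int) \<Rightarrow> 'd chart \<Rightarrow> 'd \<Rightarrow> int" where
  "E_mult C v A k = (\<Sum>j<length C. if A $ k = blowup_ray (C ! j) then v j else 0)"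

text \<open>Local generator on chart \<open>A\<close> of the line bundle \<open>O(-E\<^sub>v)\<close>.\<close>

definition E_gen :: "'d::finite chart list \<Rightarrow> (nat \<Rightarrow> int) \<Rightarrow> 'd chart \<Rightarrow> complex^'d \<Rightarrow> complex" where
  "E_gen C v A w = (\<Prod>k\<in>UNIV. (w $ k) powi E_mult C v A k)"

text \<open>
  Value on the overlap of the charts \<open>A\<close> and \<open>B\<close> of the unit \<open>E_gen C v A / E_gen C v B\<close>, as a
  monomial in the coordinates of \<open>A\<close>; the exponents of the rays common to \<open>A\<close> and \<open>B\<close> are zero.
\<close>

definition E_unit :: "'d::finite chart list \<Rightarrow> (nat \<Rightarrow> int) \<Rightarrow> 'd chart \<Rightarrow> 'd chart
    \<Rightarrow> complex^'d \<Rightarrow> complex" where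
  "E_unit C v A B y = (\<Prod>k\<in>UNIV. (y $ k) powi
     (E_mult C v A k - (\<Sum>m\<in>UNIV. transition A B $ k $ m * E_mult C v B m)))"

text \<open>
  \<open>H\<^sup>0(D, R)\<close>: a section is a family of functions on the traces of \<open>D\<close> on the charts (extended by
  zero), its coordinates with respect to the generators \<open>E_gen\<close>.  They are locally restrictions of
  holomorphic functions and compatible on overlaps.
\<close>

type_synonym 'd sect = "'d chart \<Rightarrow> complex^'d \<Rightarrow> complex"

definition H0 :: "'d::finite chart list \<Rightarrow> (nat \<Rightarrow> int) \<Rightarrow> 'd sect set" where
  "H0 C v = {s.
     (\<forall>A y. \<not> (A \<in> Z_charts C \<and> y \<in> D_in C A) \<longrightarrow> s A y = 0) \<and>
     (\<forall>A \<in> Z_charts C. \<forall>y \<in> D_in C A. \<exists>u. holo_at u y \<and>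
        (\<forall>\<^sub>F w in nhds y. w \<in> D_in C A \<longrightarrow> s A w = u w)) \<and>
     (\<forall>A \<in> Z_charts C. \<forall>B \<in> Z_charts C. \<forall>y \<in> D_in C A. \<forall>z. glued A B y z \<longrightarrow>
        s B z = s A y * E_unit C v A B y)}"

text \<open>
  Restriction to \<open>D\<close> of \<open>\<pi>\<^sup>* g\<close> as a section of \<open>O(-E\<^sub>v)\<close>, that is (if \<open>v\<close> is the value
  vector of \<open>g\<close>) of the local equation of the strict transform of \<open>{g = 0}\<close>.
\<close>

definition restr_section ::
  "'d::finite chart list \<Rightarrow> (nat \<Rightarrow> int) \<Rightarrow> (complex^'d \<Rightarrow> complex) \<Rightarrow> 'd sect" where
  "restr_section C v g = (\<lambda>A y.
     if A \<in> Z_charts C \<and> y \<in> D_in C A then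
       (THE c. \<exists>u. holo_at u y \<and> u y = c \<and>
          (\<forall>\<^sub>F w in nhds y. g (monomial_map A w) = E_gen C v A w * u w))
     else 0)"

definition strict_zeros ::
  "'d::finite chart list \<Rightarrow> (nat \<Rightarrow> int) \<Rightarrow> (complex^'d \<Rightarrow> complex) \<Rightarrow> ('d chart \<times> (complex^'d)) set" where
  "strict_zeros C v g =
     {(A, y). A \<in> Z_charts C \<and> y \<in> D_in C A \<and> restr_section C v g A y = 0}"

definition proj_class :: "'d sect \<Rightarrow> 'd sect set" where
  "proj_class s = {(\<lambda>A y. c * s A y) | c. c \<noteq> 0}"

definition quotient_top :: "'a topology \<Rightarrow> ('a \<Rightarrow> 'b) \<Rightarrow> 'b topology" where
  "quotient_top X f =
     topology (\<lambda>U. U \<subseteq> f ` topspace X \<and> openin X {x \<in> topspace X. f x \<in> U})"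

lemma istopology_quotient:
  "istopology (\<lambda>U. U \<subseteq> f ` topspace X \<and> openin X {x \<in> topspace X. f x \<in> U})"
  unfolding istopology_def
proof (intro conjI allI impI; (elim conjE)?)
  fix S T
  assume "openin X {x \<in> topspace X. f x \<in> S}" "openin X {x \<in> topspace X. f x \<in> T}"
  then have "openin X ({x \<in> topspace X. f x \<in> S} \<inter> {x \<in> topspace X. f x \<in> T})"
    by (rule openin_Int)
  also have "{x \<in> topspace X. f x \<in> S} \<inter> {x \<in> topspace X. f x \<in> T} =
      {x \<in> topspace X. f x \<in> S \<inter> T}" by auto
  finally show "openin X {x \<in> topspace X. f x \<in> S \<inter> T}" .
next
  fix K
  assume K: "\<forall>S\<in>K. S \<subseteq> f ` topspace X \<and> openin X {x \<in> topspace X. f x \<in> S}"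
  then have "openin X (\<Union>S\<in>K. {x \<in> topspace X. f x \<in> S})" by blast
  also have "(\<Union>S\<in>K. {x \<in> topspace X. f x \<in> S}) = {x \<in> topspace X. f x \<in> \<Union>K}" by auto
  finally show "openin X {x \<in> topspace X. f x \<in> \<Union>K}" .
qed auto

lemma quotient_map_quotient_top: "quotient_map X (quotient_top X f) f"
proof -
  have op: "openin (quotient_top X f) U \<longleftrightarrow>
      U \<subseteq> f ` topspace X \<and> openin X {x \<in> topspace X. f x \<in> U}" for U
    unfolding quotient_top_def by (simp add: topology_inverse'[OF istopology_quotient])
  have ts: "topspace (quotient_top X f) = f ` topspace X"
  proof
    show "topspace (quotient_top X f) \<subseteq> f ` topspace X"
      using op openin_topspace by blast
    have "{x \<in> topspace X. f x \<in> f ` topspace X} = topspace X" by auto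
    then show "f ` topspace X \<subseteq> topspace (quotient_top X f)"
      using op[of "f ` topspace X"] by (auto dest: openin_subset)
  qed
  show ?thesis unfolding quotient_map_def using op ts by auto
qed

text \<open>
  The topology on \<open>H\<^sup>0(D, R)\<close> is that of pointwise convergence (product topology on functions).
  As the space is finite-dimensional, this is its unique Hausdorff vector space topology.
\<close>

definition PH0 :: "'d::finite chart list \<Rightarrow> (nat \<Rightarrow> int) \<Rightarrow> 'd sect set topology" where
  "PH0 C v = quotient_top (top_of_set (H0 C v - {\<lambda>A y. 0})) proj_class"

definition D_set :: "'d::finite chart list \<Rightarrow> (nat \<Rightarrow> int) \<Rightarrow> 'd sect set set" where
  "D_set C v = {proj_class (restr_section C v g) | g.
     holo_at g 0 \<and>
     (\<forall>i < length C. 0 \<le> v i \<and> nu C i g = enat (nat (v i))) \<and>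
     (\<forall>a < length C. \<forall>b < length C. a \<noteq> b \<and> E_int C a b \<noteq> {} \<longrightarrow>
        \<not> E_int C a b \<subseteq> strict_zeros C v g)}"

definition D_space :: "'d::finite chart list \<Rightarrow> (nat \<Rightarrow> int) \<Rightarrow> 'd sect set topology" where
  "D_space C v = subtopology (PH0 C v) (D_set C v)"

section \<open>Euler characteristic\<close>

text \<open>
  Rank of a (multiplicatively written) abelian group of finite rank, as the largest number of
  \<open>\<int>\<close>-linearly independent elements.
\<close>

definition int_independent :: "('a, 'b) monoid_scheme \<Rightarrow> 'a set \<Rightarrow> bool" where
  "int_independent G B \<longleftrightarrow> finite B \<and> B \<subseteq> carrier G \<and>
     (\<forall>c :: 'a \<Rightarrow> int. finprod G (\<lambda>b. b [^]\<^bsub>G\<^esub> c b) B = \<one>\<^bsub>G\<^esub> \<longrightarrow> (\<forall>b\<in>B. c b = 0))"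

definition ab_rank :: "('a, 'b) monoid_scheme \<Rightarrow> nat" where
  "ab_rank G = Sup {card B | B. int_independent G B}"

definition euler_char :: "'a topology \<Rightarrow> int" where
  "euler_char X = (\<Sum>p | ab_rank (homology_group (int p) X) \<noteq> 0.
     (-1) ^ p * int (ab_rank (homology_group (int p) X)))"

end

theory Submission
  imports Defs
begin

text \<open>
  All valuations are monomial, so both sides count the monomials \<open>x\<^sup>m\<close> of value exactly \<open>v\<close>.
  For the series: \<open>x\<^sup>m\<close> contributes to \<open>L\<close> the sum of all \<open>t\<^sup>w\<close> with \<open>w \<le> \<nu>(x\<^sup>m)\<close> but not
  \<open>w + 1 \<le> \<nu>(x\<^sup>m)\<close>, which times \<open>\<Prod>i. (t\<^sub>i - 1)\<close> is \<open>t\<^sup>\<nu> (t\<^sub>1 \<cdots> t\<^sub>r - 1)\<close>.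
  For the space: the restriction of \<open>g\<close> to the exceptional divisor depends only on its coefficients
  at the finitely many monomials \<open>m\<close> of value at least \<open>v\<close> with equality in some component, and the conditions
  defining \<open>D\<^sub>v\<close> only concern the set of \<open>m\<close> with nonzero coefficient, and are preserved when this set grows.
  So \<open>D\<^sub>v\<close> is a union of open sets \<open>N\<^sub>S = {[a]. a\<^sub>m \<noteq> 0 for all m in S}\<close> of a projective space.
  These are products of a torus of dimension \<open>|S| - 1\<close> with a vector space, hence of Euler characteristic
  1 if \<open>S\<close> is a singleton and 0 otherwise; as \<open>N\<^sub>S \<inter> N\<^sub>T\<close> is \<open>N\<close> of \<open>S \<union> T\<close>, additivity gives the number of
  admissible singletons.
\<close>

section \<open>Rank of abelian groups\<close>

text \<open>A monomial whose value exceeds \<open>v j\<close> carries a positive power of the local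
  equation of the component j, so it vanishes there; exceeding \<open>v\<close> in every component
  it vanishes on the whole divisor. On an intersection of components a and b the surviving monomials
  are those with equality at a and b, and they remain linearly independent there. No cancellation is
  possible, which is why only supports matter. The case a = b of the same criterion expresses that
  the valuation takes the value \<open>v a\<close>.

  The topological obstacle is that germs reveal only the span of the monomial sections inside
  \<open>H0\<close>. Continuous functionals dual to these sections, built from evaluations at
  points, supply coordinates on the cells without a computation of \<open>H0\<close>. Additivity of
  the Euler characteristic comes from excision and the exact sequence of a pair; finiteness of ranks
  is carried along, because \<open>Sup\<close> of an unbounded set of naturals gives no
  information.\<close>

definition lincomb :: "('a, 'b) monoid_scheme \<Rightarrow> ('i \<Rightarrow> 'a) \<Rightarrow> ('i \<Rightarrow> int) \<Rightarrow> 'i set \<Rightarrow> 'a" where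
  "lincomb G v c I = finprod G (\<lambda>i. v i [^]\<^bsub>G\<^esub> c i) I"

context comm_group
begin

lemma lincomb_closed: "v \<in> I \<rightarrow> carrier G \<Longrightarrow> lincomb G v c I \<in> carrier G"
  unfolding lincomb_def by (rule finprod_closed) (auto intro!: int_pow_closed)

lemma lincomb_add:
  assumes "v \<in> I \<rightarrow> carrier G"
  shows "lincomb G v c I \<otimes> lincomb G v c' I = lincomb G v (\<lambda>i. c i + c' i) I"
proof -
  have "finprod G (\<lambda>i. v i [^] c i \<otimes> v i [^] c' i) I = lincomb G v c I \<otimes> lincomb G v c' I"
    unfolding lincomb_def using assms by (intro finprod_multf) (auto simp: Pi_iff)
  moreover have "finprod G (\<lambda>i. v i [^] c i \<otimes> v i [^] c' i) I = lincomb G v (\<lambda>i. c i + c' i) I"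
    unfolding lincomb_def using assms by (intro finprod_cong') (auto simp: int_pow_mult Pi_iff)
  ultimately show ?thesis by simp
qed

lemma lincomb_zero: "v \<in> I \<rightarrow> carrier G \<Longrightarrow> (\<And>i. i \<in> I \<Longrightarrow> c i = 0) \<Longrightarrow> lincomb G v c I = \<one>"
  unfolding lincomb_def by (rule finprod_one_eqI) auto

lemma lincomb_pow:
  assumes "v \<in> I \<rightarrow> carrier G" "finite I"
  shows "lincomb G v c I [^] (x::int) = lincomb G v (\<lambda>i. c i * x) I"
  using assms(2,1) unfolding lincomb_def
proof (induction I rule: finite_induct)
  case (insert i I)
  then show ?case
    by (simp add: int_pow_distrib int_pow_pow Pi_iff finprod_closed)
qed simp

lemma lincomb_lincomb:
  assumes "finite A" "v \<in> I \<rightarrow> carrier G" "finite I"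
  shows "lincomb G (\<lambda>a. lincomb G v (c a) I) x A = lincomb G v (\<lambda>i. \<Sum>a\<in>A. c a i * x a) I"
  using assms(1)
proof (induction A rule: finite_induct)
  case empty
  then show ?case using assms(2) by (simp add: lincomb_zero) (simp add: lincomb_def)
next
  case (insert a A)
  have "lincomb G (\<lambda>a. lincomb G v (c a) I) x (insert a A) =
      lincomb G v (c a) I [^] x a \<otimes> lincomb G (\<lambda>a. lincomb G v (c a) I) x A"
    using insert unfolding lincomb_def[of G "\<lambda>a. lincomb G v (c a) I"]
    by (subst finprod_insert) (auto intro!: int_pow_closed lincomb_closed assms)
  also have "\<dots> = lincomb G v (\<lambda>i. c a i * x a) I \<otimes> lincomb G v (\<lambda>i. \<Sum>a\<in>A. c a i * x a) I"
    using insert assms by (simp add: lincomb_pow)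
  finally show ?case using insert assms by (simp add: lincomb_add)
qed

lemma lincomb_Un:
  assumes "v \<in> I \<union> J \<rightarrow> carrier G" "finite I" "finite J" "I \<inter> J = {}"
  shows "lincomb G v c (I \<union> J) = lincomb G v c I \<otimes> lincomb G v c J"
  unfolding lincomb_def using assms by (intro finprod_Un_disjoint) (auto intro!: int_pow_closed)

lemma lincomb_mono_neutral:
  assumes "v \<in> I \<rightarrow> carrier G" "finite I" "J \<subseteq> I" "\<And>i. i \<in> I - J \<Longrightarrow> c i = 0"
  shows "lincomb G v c I = lincomb G v c J"
  unfolding lincomb_def
  using assms by (intro finprod_mono_neutral_cong_right) (auto intro!: int_pow_closed)

end

lemma hom_lincomb:
  assumes "comm_group H" "comm_group K" "g \<in> hom H K" "finite I" "v \<in> I \<rightarrow> carrier H"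
  shows "g (lincomb H v c I) = lincomb K (\<lambda>i. g (v i)) c I"
  using assms(4,5)
proof (induction I rule: finite_induct)
  interpret H: comm_group H by fact
  interpret K: comm_group K by fact
  {
    case empty
    show ?case using assms(3) by (simp add: lincomb_def hom_one)
  next
    case (insert i I)
    have gc: "g y \<in> carrier K" if "y \<in> carrier H" for y using assms(3) that by (rule hom_in_carrier)
    have "lincomb H v c (insert i I) = v i [^]\<^bsub>H\<^esub> c i \<otimes>\<^bsub>H\<^esub> lincomb H v c I"
      using insert by (simp add: lincomb_def Pi_iff)
    moreover have "lincomb K (\<lambda>i. g (v i)) c (insert i I) =
        g (v i) [^]\<^bsub>K\<^esub> c i \<otimes>\<^bsub>K\<^esub> lincomb K (\<lambda>i. g (v i)) c I"
      using insert gc unfolding lincomb_def by (subst K.finprod_insert) (auto simp: Pi_iff)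
    moreover have "g (v i [^]\<^bsub>H\<^esub> c i) = g (v i) [^]\<^bsub>K\<^esub> c i"
      using insert assms(3) by (intro hom_int_pow) auto
    ultimately show ?case
      using insert assms(3) H.lincomb_closed[of v I c]
      by (simp add: hom_mult Pi_iff)
  }
qed

text \<open>Families instead of sets, so that independence of the images of an independent set can
  be discussed before these images are known to be distinct.\<close>

definition fam_independent :: "('a, 'b) monoid_scheme \<Rightarrow> ('i \<Rightarrow> 'a) \<Rightarrow> 'i set \<Rightarrow> bool" where
  "fam_independent G v I \<longleftrightarrow> finite I \<and> v \<in> I \<rightarrow> carrier G \<and>
     (\<forall>c. lincomb G v c I = \<one>\<^bsub>G\<^esub> \<longrightarrow> (\<forall>i\<in>I. c i = 0))"

lemma int_independent_iff: "int_independent G B \<longleftrightarrow> fam_independent G (\<lambda>b. b) B"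
  unfolding int_independent_def fam_independent_def lincomb_def by auto

lemma fam_independent_empty: "fam_independent G v {}"
  by (simp add: fam_independent_def)

text \<open>A coincidence \<open>v i = v j\<close> with \<open>i \<noteq> j\<close> would itself be
  a relation, with coefficients 1 and -1.\<close>

lemma (in comm_group) fam_independent_image:
  assumes "fam_independent G v I"
  shows "inj_on v I" "int_independent G (v ` I)"
proof -
  have fin: "finite I" and v: "v \<in> I \<rightarrow> carrier G"
    and ind: "\<And>c. lincomb G v c I = \<one> \<Longrightarrow> \<forall>i\<in>I. c i = 0"
    using assms unfolding fam_independent_def by auto
  show inj: "inj_on v I"
  proof (rule inj_onI, rule ccontr)
    fix i j assume ij: "i \<in> I" "j \<in> I" "v i = v j" "i \<noteq> j"
    define c where "c k = (if k = i then 1 else if k = j then - 1 else (0::int))" for k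
    have "lincomb G v c I = lincomb G v c {i, j}"
      using ij fin v by (intro lincomb_mono_neutral) (auto simp: c_def)
    also have "\<dots> = v i [^] c i \<otimes> v j [^] c j"
      unfolding lincomb_def using ij v by (simp add: Pi_iff)
    also have "\<dots> = \<one>"
      using ij v by (auto simp: c_def int_pow_neg Pi_iff)
    finally have "c i = 0" using ind ij by blast
    then show False by (simp add: c_def)
  qed
  have "\<forall>b\<in>v ` I. c b = 0" if "lincomb G (\<lambda>b. b) c (v ` I) = \<one>" for c
  proof -
    have "lincomb G (\<lambda>b. b) c (v ` I) = lincomb G v (\<lambda>i. c (v i)) I"
      unfolding lincomb_def by (rule finprod_reindex) (use v inj in \<open>auto intro!: int_pow_closed\<close>)
    then show ?thesis using ind[of "\<lambda>i. c (v i)"] that by auto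
  qed
  then show "int_independent G (v ` I)"
    unfolding int_independent_iff fam_independent_def using fin v by auto
qed

text \<open>Finiteness of the rank, stated separately because \<open>sub_rank\<close> is meaningless
  without it. Ranks are attached to subsets of a group so that kernels and images need not be turned
  into groups of their own.\<close>

definition bdd_rank :: "('a, 'b) monoid_scheme \<Rightarrow> 'a set \<Rightarrow> bool" where
  "bdd_rank G S \<longleftrightarrow> (\<exists>N. \<forall>B. int_independent G B \<and> B \<subseteq> S \<longrightarrow> card B \<le> N)"

definition sub_rank :: "('a, 'b) monoid_scheme \<Rightarrow> 'a set \<Rightarrow> nat" where
  "sub_rank G S = Sup {card B | B. int_independent G B \<and> B \<subseteq> S}"

lemma ab_rank_eq_sub_rank: "ab_rank G = sub_rank G (carrier G)"
  unfolding ab_rank_def sub_rank_def int_independent_def by (rule arg_cong[of _ _ Sup]) auto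

lemma card_le_sub_rank:
  assumes "bdd_rank G S" "int_independent G B" "B \<subseteq> S"
  shows "card B \<le> sub_rank G S"
  unfolding sub_rank_def
  by (rule cSup_upper) (use assms in \<open>auto simp: bdd_rank_def bdd_above_def\<close>)

lemma sub_rank_leI:
  assumes "\<And>B. int_independent G B \<Longrightarrow> B \<subseteq> S \<Longrightarrow> card B \<le> n"
  shows "bdd_rank G S" "sub_rank G S \<le> n"
proof -
  show "bdd_rank G S" using assms by (auto simp: bdd_rank_def)
  have "int_independent G {}" by (simp add: int_independent_iff fam_independent_empty)
  then have "{card B | B. int_independent G B \<and> B \<subseteq> S} \<noteq> {}" by blast
  then show "sub_rank G S \<le> n"
    unfolding sub_rank_def by (rule cSup_least) (use assms in auto)
qed

lemma sub_rank_attained: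
  assumes "bdd_rank G S"
  obtains B where "int_independent G B" "B \<subseteq> S" "card B = sub_rank G S"
proof -
  let ?X = "{card B | B. int_independent G B \<and> B \<subseteq> S}"
  have "int_independent G {}" by (simp add: int_independent_iff fam_independent_empty)
  then have "?X \<noteq> {}" by blast
  moreover have "finite ?X"
    using assms unfolding bdd_rank_def finite_nat_set_iff_bounded_le by blast
  ultimately have "Max ?X \<in> ?X" by (rule Max_in[rotated])
  with \<open>?X \<noteq> {}\<close> have "Sup ?X \<in> ?X" unfolding Sup_nat_def by presburger
  then show thesis using that by (auto simp: sub_rank_def)
qed

lemma bdd_rank_mono: "bdd_rank G T \<Longrightarrow> S \<subseteq> T \<Longrightarrow> bdd_rank G S"
  unfolding bdd_rank_def by (meson order_trans)

lemma (in comm_group) one_notin_independent: "int_independent G B \<Longrightarrow> \<one> \<notin> B"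
proof
  assume B: "int_independent G B" "\<one> \<in> B"
  let ?c = "\<lambda>b. if b = \<one> then 1 else (0::int)"
  have "lincomb G (\<lambda>b. b) ?c B = \<one>"
    unfolding lincomb_def by (rule finprod_one_eqI) auto
  then have "?c \<one> = 0" using B unfolding int_independent_iff fam_independent_def by blast
  then show False by simp
qed

section \<open>Rank-nullity for homomorphisms of abelian groups\<close>

context
  fixes H :: "('a, 'x) monoid_scheme" and K :: "('b, 'y) monoid_scheme" and g
  assumes H: "comm_group H" and K: "comm_group K" and g: "g \<in> hom H K"
begin

interpretation H: comm_group H by (rule H)
interpretation K: comm_group K by (rule K)

private lemma gcl: "y \<in> carrier H \<Longrightarrow> g y \<in> carrier K"
  using g by (rule hom_in_carrier)

text \<open>Applying \<open>g\<close> to a relation kills the part from \<open>B1\<close> and leaves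
  a relation on \<open>B2\<close>, so the coefficients at the lifts of \<open>B2\<close> vanish.
  What remains is a relation on \<open>B1\<close>.\<close>

lemma independent_lift:
  assumes B1: "int_independent H B1" "B1 \<subseteq> kernel H K g"
    and B2: "int_independent K B2" "B2 \<subseteq> g ` carrier H"
  shows "\<exists>B. int_independent H B \<and> card B = card B1 + card B2"
proof -
  obtain s where s: "\<And>b. b \<in> B2 \<Longrightarrow> s b \<in> carrier H \<and> g (s b) = b"
    using B2(2) by (metis f_inv_into_f inv_into_into subsetD)
  have injs: "inj_on s B2" by (metis inj_onI s)
  have fin: "finite B1" "finite B2" using B1 B2 by (auto simp: int_independent_def)
  have B1c: "B1 \<subseteq> carrier H" and gB1: "\<And>b. b \<in> B1 \<Longrightarrow> g b = \<one>\<^bsub>K\<^esub>"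
    using B1(2) by (auto simp: kernel_def)
  have disj: "B1 \<inter> s ` B2 = {}"
    using gB1 s K.one_notin_independent[OF B2(1)] by force
  have Bc: "B1 \<union> s ` B2 \<subseteq> carrier H" using B1c s by auto
  have "\<forall>b\<in>B1 \<union> s ` B2. c b = 0" if c: "lincomb H (\<lambda>b. b) c (B1 \<union> s ` B2) = \<one>\<^bsub>H\<^esub>" for c
  proof -
    have "lincomb K g c (B1 \<union> s ` B2) = \<one>\<^bsub>K\<^esub>"
      using hom_lincomb[OF H K g, of "B1 \<union> s ` B2" "\<lambda>b. b" c] c fin Bc g by (simp add: hom_one subset_eq Pi_iff)
    moreover have "lincomb K g c (B1 \<union> s ` B2) = lincomb K g c B1 \<otimes>\<^bsub>K\<^esub> lincomb K g c (s ` B2)"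
      using fin disj Bc gcl by (intro K.lincomb_Un) auto
    moreover have "lincomb K g c B1 = \<one>\<^bsub>K\<^esub>"
      unfolding lincomb_def by (rule K.finprod_one_eqI) (simp add: gB1)
    moreover have "lincomb K g c (s ` B2) = lincomb K (\<lambda>b. b) (\<lambda>b. c (s b)) B2"
    proof -
      have "lincomb K g c (s ` B2) = finprod K (\<lambda>b. g (s b) [^]\<^bsub>K\<^esub> c (s b)) B2"
          unfolding lincomb_def using s injs gcl by (intro K.finprod_reindex) (fastforce intro!: K.int_pow_closed)+
      also have "\<dots> = lincomb K (\<lambda>b. b) (\<lambda>b. c (s b)) B2"
        unfolding lincomb_def using s gcl by (intro K.finprod_cong') (fastforce intro!: K.int_pow_closed)+
      finally show ?thesis .
    qed
    moreover have "lincomb K g c (s ` B2) \<in> carrier K"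
      using s gcl by (intro K.lincomb_closed) auto
    ultimately have "lincomb K (\<lambda>b. b) (\<lambda>b. c (s b)) B2 = \<one>\<^bsub>K\<^esub>" by simp
    then have c2: "\<forall>b\<in>s ` B2. c b = 0"
      using B2(1) unfolding int_independent_iff fam_independent_def
      by (auto dest: spec[of _ "\<lambda>b. c (s b)"])
    have "lincomb H (\<lambda>b. b) c (B1 \<union> s ` B2) = lincomb H (\<lambda>b. b) c B1"
      using fin Bc c2 by (intro H.lincomb_mono_neutral) auto
    then have "\<forall>b\<in>B1. c b = 0"
      using c B1(1) by (simp add: int_independent_iff fam_independent_def)
    with c2 show ?thesis by blast
  qed
  then have "int_independent H (B1 \<union> s ` B2)"
    using fin Bc by (auto simp: int_independent_iff fam_independent_def)
  moreover have "card (B1 \<union> s ` B2) = card B1 + card B2"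
    using fin disj injs by (simp add: card_Un_disjoint card_image)
  ultimately show ?thesis by blast
qed

text \<open>\<open>B2\<close> is the image of a maximal subset \<open>B0\<close> of \<open>B\<close>
  whose images under \<open>g\<close> are independent. By maximality every other element of
  \<open>B\<close> takes part in a relation among the images, and the same combination formed in
  \<open>H\<close> lies in the kernel.\<close>

lemma independent_split:
  assumes B: "int_independent H B"
  shows "\<exists>B1 B2. int_independent H B1 \<and> B1 \<subseteq> kernel H K g \<and>
    int_independent K B2 \<and> B2 \<subseteq> g ` carrier H \<and> card B = card B1 + card B2"
proof -
  have fin: "finite B" and Bc: "B \<subseteq> carrier H" and
    ind: "\<And>c. lincomb H (\<lambda>b. b) c B = \<one>\<^bsub>H\<^esub> \<Longrightarrow> \<forall>b\<in>B. c b = 0"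
    using B by (auto simp: int_independent_iff fam_independent_def)
  let ?P = "\<lambda>B0. B0 \<subseteq> B \<and> fam_independent K g B0"
  have "?P {}" by (simp add: fam_independent_empty)
  then obtain B0 where B0: "?P B0" and max: "\<And>B'. ?P B' \<Longrightarrow> card B' \<le> card B0"
    using ex_has_greatest_nat[of ?P "{}" card "Suc (card B)"] card_mono[OF fin]
    by (metis less_Suc_eq_le)
  have fin0: "finite B0" using B0 fin finite_subset by blast
  have "\<exists>c. lincomb K g c B = \<one>\<^bsub>K\<^esub> \<and> c b \<noteq> 0 \<and> (\<forall>b'\<in>B - B0. b' \<noteq> b \<longrightarrow> c b' = 0)" if b: "b \<in> B - B0" for b
  proof -
    have "\<not> ?P (insert b B0)"
      using max[of "insert b B0"] b fin0 by auto
    moreover have gI: "g \<in> insert b B0 \<rightarrow> carrier K" using b B0 Bc gcl by auto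
    ultimately obtain c where c: "lincomb K g c (insert b B0) = \<one>\<^bsub>K\<^esub>" "\<exists>i\<in>insert b B0. c i \<noteq> 0"
      using b B0 fin0 unfolding fam_independent_def by auto
    define c' where "c' x = (if x \<in> insert b B0 then c x else 0)" for x
    have 1: "lincomb K g c' B = lincomb K g c' (insert b B0)"
      using fin b B0 Bc gcl by (intro K.lincomb_mono_neutral) (auto simp: c'_def)
    also have "\<dots> = lincomb K g c (insert b B0)"
      unfolding lincomb_def using gI
      by (intro K.finprod_cong') (auto simp: c'_def intro!: K.int_pow_closed)
    finally have "lincomb K g c' B = \<one>\<^bsub>K\<^esub>" using c by simp
    \<comment> \<open>With a zero coefficient at \<open>b\<close> this would be a relation on
      \<open>B0\<close> alone.\<close>
    moreover have "c' b \<noteq> 0"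
    proof
      assume z: "c' b = 0"
      have "lincomb K g c' (insert b B0) = lincomb K g c' B0"
        using fin0 gI z b by (intro K.lincomb_mono_neutral) auto
      then have "\<forall>i\<in>B0. c' i = 0"
        using 1 calculation B0 unfolding fam_independent_def by auto
      then show False using c(2) z by (auto simp: c'_def)
    qed
    ultimately show ?thesis by (intro exI[of _ c']) (auto simp: c'_def)
  qed
  then obtain c where c: "\<And>b. b \<in> B - B0 \<Longrightarrow> lincomb K g (c b) B = \<one>\<^bsub>K\<^esub> \<and> c b b \<noteq> 0 \<and>
      (\<forall>b'\<in>B - B0. b' \<noteq> b \<longrightarrow> c b b' = 0)"
    by metis
  define e where "e b = lincomb H (\<lambda>x. x) (c b) B" for b
  have ec: "e b \<in> carrier H" for b unfolding e_def using Bc by (intro H.lincomb_closed) auto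
  have "g (e b) = \<one>\<^bsub>K\<^esub>" if "b \<in> B - B0" for b
    using hom_lincomb[OF H K g fin, of "\<lambda>x. x" "c b"] Bc c[OF that] unfolding e_def by (simp add: subset_eq Pi_iff)
  then have eker: "e ` (B - B0) \<subseteq> kernel H K g" using ec by (auto simp: kernel_def)
  have "fam_independent H e (B - B0)"
    unfolding fam_independent_def
  proof (intro conjI allI impI)
    fix x assume "lincomb H e x (B - B0) = \<one>\<^bsub>H\<^esub>"
    then have "lincomb H (\<lambda>x. x) (\<lambda>i. \<Sum>a\<in>B - B0. c a i * x a) B = \<one>\<^bsub>H\<^esub>"
      using H.lincomb_lincomb[of "B - B0" "\<lambda>x. x" B c x] fin Bc unfolding e_def by (simp add: subset_eq Pi_iff)
    then have z: "\<forall>i\<in>B. (\<Sum>a\<in>B - B0. c a i * x a) = 0" by (rule ind)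
    show "\<forall>i\<in>B - B0. x i = 0"
    proof
      fix i assume i: "i \<in> B - B0"
      \<comment> \<open>On \<open>B - B0\<close> the coefficients of the \<open>e b\<close> form a
        diagonal matrix with nonzero entries.\<close>
      have "(\<Sum>a\<in>B - B0. c a i * x a) = (\<Sum>a\<in>{i}. c a i * x a)"
        using i fin c by (intro sum.mono_neutral_right) auto
      then show "x i = 0" using z i c[OF i] by auto
    qed
  qed (use fin ec in auto)
  from H.fam_independent_image[OF this] have 1: "inj_on e (B - B0)" "int_independent H (e ` (B - B0))" .
  from K.fam_independent_image[of g B0] B0 have 2: "inj_on g B0" "int_independent K (g ` B0)" by auto
  have "card B = card (e ` (B - B0)) + card (g ` B0)"
    using 1 2 B0 fin fin0 by (simp add: card_image card_Diff_subset card_mono)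
  then show ?thesis using 1 2 eker B0 Bc by (intro exI[of _ "e ` (B - B0)"] exI[of _ "g ` B0"]) auto
qed

text \<open>Lifting gives one inequality and splitting the other. Torsion is invisible to the rank,
  since a torsion element belongs to no independent set.\<close>

lemma sub_rank_hom:
  assumes "bdd_rank H (kernel H K g)" "bdd_rank K (g ` carrier H)"
  shows "bdd_rank H (carrier H)"
    "sub_rank H (carrier H) = sub_rank H (kernel H K g) + sub_rank K (g ` carrier H)"
proof -
  have le: "card B \<le> sub_rank H (kernel H K g) + sub_rank K (g ` carrier H)" if "int_independent H B" for B
    using independent_split[OF that] card_le_sub_rank[OF assms(1)] card_le_sub_rank[OF assms(2)]
    by (metis add_mono)
  show b: "bdd_rank H (carrier H)" by (rule sub_rank_leI(1), rule le)
  obtain B1 where B1: "int_independent H B1" "B1 \<subseteq> kernel H K g" "card B1 = sub_rank H (kernel H K g)"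
    using sub_rank_attained[OF assms(1)] .
  obtain B2 where B2: "int_independent K B2" "B2 \<subseteq> g ` carrier H" "card B2 = sub_rank K (g ` carrier H)"
    using sub_rank_attained[OF assms(2)] .
  obtain B where "int_independent H B" "card B = card B1 + card B2"
    using independent_lift[OF B1(1,2) B2(1,2)] by blast
  then have "sub_rank H (kernel H K g) + sub_rank K (g ` carrier H) \<le> sub_rank H (carrier H)"
    using card_le_sub_rank[OF b, of B] B1 B2 by (auto simp: int_independent_def)
  moreover have "sub_rank H (carrier H) \<le> sub_rank H (kernel H K g) + sub_rank K (g ` carrier H)"
    by (rule sub_rank_leI(2), rule le)
  ultimately show "sub_rank H (carrier H) = sub_rank H (kernel H K g) + sub_rank K (g ` carrier H)" by simp
qed

text \<open>The lifting lemma with empty kernel part turns an independent subset of the image into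
  one of the same size in \<open>H\<close>.\<close>

lemma bdd_rank_image:
  assumes "bdd_rank H (carrier H)"
  shows "bdd_rank K (g ` carrier H)"
proof (rule sub_rank_leI)
  fix B assume B: "int_independent K B" "B \<subseteq> g ` carrier H"
  have "int_independent H {}" by (simp add: int_independent_iff fam_independent_empty)
  then obtain B' where "int_independent H B'" "card B' = card B"
    using independent_lift[of "{}" B] B by auto
  then show "card B \<le> sub_rank H (carrier H)"
    using card_le_sub_rank[OF assms, of B'] by (auto simp: int_independent_def)
qed

end

lemma sub_rank_singleton_one:
  assumes "comm_group G"
  shows "bdd_rank G {\<one>\<^bsub>G\<^esub>}" "sub_rank G {\<one>\<^bsub>G\<^esub>} = 0"
proof -
  have "card B \<le> 0" if "int_independent G B" "B \<subseteq> {\<one>\<^bsub>G\<^esub>}" for B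
    using comm_group.one_notin_independent[OF assms that(1)] that(2)
    by (metis card.empty le_refl subset_singletonD insertI1)
  from sub_rank_leI[OF this] show "bdd_rank G {\<one>\<^bsub>G\<^esub>}" "sub_rank G {\<one>\<^bsub>G\<^esub>} = 0" by auto
qed

lemma sub_rank_iso:
  assumes "comm_group G" "comm_group H" "G \<cong> H" "bdd_rank G (carrier G)"
  shows "bdd_rank H (carrier H)" "sub_rank H (carrier H) = sub_rank G (carrier G)"
proof -
  interpret G: comm_group G by fact
  interpret H: comm_group H by fact
  obtain h where h: "h \<in> hom G H" "bij_betw h (carrier G) (carrier H)"
    using assms(3) by (auto simp: is_iso_def iso_def)
  have im: "h ` carrier G = carrier H" using h by (simp add: bij_betw_def)
  have ker: "kernel G H h = {\<one>\<^bsub>G\<^esub>}"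
    using h hom_one[OF h(1)] unfolding kernel_def bij_betw_def
    by (auto dest: inj_onD[of h "carrier G" _ "\<one>\<^bsub>G\<^esub>"])
  show b: "bdd_rank H (carrier H)"
    using bdd_rank_image[OF assms(1,2) h(1) assms(4)] im by simp
  show "sub_rank H (carrier H) = sub_rank G (carrier G)"
    using sub_rank_hom(2)[OF assms(1,2) h(1)] b sub_rank_singleton_one[OF assms(1)] ker im by simp
qed

lemma sub_rank_integer_group:
  "bdd_rank integer_group (carrier integer_group)" "sub_rank integer_group (carrier integer_group) = 1"
proof -
  interpret comm_group integer_group by (rule abelian_integer_group)
  have pw: "x [^]\<^bsub>integer_group\<^esub> (n::int) = n * x" for x n by simp
  have le: "card B \<le> 1" if B: "int_independent integer_group B" for B
  proof (rule ccontr)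
    assume "\<not> card B \<le> 1"
    then obtain a b where ab: "a \<in> B" "b \<in> B" "a \<noteq> b"
      by (metis One_nat_def card_le_Suc0_iff_eq card.infinite le0)
    have fin: "finite B" using B by (simp add: int_independent_def)
    \<comment> \<open>The relation \<open>b * a - a * b = 0\<close> holds between any two integers;
      its coefficients vanish together only if both integers are 0.\<close>
    define c where "c x = (if x = a then b else if x = b then - a else 0)" for x
    have "lincomb integer_group (\<lambda>x. x) c B = lincomb integer_group (\<lambda>x. x) c {a, b}"
      using fin ab by (intro lincomb_mono_neutral) (auto simp: c_def)
    also have "\<dots> = \<one>\<^bsub>integer_group\<^esub>"
      unfolding lincomb_def using ab by (subst finprod_insert) (auto simp: pw c_def)
    finally have "c a = 0" "c b = 0" using B ab by (auto simp: int_independent_iff fam_independent_def)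
    then show False using ab by (auto simp: c_def split: if_splits)
  qed
  have "int_independent integer_group {1}"
    unfolding int_independent_def by (simp add: pw)
  with le show "bdd_rank integer_group (carrier integer_group)" "sub_rank integer_group (carrier integer_group) = 1"
    using sub_rank_leI[of integer_group "carrier integer_group" 1]
      card_le_sub_rank[of integer_group "carrier integer_group" "{1}"] by auto
qed

section \<open>Additivity of the Euler characteristic\<close>

definition betti :: "int \<Rightarrow> 'a topology \<Rightarrow> 'a set \<Rightarrow> nat" where
  "betti p X S = sub_rank (relative_homology_group p X S) (carrier (relative_homology_group p X S))"

text \<open>A relation rather than a function: it records, along with the value, that all ranks are
  finite and vanish in high degrees. Pairs are included so that it can be moved along exact
  sequences.\<close>

definition has_euler :: "'a topology \<Rightarrow> 'a set \<Rightarrow> int \<Rightarrow> bool" where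
  "has_euler X S n \<longleftrightarrow>
     (\<forall>p. bdd_rank (relative_homology_group p X S) (carrier (relative_homology_group p X S))) \<and>
     (\<exists>N::nat. (\<forall>p>int N. betti p X S = 0) \<and> n = (\<Sum>p\<le>N. (-1) ^ p * int (betti (int p) X S)))"

lemma euler_sum_extend:
  assumes "\<forall>p>int N. betti p X S = 0" "N \<le> N'"
  shows "(\<Sum>p\<le>N'. (-1) ^ p * int (betti (int p) X S)) = (\<Sum>p\<le>N. (-1) ^ p * int (betti (int p) X S))"
  using assms by (intro sum.mono_neutral_right) auto

lemma euler_char_eqI:
  assumes "has_euler X {} n"
  shows "euler_char X = n"
proof -
  obtain N where N: "\<forall>p>int N. betti p X {} = 0" "n = (\<Sum>p\<le>N. (-1) ^ p * int (betti (int p) X {}))"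
    using assms unfolding has_euler_def by blast
  have b: "ab_rank (homology_group p X) = betti p X {}" for p
    by (simp add: ab_rank_eq_sub_rank betti_def)
  have "{p. betti (int p) X {} \<noteq> 0} \<subseteq> {..N}" 
  proof
    fix p assume "p \<in> {p. betti (int p) X {} \<noteq> 0}"
    then show "p \<in> {..N}" using N(1)[rule_format, of "int p"] by (cases "p \<le> N") auto
  qed
  then have "(\<Sum>p | betti (int p) X {} \<noteq> 0. (-1) ^ p * int (betti (int p) X {})) = n"
    unfolding N(2) by (intro sum.mono_neutral_left) auto
  then show ?thesis by (simp add: euler_char_def b)
qed

lemma betti_cong:
  assumes "relative_homology_group p X S \<cong> relative_homology_group p Y T"
    and "bdd_rank (relative_homology_group p X S) (carrier (relative_homology_group p X S))"
  shows "bdd_rank (relative_homology_group p Y T) (carrier (relative_homology_group p Y T))"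
    "betti p Y T = betti p X S"
  using sub_rank_iso[OF _ _ assms] by (auto simp: betti_def)

lemma has_euler_cong:
  assumes "\<And>p. relative_homology_group p X S \<cong> relative_homology_group p Y T" "has_euler X S n"
  shows "has_euler Y T n"
  using assms(2) betti_cong[OF assms(1)] unfolding has_euler_def by simp

lemma has_euler_homotopy_equivalent:
  assumes "X homotopy_equivalent_space Y" "has_euler X {} n"
  shows "has_euler Y {} n"
  by (rule has_euler_cong[OF homotopy_equivalent_space_imp_isomorphic_homology_groups[OF assms(1)] assms(2)])

lemma betti_trivial:
  assumes "trivial_group (relative_homology_group p X S)"
  shows "bdd_rank (relative_homology_group p X S) (carrier (relative_homology_group p X S))"
    "betti p X S = 0"
proof -
  have "carrier (relative_homology_group p X S) = {\<one>\<^bsub>relative_homology_group p X S\<^esub>}"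
    using assms by (simp add: trivial_group_def)
  then show "bdd_rank (relative_homology_group p X S) (carrier (relative_homology_group p X S))"
    "betti p X S = 0"
    using sub_rank_singleton_one[OF abelian_relative_homology_group[of p X S]] by (simp_all add: betti_def)
qed

lemma has_euler_empty:
  assumes "topspace X = {}"
  shows "has_euler X S 0"
  using betti_trivial[OF trivial_relative_homology_group_empty[OF assms]]
  unfolding has_euler_def by simp

text \<open>A contractible space has the homotopy type of a point, whose homology is the integers in
  degree 0 and trivial elsewhere.\<close>

lemma has_euler_contractible:
  assumes "contractible_space X" "topspace X \<noteq> {}"
  shows "has_euler X {} 1"
proof -
  obtain a where a: "a \<in> topspace X" "X homotopy_equivalent_space subtopology X {a}"
    using assms contractible_eq_homotopy_equivalent_singleton_subtopology[of X]
    by (metis empty_iff homotopy_equivalent_space_contractibility insertCI subtopology_restrict topspace_discrete_topology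
        null_topspace_iff_trivial)
  let ?Y = "subtopology X {a}"
  have ts: "topspace ?Y = {a}" using a by auto
  have pc: "path_connected_space ?Y"
    using a by (metis contractible_imp_path_connected_space contractible_space_subtopology_singleton)
  have iso0: "integer_group \<cong> homology_group 0 ?Y"
    using isomorphic_integer_zeroth_homology_group[OF pc] ts
    by (metis group.iso_sym group_relative_homology_group insert_not_empty)
  note z = sub_rank_iso[OF abelian_integer_group abelian_homology_group iso0 sub_rank_integer_group(1)]
  note nz = betti_trivial[OF homology_dimension_axiom[OF ts]]
  have "has_euler ?Y {} 1"
    unfolding has_euler_def
  proof (intro conjI allI exI[of _ 0] impI)
    show "bdd_rank (homology_group p ?Y) (carrier (homology_group p ?Y))" for p
      using z(1) nz(1) by (cases "p = 0") auto
    show "betti p ?Y {} = 0" if "int 0 < p" for p using nz(2) that by auto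
    show "1 = (\<Sum>p\<le>0. (-1) ^ p * int (betti (int p) ?Y {}))"
      using z(2) sub_rank_integer_group(2) by (simp add: betti_def)
  qed
  then show ?thesis
    using a(2) has_euler_homotopy_equivalent homotopy_equivalent_space_sym by blast
qed

section \<open>Long exact sequence of a pair\<close>

lemma exact_seqD:
  assumes "exact_seq ([G3, G2, G1], [g2, g1])"
  shows "g1 \<in> hom G1 G2" "g2 \<in> hom G2 G3" "kernel G2 G3 g2 = g1 ` carrier G1"
  using assms by (auto simp: group_hom_def group_hom_axioms_def)

context
  fixes X :: "'a topology" and S :: "'a set"
begin

private abbreviation "HX p \<equiv> homology_group p X"
private abbreviation "HA p \<equiv> homology_group p (subtopology X S)"
private abbreviation "HR p \<equiv> relative_homology_group p X S"
private abbreviation "fi p \<equiv> hom_induced p (subtopology X S) {} X {} id"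
private abbreviation "fj p \<equiv> hom_induced p X {} X S id"
private abbreviation "fd p \<equiv> hom_boundary p X S"

text \<open>Ranks of the images of the three maps of the long exact sequence. The boundary map
  lowers the degree, so \<open>rk_d p\<close> is measured in degree \<open>p - 1\<close>.\<close>

private definition "rk_i p = sub_rank (HX p) (fi p ` carrier (HA p))"
private definition "rk_j p = sub_rank (HR p) (fj p ` carrier (HX p))"
private definition "rk_d p = sub_rank (HA (p - 1)) (fd p ` carrier (HR p))"

private lemmas ex1 = exact_seqD[OF homology_exactness_axiom_1[of _ X S]]
private lemmas ex2 = exact_seqD[OF homology_exactness_axiom_2[of _ X S]]
private lemmas ex3 = exact_seqD[OF homology_exactness_axiom_3[of _ X S]]

private lemma exact_A: "kernel (HA p) (HX p) (fi p) = fd (p + 1) ` carrier (HR (p + 1))"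
  using ex2(3)[of "p + 1"] by simp

private lemma rank_X:
  assumes "bdd_rank (HA p) (carrier (HA p))" "bdd_rank (HR p) (carrier (HR p))"
  shows "bdd_rank (HX p) (carrier (HX p))"
proof (rule sub_rank_hom(1))
  show "comm_group (HX p)" "comm_group (HR p)" by simp_all
  show "fj p \<in> hom (HX p) (HR p)" by (rule ex3(2))
  show "bdd_rank (HX p) (kernel (HX p) (HR p) (fj p))"
    unfolding ex3(3) by (rule bdd_rank_image[OF _ _ ex3(1) assms(1)]) simp_all
  show "bdd_rank (HR p) (fj p ` carrier (HX p))"
    using assms(2) by (rule bdd_rank_mono) (use ex3(2)[of p] in \<open>auto simp: hom_def\<close>)
qed

private lemma rank_R:
  assumes "bdd_rank (HX p) (carrier (HX p))" "bdd_rank (HA (p - 1)) (carrier (HA (p - 1)))"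
  shows "bdd_rank (HR p) (carrier (HR p))"
proof (rule sub_rank_hom(1))
  show "comm_group (HR p)" "comm_group (HA (p - 1))" by simp_all
  show "fd p \<in> hom (HR p) (HA (p - 1))" by (rule ex1(2))
  show "bdd_rank (HR p) (kernel (HR p) (HA (p - 1)) (fd p))"
    unfolding ex1(3) by (rule bdd_rank_image[OF _ _ ex1(1) assms(1)]) simp_all
  show "bdd_rank (HA (p - 1)) (fd p ` carrier (HR p))"
    using assms(2) by (rule bdd_rank_mono) (use ex1(2)[of p] in \<open>auto simp: hom_def\<close>)
qed

text \<open>By exactness the kernel of each map is the image of the preceding one, so each Betti
  number is the rank of an incoming image plus that of an outgoing one.\<close>

private lemma rank_eqs:
  assumes bdd: "\<And>p. bdd_rank (HA p) (carrier (HA p))" "\<And>p. bdd_rank (HX p) (carrier (HX p))"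
    "\<And>p. bdd_rank (HR p) (carrier (HR p))"
  shows "betti p (subtopology X S) {} = rk_d (p + 1) + rk_i p"
    "betti p X {} = rk_i p + rk_j p" "betti p X S = rk_j p + rk_d p"
proof -
  have im: "fi p ` carrier (HA p) \<subseteq> carrier (HX p)" "fj p ` carrier (HX p) \<subseteq> carrier (HR p)"
    "fd p ` carrier (HR p) \<subseteq> carrier (HA (p - 1))" for p
    using ex3[of p] ex1[of p] by (auto simp: hom_def)
  have im': "fd (p + 1) ` carrier (HR (p + 1)) \<subseteq> carrier (HA p)" for p
    using im(3)[of "p + 1"] by simp
  note b = bdd[THEN bdd_rank_mono]
  show "betti p (subtopology X S) {} = rk_d (p + 1) + rk_i p"
    using sub_rank_hom(2)[OF _ _ ex3(1), of p] b im im'[of p] unfolding exact_A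
    by (simp add: betti_def rk_d_def rk_i_def)
  show "betti p X {} = rk_i p + rk_j p"
    using sub_rank_hom(2)[OF _ _ ex3(2), of p] b im unfolding ex3(3)
    by (simp add: betti_def rk_j_def rk_i_def)
  show "betti p X S = rk_j p + rk_d p"
    using sub_rank_hom(2)[OF _ _ ex1(2), of p] b im unfolding ex1(3)
    by (simp add: betti_def rk_j_def rk_d_def)
qed

text \<open>The images under \<open>fi\<close> and \<open>fj\<close> cancel degree by degree, and
  those under the boundary map telescope. Both ends of the telescope vanish: there is no homology in
  degree -1, and the subspace has Betti number 0 in degree \<open>N\<close>.\<close>

private lemma euler_sums:
  assumes bdd: "\<And>p. bdd_rank (HA p) (carrier (HA p))" "\<And>p. bdd_rank (HX p) (carrier (HX p))"
    "\<And>p. bdd_rank (HR p) (carrier (HR p))"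
    and N: "betti (int N) (subtopology X S) {} = 0"
  shows "(\<Sum>p\<le>N. (-1) ^ p * int (betti (int p) X {})) =
     (\<Sum>p\<le>N. (-1) ^ p * int (betti (int p) (subtopology X S) {})) +
     (\<Sum>p\<le>N. (-1) ^ p * int (betti (int p) X S))"
proof -
  note eqs = rank_eqs[OF bdd]
  have "betti (- 1) (subtopology X S) {} = 0" by (rule betti_trivial) simp
  then have d0: "rk_d 0 = 0" using eqs(1)[of "-1"] by simp
  have dN: "rk_d (int N + 1) = 0" using eqs(1)[of "int N"] N by simp
  have tel: "(\<Sum>p\<le>M. (-1) ^ p * int (rk_d (int p + 1))) + (\<Sum>p\<le>M. (-1) ^ p * int (rk_d (int p)))
      = (-1) ^ M * int (rk_d (int M + 1))" for M
    by (induction M) (auto simp: d0 algebra_simps)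
  show ?thesis
    using tel[of N] dN unfolding eqs by (simp add: algebra_simps sum.distrib)
qed

lemma has_euler_exact:
  assumes "has_euler (subtopology X S) {} a" "has_euler X S n"
  shows "has_euler X {} (a + n)"
proof -
  obtain N where N: "\<forall>p>int N. betti p (subtopology X S) {} = 0"
    "a = (\<Sum>p\<le>N. (-1) ^ p * int (betti (int p) (subtopology X S) {}))"
    and bA: "\<And>p. bdd_rank (HA p) (carrier (HA p))"
    using assms(1) unfolding has_euler_def by blast
  obtain M where M: "\<forall>p>int M. betti p X S = 0"
    "n = (\<Sum>p\<le>M. (-1) ^ p * int (betti (int p) X S))"
    and bR: "\<And>p. bdd_rank (HR p) (carrier (HR p))"
    using assms(2) unfolding has_euler_def by blast
  have bX: "bdd_rank (HX p) (carrier (HX p))" for p using rank_X bA bR by blast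
  \<comment> \<open>One beyond both bounds, so that the subspace has Betti number 0 already in the
    top degree of the truncated sum.\<close>
  let ?L = "Suc (max N M)"
  have "betti p X {} = 0" if "p > int ?L" for p
    using rank_eqs[OF bA bX bR, of p] N(1) M(1) that by force
  moreover have "a + n = (\<Sum>p\<le>?L. (-1) ^ p * int (betti (int p) X {}))"
    using euler_sums[OF bA bX bR, of ?L] N(1) euler_sum_extend[OF N(1), of ?L] euler_sum_extend[OF M(1), of ?L]
    unfolding N(2) M(2) by (simp del: sum.atMost_Suc)
  ultimately show ?thesis using bX unfolding has_euler_def by blast
qed

lemma has_euler_relative:
  assumes "has_euler (subtopology X S) {} a" "has_euler X {} n"
  shows "has_euler X S (n - a)"
proof -
  obtain N where N: "\<forall>p>int N. betti p (subtopology X S) {} = 0"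
    "a = (\<Sum>p\<le>N. (-1) ^ p * int (betti (int p) (subtopology X S) {}))"
    and bA: "\<And>p. bdd_rank (HA p) (carrier (HA p))"
    using assms(1) unfolding has_euler_def by blast
  obtain M where M: "\<forall>p>int M. betti p X {} = 0"
    "n = (\<Sum>p\<le>M. (-1) ^ p * int (betti (int p) X {}))"
    and bX: "\<And>p. bdd_rank (HX p) (carrier (HX p))"
    using assms(2) unfolding has_euler_def by blast
  have bR: "bdd_rank (HR p) (carrier (HR p))" for p using rank_R bA bX by blast
  let ?L = "Suc (max N M)"
  \<comment> \<open>The relative group in degree \<open>p\<close> also sees the subspace in degree
    \<open>p - 1\<close>, which is still beyond \<open>N\<close>.\<close>
  have "betti p X S = 0" if "p > int ?L" for p
    using rank_eqs[OF bA bX bR, of p] rank_eqs(1)[OF bA bX bR, of "p - 1"] N(1) M(1) that by force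
  moreover have "n - a = (\<Sum>p\<le>?L. (-1) ^ p * int (betti (int p) X S))"
    using euler_sums[OF bA bX bR, of ?L] N(1) euler_sum_extend[OF N(1), of ?L] euler_sum_extend[OF M(1), of ?L]
    unfolding N(2) M(2) by (simp del: sum.atMost_Suc)
  ultimately show ?thesis using bR unfolding has_euler_def by blast
qed

end

text \<open>The complement of \<open>B\<close> is excised: it is closed and contained in the open
  set \<open>A\<close>, so its closure lies in the interior of \<open>A\<close>.\<close>

lemma excision_open_cover:
  assumes "openin X A" "openin X B" "topspace X = A \<union> B"
  shows "relative_homology_group p (subtopology X B) (A \<inter> B) \<cong> relative_homology_group p X A"
proof -
  let ?U = "topspace X - B"
  have "X closure_of ?U = ?U" using assms(2) by (simp add: closure_of_closedin closedin_diff)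
  moreover have "X interior_of A = A" using assms(1) by (simp add: interior_of_openin)
  moreover have "topspace X - ?U = B" "A - ?U = A \<inter> B" using assms(3) by auto
  ultimately show ?thesis
    using homology_excision_axiom[of X ?U A "topspace X" p] unfolding subtopology_topspace is_iso_def
    using assms(3) by (metis Diff_subset_conv empty_iff sup_commute subset_refl sup_ge1)
qed

text \<open>Mayer-Vietoris in numerical form. The exact sequence of the pair of \<open>B\<close> and
  \<open>A \<inter> B\<close> gives \<open>b - c\<close>; excision transports this value to the pair
  of \<open>A \<union> B\<close> and \<open>A\<close>, whose exact sequence adds
  \<open>a\<close>.\<close>

lemma has_euler_Un:
  assumes "openin X A" "openin X B" "has_euler (subtopology X A) {} a" "has_euler (subtopology X B) {} b"
    and "has_euler (subtopology X (A \<inter> B)) {} c"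
  shows "has_euler (subtopology X (A \<union> B)) {} (a + b - c)"
proof -
  let ?Y = "subtopology X (A \<union> B)"
  have sub: "A \<subseteq> topspace X" "B \<subseteq> topspace X" using assms(1,2) by (auto dest: openin_subset)
  have op: "openin ?Y A" "openin ?Y B" "topspace ?Y = A \<union> B"
    using assms(1,2) sub by (auto simp: openin_subtopology)
  have eq: "subtopology ?Y A = subtopology X A" "subtopology ?Y B = subtopology X B"
    "subtopology (subtopology X B) (A \<inter> B) = subtopology X (A \<inter> B)"
    by (auto simp: subtopology_subtopology Int_absorb1 Int_absorb2 Int_ac)
  have "has_euler (subtopology X B) (A \<inter> B) (b - c)"
    using has_euler_relative[of "subtopology X B" "A \<inter> B" c b] assms(4,5) eq(3) by simp
  then have "has_euler ?Y A (b - c)"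
    using has_euler_cong[OF excision_open_cover[OF op]] eq by metis
  then have "has_euler ?Y {} (a + (b - c))"
    using has_euler_exact[of ?Y A a] assms(3) eq by simp
  then show ?thesis by (simp add: algebra_simps)
qed

text \<open>One set \<open>S\<close> is split off. Its intersection with the remaining union is the
  union of the \<open>N (S \<union> T)\<close>, again a family with fewer members than
  \<open>K\<close>, so strong induction on the number of members covers both. As \<open>T\<close> is
  nonempty and differs from \<open>S\<close>, no \<open>S \<union> T\<close> is a singleton, and the
  intersection has value 0.\<close>

lemma has_euler_UN_lattice:
  assumes op: "\<And>S. S \<noteq> {} \<Longrightarrow> finite S \<Longrightarrow> S \<subseteq> M \<Longrightarrow> openin X (N S)"
    and Int: "\<And>S T. S \<noteq> {} \<Longrightarrow> T \<noteq> {} \<Longrightarrow> N S \<inter> N T = N (S \<union> T)"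
    and eul: "\<And>S. S \<noteq> {} \<Longrightarrow> finite S \<Longrightarrow> S \<subseteq> M \<Longrightarrow>
       has_euler (subtopology X (N S)) {} (if card S = 1 then 1 else 0)"
    and K: "finite K" "\<And>S. S \<in> K \<Longrightarrow> S \<noteq> {} \<and> finite S \<and> S \<subseteq> M"
  shows "has_euler (subtopology X (\<Union>S\<in>K. N S)) {} (int (card {S \<in> K. card S = 1}))"
  using K
proof (induction "card K" arbitrary: K rule: less_induct)
  case less
  show ?case
  proof (cases "K = {}")
    case True
    then show ?thesis by (simp add: has_euler_empty)
  next
    case False
    then obtain S K' where K: "K = insert S K'" "S \<notin> K'"
      by (metis Set.set_insert ex_in_conv)
    have fin: "finite K'" using less.prems K by simp
    have cK: "card K = Suc (card K')" using K fin by simp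
    have S: "S \<noteq> {}" "finite S" "S \<subseteq> M" using less.prems(2) K by auto
    have K': "\<And>T. T \<in> K' \<Longrightarrow> T \<noteq> {} \<and> finite T \<and> T \<subseteq> M" using less.prems(2) K by auto
    define L where "L = (\<lambda>T. S \<union> T) ` K'"
    have L: "\<And>T. T \<in> L \<Longrightarrow> T \<noteq> {} \<and> finite T \<and> T \<subseteq> M" "finite L"
      using S K' fin by (auto simp: L_def)
    have cL: "card L < card K" using card_image_le[OF fin, of "\<lambda>T. S \<union> T"] cK by (simp add: L_def)
    have "card T \<noteq> 1" if "T \<in> L" for T
    proof
      assume "card T = 1"
      then obtain x where x: "T = {x}" by (auto simp: card_1_singleton_iff)
      obtain T' where "T' \<in> K'" "T = S \<union> T'" using \<open>T \<in> L\<close> by (auto simp: L_def)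
      then have "T' = S" using x S K' by (metis Un_upper1 Un_upper2 subset_singletonD)
      then show False using K \<open>T' \<in> K'\<close> by simp
    qed
    then have "{T \<in> L. card T = 1} = {}" by blast
    then have eL: "has_euler (subtopology X (\<Union>T\<in>L. N T)) {} 0"
      using less.hyps[OF cL L(2,1)] by (simp only: card.empty of_nat_0)
    have "N S \<inter> (\<Union>T\<in>K'. N T) = (\<Union>T\<in>L. N T)"
      unfolding L_def using Int[OF S(1)] K' by (simp add: Int_UN_distrib)
    then have e2: "has_euler (subtopology X (N S \<inter> (\<Union>T\<in>K'. N T))) {} 0"
      using eL by simp
    have e1: "has_euler (subtopology X (\<Union>T\<in>K'. N T)) {} (int (card {S \<in> K'. card S = 1}))"
      using less.hyps[of K'] cK fin K' by simp
    have o1: "openin X (\<Union>T\<in>K'. N T)" 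
    proof (rule openin_Union)
      fix U assume "U \<in> N ` K'"
      then obtain T where "T \<in> K'" "U = N T" by auto
      then show "openin X U" using op[of T] K'[of T] by simp
    qed
    have "has_euler (subtopology X (N S \<union> (\<Union>T\<in>K'. N T))) {}
        ((if card S = 1 then 1 else 0) + int (card {S \<in> K'. card S = 1}) - 0)"
      by (rule has_euler_Un[OF op o1 eul e1 e2]) (use S in auto)
    moreover have "{T \<in> K. card T = 1} =
        (if card S = 1 then insert S {T \<in> K'. card T = 1} else {T \<in> K'. card T = 1})"
      using K by auto
    ultimately show ?thesis using K fin by (simp split: if_splits)
  qed
qed

section \<open>Products of punctured planes and contractible sets\<close>

lemma starlike_slit_right: "starlike (- \<real>\<^sub>\<ge>\<^sub>0 :: complex set)"
proof -
  have "(\<real>\<^sub>\<ge>\<^sub>0 :: complex set) = complex_of_real ` {0..}"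
    by (auto simp: complex_nonneg_Reals_iff complex_eq_iff image_iff)
  then show ?thesis using starlike_slotted_complex_plane_right[of 0] by simp
qed

lemma starlike_slit_left: "starlike (- \<real>\<^sub>\<le>\<^sub>0 :: complex set)"
proof -
  have "(\<real>\<^sub>\<le>\<^sub>0 :: complex set) = complex_of_real ` {..0}"
    by (auto simp: complex_nonpos_Reals_iff complex_eq_iff image_iff)
  then show ?thesis using starlike_slotted_complex_plane_left[of 0] by simp
qed

text \<open>
  Each factor \<open>\<complex> - {0}\<close> is the union of two slit planes whose intersection is the union of two disjoint
  half planes; these four sets are contractible, so additivity gives \<open>\<chi> = e + e - (e + e) = 0\<close>.
\<close>

lemma has_euler_box:
  fixes K :: "'i \<Rightarrow> complex set"
  assumes I: "finite I"
    and J: "finite J" "J \<subseteq> I" "\<And>m. m \<in> J \<Longrightarrow> K m = - {0}"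
    and K: "\<And>m. m \<in> I - J \<Longrightarrow> contractible (K m) \<and> K m \<noteq> {}"
  shows "has_euler (product_topology (\<lambda>m. top_of_set (K m)) I) {} (if J = {} then 1 else 0)"
  using J K
proof (induction J arbitrary: K rule: finite_induct)
  case empty
  let ?X = "product_topology (\<lambda>m. top_of_set (K m)) I"
  have "contractible_space ?X"
    using empty by (subst contractible_space_product_topology) auto
  moreover have "topspace ?X \<noteq> {}"
    using empty by (simp add: PiE_eq_empty_iff)
  ultimately show ?case by (simp add: has_euler_contractible)
next
  case (insert j J)
  define B where "B U = (\<Pi>\<^sub>E m\<in>I. if m = j then U else K m)" for U
  define X where "X = product_topology (\<lambda>m. top_of_set (K m)) I"
  have j: "j \<in> I" "K j = - {0}" using insert by auto
  define e where "e = (if J = {} then 1 else (0::int))"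
  have sub: "subtopology X (B U) = product_topology (\<lambda>m. top_of_set ((K(j := U)) m)) I" if "U \<subseteq> - {0}" for U
  proof -
    have "subtopology X (B U) = product_topology (\<lambda>m. subtopology (top_of_set (K m)) (if m = j then U else K m)) I"
      unfolding X_def B_def by (rule subtopology_product_topology)
    moreover have "subtopology (top_of_set (K m)) (if m = j then U else K m) = top_of_set ((K(j := U)) m)" for m
      using that j by (auto simp: subtopology_subtopology Int_absorb1)
    ultimately show ?thesis by simp
  qed
  have op: "openin X (B U)" if "open U" "U \<subseteq> - {0}" for U
  proof -
    have "openin (top_of_set (K m)) (if m = j then U else K m)" for m
      using that j by (auto intro!: open_openin_trans)
    then show ?thesis unfolding X_def B_def using I by (subst openin_PiE) auto
  qed
  \<comment> \<open>A contractible factor at \<open>j\<close> makes \<open>j\<close> an index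
    outside \<open>J\<close>, so the induction hypothesis applies to the modified family of
    factors.\<close>
  have eul: "has_euler (subtopology X (B U)) {} e" if "contractible U" "U \<noteq> {}" "U \<subseteq> - {0}" for U
    unfolding sub[OF that(3)] e_def
  proof (rule insert.IH)
    show "(K(j := U)) m = - {0}" if "m \<in> J" for m using that insert by auto
    show "contractible ((K(j := U)) m) \<and> (K(j := U)) m \<noteq> {}" if "m \<in> I - J" for m
      using that insert \<open>contractible U\<close> \<open>U \<noteq> {}\<close> by auto
  qed (use insert in auto)
  have Bsets: "B U \<union> B V = B (U \<union> V)" "B U \<inter> B V = B (U \<inter> V)" for U V
    unfolding B_def using j(1) by (auto simp: PiE_iff split: if_splits)
  let ?Up = "{z. Im z > 0}" and ?Lo = "{z. Im z < 0}" and ?R = "- \<real>\<^sub>\<ge>\<^sub>0 :: complex set" and ?L = "- \<real>\<^sub>\<le>\<^sub>0 :: complex set"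
  have o: "open ?Up" "open ?Lo" "open ?R" "open ?L"
    by (auto simp: open_halfspace_Im_gt open_halfspace_Im_lt intro: open_Compl)
  have s: "?Up \<subseteq> - {0}" "?Lo \<subseteq> - {0}" "?R \<subseteq> - {0}" "?L \<subseteq> - {0}" by auto
  have c: "contractible ?Up" "contractible ?Lo" "contractible ?R" "contractible ?L"
    using starlike_slit_right starlike_slit_left
    by (auto intro: convex_imp_contractible convex_halfspace_Im_gt convex_halfspace_Im_lt starlike_imp_contractible)
  have n: "?Up \<noteq> {}" "?Lo \<noteq> {}" "?R \<noteq> {}" "?L \<noteq> {}"
  proof -
    show "?Up \<noteq> {}" by (rule ex_in_conv[THEN iffD1], rule exI[of _ "\<i>"]) simp
    show "?Lo \<noteq> {}" by (rule ex_in_conv[THEN iffD1], rule exI[of _ "-\<i>"]) simp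
    show "?R \<noteq> {}" by (rule ex_in_conv[THEN iffD1], rule exI[of _ "-1"]) (simp add: complex_nonneg_Reals_iff)
    show "?L \<noteq> {}" by (rule ex_in_conv[THEN iffD1], rule exI[of _ "1"]) (simp add: complex_nonpos_Reals_iff)
  qed
  have i: "?Up \<inter> ?Lo = {}" "?R \<union> ?L = - {0}" "?R \<inter> ?L = ?Up \<union> ?Lo"
    by (auto simp: complex_nonneg_Reals_iff complex_nonpos_Reals_iff complex_eq_iff)
  have "B {} = {}" using j(1) by (auto simp: B_def)
  then have "has_euler (subtopology X (B ?Up \<inter> B ?Lo)) {} 0"
    by (simp add: has_euler_empty Bsets i)
  then have "has_euler (subtopology X (B ?Up \<union> B ?Lo)) {} (e + e - 0)"
    by (intro has_euler_Un op eul o s c n)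
  then have 2: "has_euler (subtopology X (B ?R \<inter> B ?L)) {} (e + e)"
    unfolding Bsets i by simp
  have "has_euler (subtopology X (B ?R \<union> B ?L)) {} (e + e - (e + e))"
    by (intro has_euler_Un op eul o s c n 2)
  then have "has_euler (subtopology X (B (- {0}))) {} 0"
    unfolding Bsets i by simp
  moreover have "K(j := - {0}) = K" by (rule fun_upd_idem) (rule j(2))
  ultimately show ?case using sub[of "- {0}"] by (simp add: X_def)
qed

section \<open>Monomial expansions of germs\<close>

definition mpow :: "complex^'d \<Rightarrow> nat^'d \<Rightarrow> complex" where
  "mpow y n = (\<Prod>k\<in>UNIV. (y $ k) ^ (n $ k))"

lemma norm_mpow: "norm (mpow y n) = (\<Prod>k\<in>UNIV. norm (y $ k) ^ (n $ k))"
  by (simp add: mpow_def norm_power flip: prod_norm)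

lemma norm_mpow_mono: "(\<And>k. norm (y $ k) \<le> norm (z $ k)) \<Longrightarrow> norm (mpow y n) \<le> norm (mpow z n)"
  unfolding norm_mpow by (intro prod_mono) (auto intro: power_mono)

lemma mpow_scale:
  "mpow (\<chi> k. if k = j then c * y $ k else y $ k) n = c ^ (n $ j) * mpow (y :: complex^'d::finite) n"
proof -
  have "mpow (\<chi> k. if k = j then c * y $ k else y $ k) n =
      (\<Prod>k\<in>UNIV. (if k = j then c ^ (n $ j) else 1) * (y $ k) ^ (n $ k))"
    unfolding mpow_def by (intro prod.cong) (auto simp: power_mult_distrib)
  then show ?thesis by (simp add: prod.distrib mpow_def)
qed

text \<open>Stated over a general semiring because it serves twice: over the complex numbers for an
  expansion and over the reals for its majorant.\<close>

lemma mpow_binomial: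
  fixes y h :: "'a::comm_semiring_1 ^ 'd::finite"
  shows "((\<Prod>k\<in>UNIV. (y $ k + h $ k) ^ (n $ k))) =
    (\<Sum>\<alpha>\<in>{\<alpha>. \<forall>k. \<alpha> $ k \<le> n $ k}. (\<Prod>k\<in>UNIV. of_nat (n $ k choose \<alpha> $ k) * (y $ k) ^ (n $ k - \<alpha> $ k)) *
       (\<Prod>k\<in>UNIV. (h $ k) ^ (\<alpha> $ k)))" (is "_ = (\<Sum>\<alpha>\<in>?B. ?g \<alpha>)")
    and "finite {\<alpha> :: nat^'d. \<forall>k. \<alpha> $ k \<le> n $ k}"
proof -
  let ?P = "PiE UNIV (\<lambda>k. {..n $ k})"
  have img: "?B = vec_lambda ` ?P"
  proof
    show "?B \<subseteq> vec_lambda ` ?P"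
      by (auto intro!: image_eqI[where x = "vec_nth _"])
  qed auto
  show "finite ?B" unfolding img by (intro finite_imageI finite_PiE) auto
  have "(\<Prod>k\<in>UNIV. (y $ k + h $ k) ^ (n $ k)) =
      (\<Prod>k\<in>UNIV. \<Sum>j\<in>{..n $ k}. of_nat (n $ k choose j) * (h $ k) ^ j * (y $ k) ^ (n $ k - j))"
    by (intro prod.cong refl) (simp add: binomial_ring add.commute[of "y $ _"])
  also have "\<dots> = (\<Sum>p\<in>?P. \<Prod>k\<in>UNIV. of_nat (n $ k choose p k) * (h $ k) ^ p k * (y $ k) ^ (n $ k - p k))"
    by (rule prod_sum_PiE) auto
  also have "\<dots> = (\<Sum>p\<in>?P. ?g (vec_lambda p))"
    by (intro sum.cong refl) (simp add: prod.distrib[symmetric] mult_ac)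
  also have "\<dots> = (\<Sum>\<alpha>\<in>?B. ?g \<alpha>)"
    unfolding img by (subst sum.reindex) (auto intro!: inj_onI simp: vec_lambda_inject)
  finally show "(\<Prod>k\<in>UNIV. (y $ k + h $ k) ^ (n $ k)) = (\<Sum>\<alpha>\<in>?B. ?g \<alpha>)" .
qed

text \<open>Each monomial is expanded at \<open>y\<close> by the binomial formula. With absolute
  values everywhere, the base \<open>y + h\<close> becomes \<open>|y| + |h|\<close>, which stays
  inside the polyradius \<open>R\<close>; the double family is therefore summable and the order of
  summation can be exchanged.\<close>

lemma holo_at_monomial_series:
  fixes c :: "'i \<Rightarrow> complex" and n :: "'i \<Rightarrow> nat^'d::finite" and y R :: "complex^'d"
  assumes abs: "(\<lambda>i. c i * mpow R (n i)) summable_on S"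
    and less: "\<And>k. norm (y $ k) < norm (R $ k)"
  shows "holo_at (\<lambda>w. \<Sum>\<^sub>\<infinity>i\<in>S. c i * mpow w (n i)) y"
proof -
  \<comment> \<open>The smallest gap between \<open>y\<close> and \<open>R\<close>: a shorter
    \<open>h\<close> cannot leave the polydisc in any coordinate.\<close>
  define e where "e = Min (range (\<lambda>k. norm (R $ k) - norm (y $ k)))"
  have e: "e > 0" "\<And>k. e \<le> norm (R $ k) - norm (y $ k)"
    unfolding e_def using less by (auto simp: Min_gr_iff)
  define b where "b i \<alpha> = c i * (\<Prod>k\<in>UNIV. of_nat (n i $ k choose \<alpha> $ k) * (y $ k) ^ (n i $ k - \<alpha> $ k))" for i \<alpha>
  have "((\<lambda>\<alpha>. (\<Sum>\<^sub>\<infinity>i\<in>S. b i \<alpha>) * (\<Prod>k\<in>UNIV. (h $ k) ^ (\<alpha> $ k))) has_sum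
      (\<Sum>\<^sub>\<infinity>i\<in>S. c i * mpow (y + h) (n i))) UNIV" if h: "norm h < e" for h
  proof -
    define f where "f = (\<lambda>(i, \<alpha>). b i \<alpha> * mpow h \<alpha>)"
    have hk: "norm (y $ k) + norm (h $ k) \<le> norm (R $ k)" for k
      using e(2)[of k] h Finite_Cartesian_Product.norm_nth_le[of h k] by linarith
    have inner: "((\<lambda>\<alpha>. f (i, \<alpha>)) has_sum c i * mpow (y + h) (n i)) UNIV" for i
    proof (rule has_sum_finite_neutralI[OF mpow_binomial(2)[of "n i"]])
      show "f (i, \<alpha>) = 0" if "\<alpha> \<in> UNIV - {\<alpha>. \<forall>k. \<alpha> $ k \<le> n i $ k}" for \<alpha>
      proof -
        have "\<exists>k. \<alpha> $ k > n i $ k" using that by (auto simp: not_le)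
        then obtain k where "\<alpha> $ k > n i $ k" ..
        then show ?thesis by (auto simp: f_def b_def)
      qed
      show "c i * mpow (y + h) (n i) = (\<Sum>\<alpha>\<in>{\<alpha>. \<forall>k. \<alpha> $ k \<le> n i $ k}. f (i, \<alpha>))"
        unfolding mpow_def vector_add_component mpow_binomial(1)[of y h "n i"]
        by (simp add: f_def b_def mpow_def sum_distrib_left mult_ac)
    qed simp
    define t where "t i = norm (c i) * (\<Prod>k\<in>UNIV. (norm (y $ k) + norm (h $ k)) ^ (n i $ k))" for i
    have inner_norm: "((\<lambda>\<alpha>. norm (f (i, \<alpha>))) has_sum t i) UNIV" for i
    proof (rule has_sum_finite_neutralI[OF mpow_binomial(2)[of "n i"]])
      show "norm (f (i, \<alpha>)) = 0" if "\<alpha> \<in> UNIV - {\<alpha>. \<forall>k. \<alpha> $ k \<le> n i $ k}" for \<alpha>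
      proof -
        have "\<exists>k. \<alpha> $ k > n i $ k" using that by (auto simp: not_le)
        then obtain k where "\<alpha> $ k > n i $ k" ..
        then show ?thesis by (auto simp: f_def b_def)
      qed
      show "t i = (\<Sum>\<alpha>\<in>{\<alpha>. \<forall>k. \<alpha> $ k \<le> n i $ k}. norm (f (i, \<alpha>)))"
        using mpow_binomial(1)[of "\<chi> k. norm (y $ k)" "\<chi> k. norm (h $ k)" "n i"]
        by (simp add: t_def f_def b_def norm_mpow norm_mult norm_power sum_distrib_left mult_ac flip: prod_norm)
    qed simp
    have "t summable_on S"
    proof (rule summable_on_comparison_test)
      show "(\<lambda>i. norm (c i * mpow R (n i))) summable_on S"
        by (rule summable_on_iff_abs_summable_on_complex[THEN iffD1, OF abs])
      show "t i \<le> norm (c i * mpow R (n i))" for i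
        unfolding t_def norm_mult norm_mpow
        by (intro mult_left_mono prod_mono) (use hk in \<open>auto intro!: power_mono\<close>)
      show "0 \<le> t i" for i unfolding t_def by (intro mult_nonneg_nonneg prod_nonneg) auto
    qed
    then have "(\<lambda>x. norm (f x)) summable_on (S \<times> UNIV)"
      using inner_norm by (intro summable_on_SigmaI[where g = t]) auto
    then have sf: "f summable_on (S \<times> UNIV)" by (rule abs_summable_summable)
    then have F: "(f has_sum infsum f (S \<times> UNIV)) (S \<times> UNIV)" by simp
    have "((\<lambda>i. c i * mpow (y + h) (n i)) has_sum infsum f (S \<times> UNIV)) S"
      by (rule has_sum_SigmaD[OF F]) (rule inner)
    then have eq: "infsum f (S \<times> UNIV) = (\<Sum>\<^sub>\<infinity>i\<in>S. c i * mpow (y + h) (n i))"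
      by (simp add: infsumI)
    have sw: "((\<lambda>(\<alpha>, i). f (i, \<alpha>)) has_sum infsum f (S \<times> UNIV)) (UNIV \<times> S)"
      using F has_sum_swap by blast
    have "((\<lambda>\<alpha>. \<Sum>\<^sub>\<infinity>i\<in>S. f (i, \<alpha>)) has_sum infsum f (S \<times> UNIV)) UNIV"
    proof (rule has_sum_SigmaD[OF sw])
      fix \<alpha> :: "nat^'d"
      have "(\<lambda>(\<alpha>, i). f (i, \<alpha>)) summable_on (UNIV \<times> S)" using sw by (auto simp: summable_on_def)
      then have "(\<lambda>i. f (i, \<alpha>)) summable_on S"
        by (rule summable_on_SigmaD1[of "\<lambda>\<alpha> i. f (i, \<alpha>)"]) simp
      then show "((\<lambda>i. case (\<alpha>, i) of (\<alpha>, i) \<Rightarrow> f (i, \<alpha>)) has_sum (\<Sum>\<^sub>\<infinity>i\<in>S. f (i, \<alpha>))) S"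
        by simp
    qed
    moreover have "(\<Sum>\<^sub>\<infinity>i\<in>S. f (i, \<alpha>)) = (\<Sum>\<^sub>\<infinity>i\<in>S. b i \<alpha>) * (\<Prod>k\<in>UNIV. (h $ k) ^ (\<alpha> $ k))" for \<alpha>
      unfolding f_def mpow_def by (simp add: infsum_cmult_left')
    ultimately show ?thesis using eq by simp
  qed
  then show ?thesis
    unfolding holo_at_def using e(1)
    by (intro exI[of _ "\<lambda>\<alpha>. \<Sum>\<^sub>\<infinity>i\<in>S. b i \<alpha>"] exI[of _ e]) simp
qed

text \<open>In a monomial of positive degree one factor is bounded by \<open>norm h\<close> and the
  others by \<open>\<rho>\<close>. Comparison with the absolutely convergent series at polyradius
  \<open>\<rho>\<close> gives a Lipschitz estimate at \<open>p\<close>.\<close>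

lemma holo_at_continuous:
  fixes u :: "complex^'d::finite \<Rightarrow> complex"
  assumes "holo_at u p"
  shows "isCont u p"
proof -
  obtain a e where e: "e > 0" and
    a: "\<And>h. norm h < e \<Longrightarrow> ((\<lambda>\<alpha>. a \<alpha> * mpow h \<alpha>) has_sum u (p + h)) UNIV"
    using assms unfolding holo_at_def mpow_def by blast
  \<comment> \<open>The constant vector with entries \<open>\<rho>\<close> has norm at most
    \<open>CARD('d) * \<rho> = e / 2\<close>, so it lies in the ball of convergence.\<close>
  define \<rho> where "\<rho> = e / (2 * real CARD('d))"
  have \<rho>: "\<rho> > 0" using e by (simp add: \<rho>_def)
  let ?r = "(\<chi> k. of_real \<rho>) :: complex^'d"
  have "norm ?r \<le> (\<Sum>k\<in>UNIV. norm (?r $ k))" 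
    unfolding norm_vec_def by (rule L2_set_le_sum) simp
  also have "\<dots> < e" using e by (simp add: \<rho>_def norm_divide)
  finally have "(\<lambda>\<alpha>. a \<alpha> * mpow ?r \<alpha>) summable_on UNIV" using a by (auto simp: summable_on_def)
  then have sr: "(\<lambda>\<alpha>. norm (a \<alpha> * mpow ?r \<alpha>)) summable_on UNIV"
    by (rule summable_on_iff_abs_summable_on_complex[THEN iffD1])
  define C where "C = (\<Sum>\<^sub>\<infinity>\<alpha>\<in>UNIV. norm (a \<alpha> * mpow ?r \<alpha>))"
  have bound: "norm (u (p + h) - u p) \<le> C / \<rho> * norm h" if h: "norm h < e" "norm h < \<rho>" for h
  proof -
    have m0: "mpow 0 \<alpha> = (if \<alpha> = 0 then 1 else 0)" for \<alpha> :: "nat^'d"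
      by (auto simp: mpow_def vec_eq_iff power_0_left)
    have d: "((\<lambda>\<alpha>. a \<alpha> * mpow h \<alpha> - a \<alpha> * mpow 0 \<alpha>) has_sum (u (p + h) - u p)) UNIV"
      using has_sum_add[OF a[of h] has_sum_cmult_right[OF a[of 0], of "-1"]] h e by simp
    have term_le: "norm (a \<alpha> * mpow h \<alpha> - a \<alpha> * mpow 0 \<alpha>) \<le> norm h / \<rho> * norm (a \<alpha> * mpow ?r \<alpha>)" for \<alpha>
    proof (cases "\<alpha> = 0")
      case True
      then show ?thesis using \<rho> by (simp add: mpow_def)
    next
      case False
      then obtain j where j: "\<alpha> $ j > 0" by (auto simp: vec_eq_iff)
      have hk: "norm (h $ k) \<le> norm h" for k by (rule Finite_Cartesian_Product.norm_nth_le)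
      have "norm (mpow h \<alpha>) = norm (h $ j) ^ (\<alpha> $ j) * (\<Prod>k\<in>UNIV - {j}. norm (h $ k) ^ (\<alpha> $ k))"
        unfolding norm_mpow by (subst prod.remove[of _ j]) auto
      also have "\<dots> \<le> (norm h / \<rho> * \<rho> ^ (\<alpha> $ j)) * (\<Prod>k\<in>UNIV - {j}. \<rho> ^ (\<alpha> $ k))"
      proof (intro mult_mono prod_mono)
        have "norm (h $ j) ^ (\<alpha> $ j) = norm (h $ j) * norm (h $ j) ^ (\<alpha> $ j - 1)"
          using j by (simp add: power_eq_if)
        also have "\<dots> \<le> norm h * \<rho> ^ (\<alpha> $ j - 1)"
          using hk[of j] h by (intro mult_mono power_mono) auto
        also have "\<dots> = norm h / \<rho> * \<rho> ^ (\<alpha> $ j)" using j \<rho> by (simp add: power_eq_if)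
        finally show "norm (h $ j) ^ (\<alpha> $ j) \<le> norm h / \<rho> * \<rho> ^ (\<alpha> $ j)" .
        show "0 \<le> norm (h $ k) ^ (\<alpha> $ k) \<and> norm (h $ k) ^ (\<alpha> $ k) \<le> \<rho> ^ (\<alpha> $ k)" for k
          using hk[of k] h by (auto intro!: power_mono)
      qed (use \<rho> in \<open>auto intro!: prod_nonneg\<close>)
      also have "\<dots> = norm h / \<rho> * (\<Prod>k\<in>UNIV. \<rho> ^ (\<alpha> $ k))"
        by (subst prod.remove[of UNIV j]) auto
      also have "(\<Prod>k\<in>UNIV. \<rho> ^ (\<alpha> $ k)) = norm (mpow ?r \<alpha>)"
        unfolding norm_mpow using \<rho> by simp
      finally have "norm (a \<alpha>) * norm (mpow h \<alpha>) \<le> norm (a \<alpha>) * (norm h / \<rho> * norm (mpow ?r \<alpha>))"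
        by (rule mult_left_mono) simp
      then show ?thesis
        using False by (simp add: m0 norm_mult mult_ac)
    qed
    have sm: "(\<lambda>\<alpha>. norm h / \<rho> * norm (a \<alpha> * mpow ?r \<alpha>)) summable_on UNIV"
      by (rule summable_on_cmult_right[OF sr])
    have ab: "(\<lambda>\<alpha>. norm (a \<alpha> * mpow h \<alpha> - a \<alpha> * mpow 0 \<alpha>)) summable_on UNIV"
      by (rule summable_on_comparison_test[OF sm]) (use term_le in auto)
    have "norm (u (p + h) - u p) \<le> (\<Sum>\<^sub>\<infinity>\<alpha>\<in>UNIV. norm (a \<alpha> * mpow h \<alpha> - a \<alpha> * mpow 0 \<alpha>))"
      using norm_infsum_bound[OF ab] infsumI[OF d] by simp
    also have "\<dots> \<le> (\<Sum>\<^sub>\<infinity>\<alpha>\<in>UNIV. norm h / \<rho> * norm (a \<alpha> * mpow ?r \<alpha>))"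
      by (rule infsum_mono[OF ab sm term_le])
    also have "\<dots> = C / \<rho> * norm h"
      unfolding C_def using \<rho> by (subst infsum_cmult_right') (simp add: field_simps)
    finally show ?thesis .
  qed
  have "((\<lambda>h. u (p + h) - u p) \<longlongrightarrow> 0) (at 0)"
  proof (rule tendsto_0_le[where K = 1])
    show "((\<lambda>h. C / \<rho> * norm h) \<longlongrightarrow> 0) (at (0 :: complex^'d))"
      using \<rho> by (auto intro!: tendsto_eq_intros)
    show "\<forall>\<^sub>F h in at 0. norm (u (p + h) - u p) \<le> norm (C / \<rho> * norm h) * 1"
    proof -
      have "\<forall>\<^sub>F h in at (0 :: complex^'d). dist h 0 < min e \<rho>"
        using e \<rho> unfolding eventually_at by (intro exI[of _ "min e \<rho>"]) simp
      then show ?thesis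
      proof eventually_elim
        case (elim h)
        then have "norm (u (p + h) - u p) \<le> C / \<rho> * norm h"
            by (intro bound) (simp_all add: dist_norm)
          also have "\<dots> \<le> norm (C / \<rho> * norm h) * 1"
            unfolding real_norm_def mult_1_right by (rule abs_ge_self)
          finally show ?case .
      qed
    qed
  qed
  then have "((\<lambda>h. u (p + h)) \<longlongrightarrow> u p) (at 0)"
    by (simp add: LIM_zero_iff)
  then show ?thesis by (simp add: isCont_iff)
qed

text \<open>
  Rescaling one coordinate of \<open>h\<close> by \<open>z\<close> turns the series into a power series in \<open>z\<close> that vanishes on the
  unit disc.
\<close>

lemma monomial_series_zero_slices:
  fixes a :: "'i \<Rightarrow> complex" and n :: "'i \<Rightarrow> nat^'d::finite"
  assumes zero: "\<And>h. norm h < e \<Longrightarrow> ((\<lambda>i. a i * mpow h (n i)) has_sum 0) S"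
    and "finite I" "norm h < e"
  shows "((\<lambda>i. a i * mpow h (n i)) has_sum 0) {i \<in> S. \<forall>k\<in>I. n i $ k = \<beta> k}"
  using assms(2,3)
proof (induction I arbitrary: h rule: finite_induct)
  case empty
  then show ?case using zero by simp
next
  case (insert j I)
  define T where "T = {i \<in> S. \<forall>k\<in>I. n i $ k = \<beta> k}"
  define T' where "T' N = {i \<in> T. n i $ j = N}" for N
  define G where "G N = (\<Sum>\<^sub>\<infinity>i\<in>T' N. a i * mpow h (n i))" for N
  have "(\<lambda>i. a i * mpow h (n i)) summable_on T"
    using insert.IH[of h] insert.prems by (auto simp: T_def summable_on_def)
  then have sG: "((\<lambda>i. a i * mpow h (n i)) has_sum G N) (T' N)" for N
  proof -
    have "T' N \<subseteq> T" by (auto simp: T'_def)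
    then have "(\<lambda>i. a i * mpow h (n i)) summable_on T' N"
      by (rule summable_on_subset_banach[rotated]) fact
    then show ?thesis unfolding G_def by (rule has_sum_infsum)
  qed
  have ser: "(\<lambda>N. G N * z ^ N) sums 0" if z: "norm z \<le> 1" for z
  proof -
    define hz where "hz = (\<chi> k. if k = j then z * h $ k else h $ k)"
    have "norm hz \<le> norm h"
      unfolding norm_vec_def hz_def
      by (intro L2_set_mono) (use z in \<open>auto simp: norm_mult mult_left_le_one_le\<close>)
    then have "((\<lambda>i. a i * mpow hz (n i)) has_sum 0) T"
      using insert.IH[of hz] insert.prems by (simp add: T_def)
    moreover have "mpow hz (n i) = z ^ (n i $ j) * mpow h (n i)" for i
      unfolding hz_def by (rule mpow_scale)
    ultimately have "((\<lambda>i. z ^ (n i $ j) * (a i * mpow h (n i))) has_sum 0) T"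
      by (simp add: mult_ac)
    \<comment> \<open>Sorting the index set by the \<open>j\<close>-th exponent turns the sum into
      an iterated one, with \<open>G N\<close> as coefficient of \<open>z ^ N\<close>.\<close>
    moreover have "bij_betw snd (SIGMA N:UNIV. T' N) T"
      by (rule bij_betwI[where g = "\<lambda>i. (n i $ j, i)"]) (auto simp: T'_def)
    ultimately have *: "((\<lambda>x. z ^ (n (snd x) $ j) * (a (snd x) * mpow h (n (snd x)))) has_sum 0) (SIGMA N:UNIV. T' N)"
      using has_sum_reindex_bij_betw[of snd "SIGMA N:UNIV. T' N" T "\<lambda>i. z ^ (n i $ j) * (a i * mpow h (n i))" 0]
      by simp
    have "((\<lambda>N. G N * z ^ N) has_sum 0) UNIV"
    proof (rule has_sum_SigmaD[OF *])
      fix N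
      have "((\<lambda>i. z ^ N * (a i * mpow h (n i))) has_sum (z ^ N * G N)) (T' N)"
        by (rule has_sum_cmult_right[OF sG])
      also have "?this \<longleftrightarrow> ((\<lambda>i. z ^ (n i $ j) * (a i * mpow h (n i))) has_sum (G N * z ^ N)) (T' N)"
        by (auto simp: T'_def mult_ac intro!: has_sum_cong)
      finally show "((\<lambda>i. z ^ (n (snd (N, i)) $ j) * (a (snd (N, i)) * mpow h (n (snd (N, i))))) has_sum
          (G N * z ^ N)) (T' N)" by simp
    qed
    then show ?thesis by (rule has_sum_imp_sums)
  qed
  have "Abs_fps G = 0"
  proof (rule eval_fps_eqD)
    have "conv_radius G \<ge> norm (1 :: complex)"
      by (rule conv_radius_geI) (use ser[of 1] in \<open>auto intro: sums_summable\<close>)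
    then show "fps_conv_radius (Abs_fps G) > 0"
      by (intro less_le_trans[of 0 "ereal 1" "fps_conv_radius (Abs_fps G)"]) (simp_all add: fps_conv_radius_def)
    have "\<forall>\<^sub>F z in nhds (0 :: complex). norm z < 1"
      using eventually_nhds_ball[of 1 "0 :: complex"] by simp
    then show "\<forall>\<^sub>F z in nhds 0. eval_fps (Abs_fps G) z = eval_fps 0 z"
      by eventually_elim (use ser in \<open>auto simp: eval_fps_def sums_unique[symmetric]\<close>)
  qed simp
  then have "G N = 0" for N by (metis fps_nth_Abs_fps fps_zero_nth)
  then have "((\<lambda>i. a i * mpow h (n i)) has_sum 0) (T' (\<beta> j))" using sG[of "\<beta> j"] by simp
  moreover have "T' (\<beta> j) = {i \<in> S. \<forall>k\<in>insert j I. n i $ k = \<beta> k}"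
    by (auto simp: T'_def T_def)
  ultimately show ?case by simp
qed

text \<open>Prescribing all exponents leaves a single term, which is evaluated at a point without
  zero coordinates. Only the exponent of \<open>i\<close> has to be unique; other exponents may
  repeat, so two series can be compared by merging them into one over a disjoint sum.\<close>

lemma monomial_series_identity:
  fixes a :: "'i \<Rightarrow> complex" and n :: "'i \<Rightarrow> nat^'d::finite"
  assumes zero: "\<And>h. norm h < e \<Longrightarrow> ((\<lambda>i. a i * mpow h (n i)) has_sum 0) S"
    and "e > 0" "i \<in> S" and inj: "\<And>j. j \<in> S \<Longrightarrow> n j = n i \<Longrightarrow> j = i"
  shows "a i = 0"
proof -
  obtain h :: "complex^'d" where h: "norm h < e" "\<And>k. h $ k \<noteq> 0"
  proof
    let ?r = "e / (2 * real CARD('d))"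
    let ?h = "(\<chi> k. of_real ?r) :: complex^'d"
    have "norm ?h \<le> (\<Sum>k\<in>UNIV. norm (?h $ k))"
      unfolding norm_vec_def by (rule L2_set_le_sum) simp
    also have "\<dots> < e" using \<open>e > 0\<close> by (simp add: norm_divide)
    finally show "norm ?h < e" .
    show "?h $ k \<noteq> 0" for k using \<open>e > 0\<close> by simp
  qed
  have "{j \<in> S. \<forall>k\<in>UNIV. n j $ k = n i $ k} = {i}"
    using assms(3) inj by (auto simp flip: vec_eq_iff)
  then have "((\<lambda>j. a j * mpow h (n j)) has_sum 0) {i}"
    using monomial_series_zero_slices[OF zero, of e UNIV h "\<lambda>k. n i $ k"] h(1) by simp
  then have "a i * mpow h (n i) = 0" by (simp add: has_sum_finite_iff)
  then show ?thesis using h(2) by (simp add: mpow_def)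
qed

section \<open>Combinatorics of the charts\<close>

definition unimodular :: "'d::finite chart \<Rightarrow> bool" where
  "unimodular A \<longleftrightarrow> (\<exists>B. A ** B = mat 1 \<and> B ** A = mat 1)"

lemma blowup_chart_row: "blowup_chart A l $ k = (if k = l then blowup_ray A else A $ k)"
  by (simp add: blowup_chart_def)

text \<open>The new ray contributes to every old row. For positive \<open>c\<close> this makes the
  \<open>l\<close>-th old coordinate the strictly smallest one.\<close>

lemma vector_blowup_chart:
  fixes A :: "'d::finite chart"
  shows "c v* blowup_chart A l = (\<chi> k. if k = l then c $ l else c $ k + c $ l) v* A"
proof -
  have "(\<Sum>k\<in>UNIV. c $ k * blowup_chart A l $ k $ i) = (\<Sum>k\<in>UNIV. (if k = l then c $ l else c $ k + c $ l) * A $ k $ i)" for i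
  proof -
    have "(\<Sum>k\<in>UNIV. c $ k * blowup_chart A l $ k $ i) =
        c $ l * (\<Sum>k\<in>UNIV. A $ k $ i) + (\<Sum>k\<in>UNIV - {l}. c $ k * A $ k $ i)"
      by (subst sum.remove[of UNIV l]) (auto simp: blowup_chart_row blowup_ray_def intro!: sum.cong)
    also have "(\<Sum>k\<in>UNIV. A $ k $ i) = A $ l $ i + (\<Sum>k\<in>UNIV - {l}. A $ k $ i)"
      by (rule sum.remove) auto
    also have "c $ l * (A $ l $ i + (\<Sum>k\<in>UNIV - {l}. A $ k $ i)) + (\<Sum>k\<in>UNIV - {l}. c $ k * A $ k $ i) =
        c $ l * A $ l $ i + (\<Sum>k\<in>UNIV - {l}. (c $ k + c $ l) * A $ k $ i)"
      by (simp add: algebra_simps sum.distrib sum_distrib_left)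
    also have "\<dots> = (\<Sum>k\<in>UNIV. (if k = l then c $ l else c $ k + c $ l) * A $ k $ i)"
      by (subst sum.remove[of UNIV l "\<lambda>k. (if k = l then c $ l else c $ k + c $ l) * A $ k $ i"]) (auto intro!: sum.cong)
    finally show ?thesis .
  qed
  then show ?thesis
    by (simp add: vector_matrix_mult_def vec_eq_iff mult.commute)
qed

lemma unimodular_mat_1: "unimodular (mat 1)"
  unfolding unimodular_def by (intro exI[of _ "mat 1"]) simp

lemma unimodular_blowup_chart:
  fixes A :: "'d::finite chart"
  assumes "unimodular A"
  shows "unimodular (blowup_chart A l)"
proof -
  obtain B where B: "A ** B = mat 1" "B ** A = mat 1" using assms by (auto simp: unimodular_def)
  \<comment> \<open>Blowing up multiplies by an integer matrix: \<open>P\<close> replaces row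
    \<open>l\<close> by the sum of all rows, and \<open>Q\<close> undoes this by subtracting the
    other rows from row \<open>l\<close>.\<close>
  define P :: "int^'d^'d" where "P = (\<chi> k i. if k = l \<or> k = i then 1 else 0)"
  define Q :: "int^'d^'d" where "Q = (\<chi> k i. if k = i then 1 else if k = l then - 1 else 0)"
  have "blowup_chart A l = P ** A"
  proof -
    have "(\<Sum>j\<in>UNIV. (if k = l \<or> k = j then 1 else 0) * A $ j $ i) = blowup_chart A l $ k $ i" for k i
    proof (cases "k = l")
      case False
      then have "(\<Sum>j\<in>UNIV. (if k = l \<or> k = j then 1 else 0) * A $ j $ i) = (\<Sum>j\<in>UNIV. if k = j then A $ j $ i else 0)"
        by (intro sum.cong) auto
      then show ?thesis using False by (simp add: blowup_chart_row)
    qed (simp add: blowup_chart_row blowup_ray_def)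
    then show ?thesis by (simp add: P_def matrix_matrix_mult_def vec_eq_iff)
  qed
  moreover have PQ: "P ** Q = mat 1" "Q ** P = mat 1"
  proof -
    have "(\<Sum>j\<in>UNIV. P $ k $ j * Q $ j $ i) = (if k = i then 1 else 0)" for k i
    proof (cases "k = l")
      case True
      have "(\<Sum>j\<in>UNIV. P $ k $ j * Q $ j $ i) = (\<Sum>j\<in>UNIV. (if j = i then 1 else 0) + (if j = l then (if i = l then 0 else - 1) else 0))"
        using True by (intro sum.cong) (auto simp: P_def Q_def)
      then show ?thesis using True by (simp add: sum.distrib)
    next
      case False
      have "(\<Sum>j\<in>UNIV. P $ k $ j * Q $ j $ i) = (\<Sum>j\<in>UNIV. if j = k then (if k = i then 1 else 0) else 0)"
        using False by (intro sum.cong) (auto simp: P_def Q_def)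
      then show ?thesis by simp
    qed
    then show "P ** Q = mat 1" by (simp add: matrix_matrix_mult_def mat_def vec_eq_iff)
    have "(\<Sum>j\<in>UNIV. Q $ k $ j * P $ j $ i) = (if k = i then 1 else 0)" for k i
    proof (cases "k = l")
      case True
      have "(\<Sum>j\<in>UNIV. Q $ k $ j * P $ j $ i) = (\<Sum>j\<in>UNIV. (if j = l then 1 else 0) + (if j = i then (if i = l then 0 else - 1) else 0))"
        using True by (intro sum.cong) (auto simp: P_def Q_def)
      then show ?thesis using True by (simp add: sum.distrib)
    next
      case False
      have "(\<Sum>j\<in>UNIV. Q $ k $ j * P $ j $ i) = (\<Sum>j\<in>UNIV. if j = k then (if k = i then 1 else 0) else 0)"
        using False by (intro sum.cong) (auto simp: P_def Q_def)
      then show ?thesis by simp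
    qed
    then show "Q ** P = mat 1" by (simp add: matrix_matrix_mult_def mat_def vec_eq_iff)
  qed
  ultimately have "blowup_chart A l ** (B ** Q) = mat 1" "(B ** Q) ** blowup_chart A l = mat 1"
    using B by (metis matrix_mul_assoc matrix_mul_rid)+
  then show ?thesis unfolding unimodular_def by blast
qed

lemma unimodular_vector_inj:
  fixes A :: "'d::finite chart"
  assumes "unimodular A" "c v* A = c' v* A"
  shows "c = c'"
proof -
  obtain B where "A ** B = mat 1" using assms(1) by (auto simp: unimodular_def)
  then have "c = (c v* A) v* B" "c' = (c' v* A) v* B"
    by (simp_all add: vector_matrix_mul_assoc)
  then show ?thesis using assms(2) by simp
qed

lemma one_vector_matrix: "1 v* A = blowup_ray (A :: 'd::finite chart)"
  by (simp add: vector_matrix_mult_def blowup_ray_def vec_eq_iff)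

text \<open>Lattice points in the open simplicial cone spanned by the rows. Integer coordinates
  suffice, because in a unimodular chart every lattice point has integer coordinates.\<close>

definition in_interior :: "'d::finite chart \<Rightarrow> int^'d \<Rightarrow> bool" where
  "in_interior A x \<longleftrightarrow> (\<exists>c. (\<forall>k. c $ k > 0) \<and> x = c v* A)"

text \<open>Star subdivision in the old coordinates: the regions for different \<open>l\<close>
  exclude each other, as only one coordinate can be strictly smallest.\<close>

lemma in_interior_blowup_chart:
  fixes A :: "'d::finite chart"
  assumes "in_interior (blowup_chart A l) x"
  obtains c where "\<And>k. c $ k > 0" "\<And>k. k \<noteq> l \<Longrightarrow> c $ l < c $ k" "x = c v* A"
proof -
  obtain c where c: "\<And>k. c $ k > 0" "x = c v* blowup_chart A l"
    using assms by (auto simp: in_interior_def)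
  show thesis
    by (rule that[of "\<chi> k. if k = l then c $ l else c $ k + c $ l"])
      (use c in \<open>auto simp: vector_blowup_chart add_pos_pos\<close>)
qed

lemma in_interior_blowup_chartD: "in_interior (blowup_chart A l) x \<Longrightarrow> in_interior A x"
  by (erule in_interior_blowup_chart) (auto simp: in_interior_def)

lemma blowup_ray_in_interior: "in_interior A (blowup_ray A)"
  unfolding in_interior_def by (rule exI[of _ 1]) (simp add: one_vector_matrix)

section \<open>Cones and rays of a toric constellation\<close>

locale toric =
  fixes C :: "('d::finite) chart list"
  assumes card_d: "CARD('d) \<ge> 2" and toric: "toric_constellation C"
begin

abbreviation ray :: "nat \<Rightarrow> int^'d" where
  "ray j \<equiv> blowup_ray (C ! j)"

text \<open>This is where \<open>d \<ge> 2\<close> enters: a blow-up creates a ray different from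
  the old ones, and each row of the chart survives in some blow-up chart.\<close>

lemma other_index: "\<exists>l :: 'd. l \<noteq> k"
proof (rule ccontr)
  assume "\<not> ?thesis"
  then have "UNIV = {k}" by auto
  then have "CARD('d) = 1" by (metis card.empty card_insert_disjoint empty_iff finite.emptyI One_nat_def)
  then show False using card_d by simp
qed

lemma length_pos: "length C > 0"
  using toric by (simp add: toric_constellation_def)

lemma nth_in_charts: "j < length C \<Longrightarrow> C ! j \<in> charts C j"
  using toric by (simp add: toric_constellation_def)

lemma charts_unimodular: "j \<le> length C \<Longrightarrow> A \<in> charts C j \<Longrightarrow> unimodular A"
proof (induction j arbitrary: A)
  case (Suc j)
  then show ?case using nth_in_charts[of j] by (auto intro: unimodular_blowup_chart)
qed (simp add: unimodular_mat_1)

lemma charts_nonneg: "j \<le> length C \<Longrightarrow> A \<in> charts C j \<Longrightarrow> A $ k $ i \<ge> 0"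
proof (induction j arbitrary: A k)
  case (Suc j)
  then have IH: "\<And>A k. A \<in> charts C j \<Longrightarrow> A $ k $ i \<ge> 0" by simp
  have "A \<in> charts C j \<or> (\<exists>l. A = blowup_chart (C ! j) l)" using Suc.prems by auto
  then show ?case
    using IH nth_in_charts[of j] Suc.prems(1)
    by (auto simp: blowup_chart_row blowup_ray_def intro!: sum_nonneg)
qed (simp add: mat_def)

text \<open>An invertible matrix has no zero column. Positivity of all entries means that the
  component lies over the origin, and it makes the set of monomials of bounded weight
  finite.\<close>

lemma ray_pos:
  assumes "j < length C"
  shows "ray j $ i > 0"
proof -
  obtain B where B: "B ** (C ! j) = mat 1"
    using charts_unimodular nth_in_charts assms by (metis unimodular_def less_imp_le)
  have nn: "C ! j $ k $ i \<ge> 0" for k 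
    by (rule charts_nonneg[of j]) (use nth_in_charts assms in auto)
  have "\<exists>k. C ! j $ k $ i \<noteq> 0"
  proof (rule ccontr)
    assume "\<not> ?thesis"
    then have "(B ** (C ! j)) $ i $ i = 0" by (simp add: matrix_matrix_mult_def)
    then show False using B by (simp add: mat_def)
  qed
  then obtain k where "C ! j $ k $ i > 0" using nn by (metis order_le_less)
  then show ?thesis
    unfolding blowup_ray_def sum_component using nn by (intro sum_pos2[where i = k]) auto
qed

text \<open>Blow-up charts lie inside the old cone, so the only new case is that of two blow-up
  charts of the same point. There two different coordinates would both be strictly smallest.\<close>

lemma interiors_disjoint:
  assumes "j \<le> length C" "A \<in> charts C j" "B \<in> charts C j" "A \<noteq> B" "in_interior A x"
  shows "\<not> in_interior B x"
  using assms
proof (induction j arbitrary: A B)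
  case (Suc j)
  let ?Q = "C ! j"
  have Q: "?Q \<in> charts C j" "unimodular ?Q" using nth_in_charts[of j] charts_unimodular[of j] Suc.prems(1) by auto
  have IH: "\<And>A B. A \<in> charts C j \<Longrightarrow> B \<in> charts C j \<Longrightarrow> A \<noteq> B \<Longrightarrow> in_interior A x \<Longrightarrow> \<not> in_interior B x"
    using Suc.IH Suc.prems(1) by simp
  have or: "A \<in> charts C j - {?Q} \<or> (\<exists>l. A = blowup_chart ?Q l)" "B \<in> charts C j - {?Q} \<or> (\<exists>l. B = blowup_chart ?Q l)"
    using Suc.prems by auto
  show ?case
  proof
    assume B: "in_interior B x"
    consider "A \<in> charts C j - {?Q}" "B \<in> charts C j - {?Q}"
      | l where "A \<in> charts C j - {?Q}" "B = blowup_chart ?Q l"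
      | l where "B \<in> charts C j - {?Q}" "A = blowup_chart ?Q l"
      | l m where "A = blowup_chart ?Q l" "B = blowup_chart ?Q m" using or by blast
    then show False
    proof cases
      case 1
      then show ?thesis using IH[of A B] Suc.prems B by auto
    next
      case 2
      then show ?thesis using IH[of A ?Q] Q Suc.prems(5) B in_interior_blowup_chartD by blast
    next
      case 3
      then show ?thesis using IH[of B ?Q] Q Suc.prems(5) B in_interior_blowup_chartD by blast
    next
      case 4
      then have "l \<noteq> m" using Suc.prems(4) by auto
      obtain c where c: "\<And>k. k \<noteq> l \<Longrightarrow> c $ l < c $ k" "x = c v* ?Q"
        using in_interior_blowup_chart[of ?Q l x] Suc.prems(5) 4 by metis
      obtain c' where c': "\<And>k. k \<noteq> m \<Longrightarrow> c' $ m < c' $ k" "x = c' v* ?Q"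
        using in_interior_blowup_chart[of ?Q m x] B 4 by metis
      have "c = c'" using unimodular_vector_inj[OF Q(2)] c(2) c'(2) by simp
      then show False using c(1)[of m] c'(1)[of l] \<open>l \<noteq> m\<close> by auto
    qed
  qed
qed simp

text \<open>In the cone that is blown up, the new ray has all coordinates 1; none is strictly
  smallest, so it is interior to no blow-up chart, and by disjointness to no other chart. Later
  blow-ups only shrink interiors.\<close>

lemma ray_not_in_interior:
  assumes "j \<le> length C" "i < j" "A \<in> charts C j"
  shows "\<not> in_interior A (ray i)"
  using assms
proof (induction j arbitrary: A)
  case (Suc j)
  let ?Q = "C ! j"
  have Q: "?Q \<in> charts C j" "unimodular ?Q" using nth_in_charts[of j] charts_unimodular[of j] Suc.prems(1) by auto
  have IH: "\<And>A. i < j \<Longrightarrow> A \<in> charts C j \<Longrightarrow> \<not> in_interior A (ray i)"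
    using Suc.IH Suc.prems(1) by simp
  have "A \<in> charts C j - {?Q} \<or> (\<exists>l. A = blowup_chart ?Q l)" using Suc.prems by auto
  then show ?case
  proof (elim disjE exE)
    assume A: "A \<in> charts C j - {?Q}"
    show ?thesis
    proof (cases "i = j")
      case True
      then show ?thesis
        using interiors_disjoint[of j ?Q A "ray i"] A Q Suc.prems(1) blowup_ray_in_interior[of ?Q] by auto
    next
      case False
      then show ?thesis using IH A Suc.prems by auto
    qed
  next
    fix l assume A: "A = blowup_chart ?Q l"
    show ?thesis
    proof
      assume int: "in_interior A (ray i)"
      show False
      proof (cases "i = j")
        case True
        obtain c where c: "\<And>k. k \<noteq> l \<Longrightarrow> c $ l < c $ k" "ray i = c v* ?Q"
          using in_interior_blowup_chart[of ?Q l "ray i"] int A by metis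
        have "c = 1" using unimodular_vector_inj[OF Q(2), of c 1] c(2) True by (simp add: one_vector_matrix)
        moreover obtain k where "k \<noteq> l" using other_index by blast
        ultimately show False using c(1)[of k] by simp
      next
        case False
        then show False using IH[of ?Q] Q int A in_interior_blowup_chartD Suc.prems by auto
      qed
    qed
  qed
qed simp

text \<open>If two rays agreed, the earlier one would be interior to the cone blown up
  later.\<close>

lemma ray_inj:
  assumes "i < length C" "j < length C" "ray i = ray j"
  shows "i = j"
proof (rule ccontr)
  have less: False if "i < j" "j < length C" "ray i = ray j" for i j
    using ray_not_in_interior[of j i "C ! j"] nth_in_charts[of j] blowup_ray_in_interior[of "C ! j"] that by simp
  assume "i \<noteq> j"
  then show False using less[of i j] less[of j i] assms by (metis linorder_neqE_nat)
qed

text \<open>When its chart is blown up, row \<open>k\<close> survives in every blow-up chart with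
  \<open>l \<noteq> k\<close>, so no component is lost on the way to \<open>Z\<close>.\<close>

lemma ray_in_chart:
  assumes "j < length C"
  shows "\<exists>A\<in>Z_charts C. \<exists>k. A $ k = ray j"
proof -
  have "\<exists>A\<in>charts C (Suc j + n). \<exists>k. A $ k = ray j" for n
  proof (induction n)
    case 0
    have "blowup_chart (C ! j) undefined $ undefined = ray j" by (simp add: blowup_chart_row)
    moreover have "blowup_chart (C ! j) undefined \<in> charts C (Suc j + 0)" by simp
    ultimately show ?case by blast
  next
    case (Suc n)
    then obtain A k where A: "A \<in> charts C (Suc j + n)" "A $ k = ray j" by blast
    show ?case
    proof (cases "A = C ! (Suc j + n)")
      case True
      obtain l where "l \<noteq> k" using other_index by blast
      then have "blowup_chart A l $ k = ray j" using A by (simp add: blowup_chart_row)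
      moreover have "blowup_chart A l \<in> charts C (Suc j + Suc n)" using True by simp
      ultimately show ?thesis by blast
    next
      case False
      then have "A \<in> charts C (Suc j + Suc n)" using A by simp
      then show ?thesis using A by blast
    qed
  qed
  moreover have "Suc j + (length C - Suc j) = length C" using assms by simp
  ultimately show ?thesis by metis
qed

end

text \<open>Value of the monomial with exponent \<open>m\<close> under the monomial valuation of the
  ray \<open>a\<close>. The rays that occur have nonnegative entries, so \<open>nat\<close> changes
  nothing.\<close>

definition row_wt :: "int^'d \<Rightarrow> nat^'d \<Rightarrow> nat" where
  "row_wt a m = (\<Sum>i\<in>UNIV. nat (a $ i) * m $ i)"

text \<open>Exponent of the pullback of this monomial to chart \<open>A\<close>; see
  \<open>mpow_monomial_map\<close>.\<close>

definition chart_exp :: "'d::finite chart \<Rightarrow> nat^'d \<Rightarrow> nat^'d" where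
  "chart_exp A m = (\<chi> k. row_wt (A $ k) m)"

lemma finite_row_wt_le:
  fixes a :: "int^'d::finite"
  assumes "\<And>i. a $ i > 0"
  shows "finite {m. row_wt a m \<le> N}"
proof (rule finite_subset)
  show "{m. row_wt a m \<le> N} \<subseteq> vec_lambda ` PiE UNIV (\<lambda>_::'d. {..N})"
  proof
    fix m assume "m \<in> {m. row_wt a m \<le> N}"
    then have m: "row_wt a m \<le> N" by simp
    have "m $ i \<le> N" for i
    proof -
      have "1 \<le> nat (a $ i)" using assms[of i] by linarith
      then have "m $ i \<le> nat (a $ i) * m $ i" by simp
      also have "\<dots> \<le> row_wt a m" unfolding row_wt_def by (rule member_le_sum) auto
      finally show ?thesis using m by simp
    qed
    then show "m \<in> vec_lambda ` PiE UNIV (\<lambda>_::'d. {..N})"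
      by (intro image_eqI[where x = "vec_nth m"]) auto
  qed
qed (intro finite_imageI finite_PiE, auto)

lemma inj_chart_exp:
  fixes A :: "'d::finite chart"
  assumes "unimodular A" "\<And>k i. A $ k $ i \<ge> 0"
  shows "inj (chart_exp A)"
proof (rule injI)
  fix m m' assume eq: "chart_exp A m = chart_exp A m'"
  obtain B where B: "B ** A = mat 1" using assms(1) by (auto simp: unimodular_def)
  define w where "w m = (\<chi> i. int (m $ i))" for m :: "nat^'d"
  have "A *v w m = (\<chi> k. int (chart_exp A m $ k))" for m
    using assms(2) by (simp add: matrix_vector_mult_def w_def chart_exp_def row_wt_def vec_eq_iff)
  then have "B *v (A *v w m) = B *v (A *v w m')" using eq by simp
  then have "w m = w m'" by (simp add: matrix_vector_mul_assoc B)
  then show "m = m'" by (simp add: w_def vec_eq_iff)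
qed

section \<open>Monomial valuations\<close>

lemma mpow_add: "mpow w (m + n) = mpow w m * mpow w n"
  by (simp add: mpow_def power_add prod.distrib)

lemma mpow_axis: "mpow w (axis k n) = (w $ k) ^ n"
proof -
  have "mpow w (axis k n) = (\<Prod>j\<in>UNIV. if j = k then (w $ k) ^ n else 1)"
    unfolding mpow_def by (intro prod.cong) (auto simp: axis_def)
  then show ?thesis by simp
qed

lemma mpow_0_right [simp]: "mpow w 0 = 1"
  by (simp add: mpow_def)

lemma mpow_eq_0_iff: "mpow w n = 0 \<longleftrightarrow> (\<exists>k. w $ k = 0 \<and> n $ k > 0)"
  by (auto simp: mpow_def)

lemma monomial_map_nonneg:
  assumes "\<And>k i. A $ k $ i \<ge> 0"
  shows "monomial_map A w $ i = (\<Prod>k\<in>UNIV. (w $ k) ^ nat (A $ k $ i))"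
  using assms by (simp add: monomial_map_def power_int_def)

lemma mpow_monomial_map:
  fixes A :: "'d::finite chart"
  assumes "\<And>k i. A $ k $ i \<ge> 0"
  shows "mpow (monomial_map A w) m = mpow w (chart_exp A m)"
proof -
  have "mpow (monomial_map A w) m = (\<Prod>i\<in>UNIV. \<Prod>k\<in>UNIV. (w $ k) ^ (nat (A $ k $ i) * m $ i))"
    unfolding mpow_def monomial_map_nonneg[OF assms] prod_power_distrib[symmetric] power_mult ..
  also have "\<dots> = (\<Prod>k\<in>UNIV. \<Prod>i\<in>UNIV. (w $ k) ^ (nat (A $ k $ i) * m $ i))"
    by (rule prod.swap)
  also have "\<dots> = mpow w (chart_exp A m)"
    by (simp add: mpow_def chart_exp_def row_wt_def power_sum)
  finally show ?thesis .
qed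

lemma norm_monomial_map_mono:
  fixes A :: "'d::finite chart"
  assumes "\<And>k i. A $ k $ i \<ge> 0" "\<And>k. norm (w $ k) \<le> norm (z $ k)"
  shows "norm (monomial_map A w) \<le> norm (monomial_map A z)"
  unfolding norm_vec_def monomial_map_nonneg[OF assms(1)] norm_power prod_norm[symmetric]
  by (intro L2_set_mono prod_mono) (auto intro!: power_mono prod_nonneg assms)

definition expands :: "(complex^'d \<Rightarrow> complex) \<Rightarrow> (nat^'d \<Rightarrow> complex) \<Rightarrow> real \<Rightarrow> bool" where
  "expands g a e \<longleftrightarrow> e > 0 \<and> (\<forall>h. norm h < e \<longrightarrow> ((\<lambda>m. a m * mpow h m) has_sum g h) UNIV)"

lemma holo_at_0_expands: "holo_at g 0 \<longleftrightarrow> (\<exists>a e. expands g a e)"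
  by (simp add: holo_at_def expands_def mpow_def)

text \<open>For nonnegative exponents the norm of the image is monotone in the moduli of the
  coordinates, so only the corner \<open>R\<close> has to be controlled. The moduli of
  \<open>y\<close> themselves still map to 0, and by continuity a small common increase keeps the
  image in the ball. This works at every point over the origin, not only at chart origins.\<close>

lemma polydisc_of_nonneg_chart:
  fixes A :: "'d::finite chart" and y :: "complex^'d"
  assumes nn: "\<And>k i. A $ k $ i \<ge> 0" and y0: "monomial_map A y = 0" and "e > 0"
  obtains R :: "complex^'d" where "\<And>k. norm (y $ k) < norm (R $ k)" "norm (monomial_map A R) < e"
proof -
  define \<rho> where "\<rho> t = (\<chi> k. complex_of_real (norm (y $ k) + t))" for t :: real
  have lim: "((\<lambda>t. monomial_map A (\<rho> t)) \<longlongrightarrow> monomial_map A (\<rho> 0)) (at_right 0)"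
  proof (rule vec_tendstoI)
    fix i
    have "((\<lambda>t. \<rho> t $ k) \<longlongrightarrow> \<rho> 0 $ k) (at_right 0)" for k
      unfolding \<rho>_def by (auto intro!: tendsto_eq_intros)
    then show "((\<lambda>t. monomial_map A (\<rho> t) $ i) \<longlongrightarrow> monomial_map A (\<rho> 0) $ i) (at_right 0)"
      unfolding monomial_map_nonneg[OF nn] by (intro tendsto_prod tendsto_power)
  qed
  have "norm (monomial_map A (\<rho> 0)) \<le> norm (monomial_map A y)"
    by (rule norm_monomial_map_mono[OF nn]) (simp add: \<rho>_def)
  then have "monomial_map A (\<rho> 0) = 0" using y0 by simp
  then have "((\<lambda>t. norm (monomial_map A (\<rho> t))) \<longlongrightarrow> 0) (at_right 0)"
    using tendsto_norm[OF lim] by simp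
  then have "\<forall>\<^sub>F t in at_right 0. norm (monomial_map A (\<rho> t)) < e"
    using \<open>e > 0\<close> by (rule order_tendstoD)
  moreover have "\<forall>\<^sub>F t in at_right (0::real). t > 0" by (simp add: eventually_at_right_less)
  ultimately have "\<forall>\<^sub>F t in at_right (0::real). t > 0 \<and> norm (monomial_map A (\<rho> t)) < e"
    by eventually_elim simp
  then obtain t where t: "t > 0" "norm (monomial_map A (\<rho> t)) < e"
    using eventually_happens[of _ "at_right (0::real)"] by auto
  show thesis
  proof (rule that[of "\<rho> t"])
    have "norm (\<rho> t $ k) = norm (y $ k) + t" for k
    proof -
      have "\<bar>norm (y $ k) + t\<bar> = norm (y $ k) + t" using t(1) by simp
      then show ?thesis by (simp only: \<rho>_def vec_lambda_beta norm_of_real)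
    qed
    then show "norm (y $ k) < norm (\<rho> t $ k)" for k using t(1) by simp
  qed (rule t)
qed

text \<open>The common monomial factor is divided out term by term. It is nonzero at the corner
  \<open>R\<close>, so the quotient series converges there, hence by comparison on the closed
  polydisc, including the points where the factor vanishes.\<close>

lemma pullback_factor:
  fixes A :: "'d::finite chart" and y :: "complex^'d"
  assumes nn: "\<And>k i. A $ k $ i \<ge> 0" and y0: "monomial_map A y = 0"
    and g: "expands g a e"
    and b: "\<And>m k. a m \<noteq> 0 \<Longrightarrow> b $ k \<le> chart_exp A m $ k"
  shows "\<exists>u (R :: complex^'d). holo_at u y \<and> (\<forall>k. norm (y $ k) < norm (R $ k)) \<and>
    (\<forall>w. (\<forall>k. norm (w $ k) \<le> norm (R $ k)) \<longrightarrow>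
       ((\<lambda>m. a m * mpow w (chart_exp A m - b)) has_sum u w) {m. a m \<noteq> 0} \<and>
       g (monomial_map A w) = mpow w b * u w)"
proof -
  have e: "e > 0" using g by (simp add: expands_def)
  obtain R where R: "\<And>k. norm (y $ k) < norm (R $ k)" "norm (monomial_map A R) < e"
    using polydisc_of_nonneg_chart[OF nn y0 e] by blast
  define S where "S = {m. a m \<noteq> 0}"
  have exp: "mpow w (chart_exp A m) = mpow w b * mpow w (chart_exp A m - b)" if "m \<in> S" for w m
  proof -
    have "chart_exp A m = b + (chart_exp A m - b)" using b[of m] that by (simp add: S_def vec_eq_iff)
    then show ?thesis by (metis mpow_add)
  qed
  have ser: "((\<lambda>m. mpow w b * (a m * mpow w (chart_exp A m - b))) has_sum g (monomial_map A w)) S"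
    if w: "\<And>k. norm (w $ k) \<le> norm (R $ k)" for w
  proof -
    have "norm (monomial_map A w) < e"
      using norm_monomial_map_mono[OF nn w] R(2) by simp
    then have "((\<lambda>m. a m * mpow (monomial_map A w) m) has_sum g (monomial_map A w)) UNIV"
      using g by (simp add: expands_def)
    also have "?this \<longleftrightarrow> ?thesis"
      by (intro has_sum_cong_neutral) (auto simp: mpow_monomial_map[OF nn] exp, auto simp: S_def)
    finally show ?thesis .
  qed
  have R0: "mpow R b \<noteq> 0" using R(1) by (auto simp: mpow_eq_0_iff) (metis norm_zero not_less norm_ge_zero)
  have sR: "(\<lambda>m. a m * mpow R (chart_exp A m - b)) summable_on S"
    using ser[of R] has_sum_cmult_right_iff[OF R0] by (auto simp: summable_on_def)
  define u where "u w = (\<Sum>\<^sub>\<infinity>m\<in>S. a m * mpow w (chart_exp A m - b))" for w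
  have "holo_at u y"
    unfolding u_def by (rule holo_at_monomial_series[OF sR R(1)])
  moreover have "((\<lambda>m. a m * mpow w (chart_exp A m - b)) has_sum u w) S \<and> g (monomial_map A w) = mpow w b * u w"
    if w: "\<And>k. norm (w $ k) \<le> norm (R $ k)" for w
  proof -
    have "(\<lambda>m. norm (a m * mpow w (chart_exp A m - b))) summable_on S"
    proof (rule Infinite_Sum.abs_summable_on_comparison_test)
      show "(\<lambda>m. norm (a m * mpow R (chart_exp A m - b))) summable_on S"
        by (rule summable_on_iff_abs_summable_on_complex[THEN iffD1, OF sR])
      show "norm (a m * mpow w (chart_exp A m - b)) \<le> norm (a m * mpow R (chart_exp A m - b))" for m
        unfolding norm_mult by (intro mult_left_mono norm_mpow_mono w) simp
    qed
    then have hs: "((\<lambda>m. a m * mpow w (chart_exp A m - b)) has_sum u w) S"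
      unfolding u_def by (intro has_sum_infsum) (rule abs_summable_summable)
    moreover have "g (monomial_map A w) = mpow w b * u w"
      using has_sum_unique[OF ser[OF w] has_sum_cmult_right[OF hs]] .
    ultimately show ?thesis by blast
  qed
  ultimately show ?thesis using R(1) unfolding S_def by (intro exI[of _ u] exI[of _ R]) simp
qed

lemma eventually_polydisc:
  fixes y R :: "complex^'d::finite"
  assumes "\<forall>k. norm (y $ k) < norm (R $ k)"
  shows "\<forall>\<^sub>F w in nhds y. \<forall>k. norm (w $ k) \<le> norm (R $ k)"
proof -
  have "\<forall>\<^sub>F w in nhds y. norm (w $ k) < norm (R $ k)" for k
  proof (rule order_tendstoD(2)[OF _ assms[rule_format]])
    show "((\<lambda>w. norm (w $ k)) \<longlongrightarrow> norm (y $ k)) (nhds y)"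
      by (intro tendsto_norm tendsto_vec_nth filterlim_ident)
  qed
  then have "\<forall>\<^sub>F w in nhds y. \<forall>k. norm (w $ k) < norm (R $ k)"
    by (rule eventually_all_finite)
  then show ?thesis by eventually_elim (auto intro: less_imp_le)
qed

text \<open>The factor may vanish at \<open>y\<close>. On the points
  \<open>y + t (1, ..., 1)\<close> with small \<open>t \<noteq> 0\<close> all coordinates are
  nonzero, so the two quotients agree there and, by continuity, at \<open>y\<close>. This makes the
  value described in \<open>restr_section\<close> unique.\<close>

lemma holo_quotient_unique:
  fixes y :: "complex^'d::finite"
  assumes "holo_at u y" "holo_at u' y" and ev: "\<forall>\<^sub>F w in nhds y. mpow w b * u w = mpow w b * u' w"
  shows "u y = u' y"
proof -
  define \<gamma> where "\<gamma> t = (\<chi> k. y $ k + of_real t)" for t :: real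
  have lim: "(\<gamma> \<longlongrightarrow> y) (at 0)"
    by (rule vec_tendstoI) (auto simp: \<gamma>_def intro!: tendsto_eq_intros)
  have "\<forall>\<^sub>F t in at 0. \<gamma> t $ k \<noteq> 0" for k
  proof (cases "y $ k = 0")
    case True
    then show ?thesis by (simp add: \<gamma>_def eventually_at_filter)
  next
    case False
    then show ?thesis using tendsto_vec_nth[OF lim, of k] by (rule tendsto_imp_eventually_ne[rotated])
  qed
  then have nz: "\<forall>\<^sub>F t in at 0. \<forall>k. \<gamma> t $ k \<noteq> 0" by (rule eventually_all_finite)
  have "\<forall>\<^sub>F t in at 0. mpow (\<gamma> t) b * u (\<gamma> t) = mpow (\<gamma> t) b * u' (\<gamma> t)"
    using ev lim by (rule eventually_compose_filterlim)
  with nz have eq: "\<forall>\<^sub>F t in at 0. u (\<gamma> t) = u' (\<gamma> t)"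
    by eventually_elim (auto simp: mpow_eq_0_iff)
  have l: "((\<lambda>t. f (\<gamma> t)) \<longlongrightarrow> f y) (at 0)" if "holo_at f y" for f
    using holo_at_continuous[OF that] lim by (rule isCont_tendsto_compose)
  have "((\<lambda>t. u' (\<gamma> t)) \<longlongrightarrow> u y) (at 0)"
    using l[OF assms(1)] eq by (rule Lim_transform_eventually)
  then show ?thesis using l[OF assms(2)] tendsto_unique[of "at (0::real)"] by auto
qed

context toric
begin

abbreviation r :: nat where "r \<equiv> length C"

abbreviation wt :: "nat \<Rightarrow> nat^'d \<Rightarrow> nat" where "wt j \<equiv> row_wt (ray j)"

lemma Z_nonneg: "A \<in> Z_charts C \<Longrightarrow> A $ k $ i \<ge> 0"
  by (rule charts_nonneg) auto

lemma Z_unimodular: "A \<in> Z_charts C \<Longrightarrow> unimodular A"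
  by (rule charts_unimodular) auto

lemma monomial_map_exceptional:
  assumes "A \<in> Z_charts C" "j < r" "A $ k = ray j" "y $ k = 0"
  shows "monomial_map A y = 0"
proof -
  have "monomial_map A y $ i = 0" for i
    unfolding monomial_map_nonneg[OF Z_nonneg[OF assms(1)]]
    using assms ray_pos[OF assms(2), of i] by (intro prod_zero) (auto intro!: bexI[of _ k])
  then show ?thesis by (simp add: vec_eq_iff)
qed

lemma chart_exp_ray: "A $ k = ray j \<Longrightarrow> chart_exp A m $ k = wt j m"
  by (simp add: chart_exp_def)

text \<open>Two expansions are compared at the origin of a chart that shows the component. The
  monomial \<open>m\<close> contributes an exponent with \<open>k\<close>-th entry
  \<open>wt j m\<close>, whereas all exponents of \<open>w $ k ^ n * u\<close> have
  \<open>k\<close>-th entry at least \<open>n\<close>; if \<open>n\<close> were larger, nothing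
  could cancel this term.\<close>

lemma order_le_weight:
  assumes j: "j < r" and g: "expands g a e" and m: "a m \<noteq> 0"
    and n: "\<forall>A \<in> Z_charts C. \<forall>k. A $ k = ray j \<longrightarrow> (\<forall>y. y $ k = 0 \<longrightarrow>
          (\<exists>u. holo_at u y \<and> (\<forall>\<^sub>F w in nhds y. g (monomial_map A w) = (w $ k) ^ n * u w)))"
  shows "n \<le> wt j m"
proof (rule ccontr)
  assume less: "\<not> n \<le> wt j m"
  obtain A k where A: "A \<in> Z_charts C" "A $ k = ray j" using ray_in_chart[OF j] by blast
  have y0: "monomial_map A 0 = 0" using monomial_map_exceptional[OF A(1) j A(2)] by simp
  obtain u where u: "holo_at u 0" "\<forall>\<^sub>F w in nhds 0. g (monomial_map A w) = (w $ k) ^ n * u w"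
    using n[rule_format, OF A, of 0] by auto
  obtain a' e' where u': "expands u a' e'" using u(1) holo_at_0_expands by blast
  obtain u0 and R :: "complex^'d" where R: "\<forall>k. norm ((0 :: complex^'d) $ k) < norm (R $ k)"
    "\<And>w. \<forall>k. norm (w $ k) \<le> norm (R $ k) \<Longrightarrow>
       ((\<lambda>m. a m * mpow w (chart_exp A m - 0)) has_sum u0 w) {m. a m \<noteq> 0} \<and>
       g (monomial_map A w) = mpow w 0 * u0 w"
    using pullback_factor[OF Z_nonneg[OF A(1)] y0 g, of 0] by auto
  have "\<forall>\<^sub>F w in nhds 0. (\<forall>k. norm (w $ k) \<le> norm (R $ k)) \<and> g (monomial_map A w) = (w $ k) ^ n * u w"
    using eventually_polydisc[OF R(1)] u(2) by eventually_elim simp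
  then obtain \<delta> where \<delta>: "\<delta> > 0" "\<And>w. norm w < \<delta> \<Longrightarrow>
      (\<forall>k. norm (w $ k) \<le> norm (R $ k)) \<and> g (monomial_map A w) = (w $ k) ^ n * u w"
    unfolding eventually_nhds_metric by (auto simp: dist_norm)
  \<comment> \<open>Both expansions as one vanishing series: \<open>Inl\<close> indexes the pulled
    back monomials, \<open>Inr\<close> the terms of \<open>- (w $ k) ^ n * u\<close>.\<close>
  define c :: "(nat^'d) + (nat^'d) \<Rightarrow> complex" where "c = case_sum a (\<lambda>\<alpha>. - a' \<alpha>)"
  define N where "N = case_sum (chart_exp A) (\<lambda>\<alpha>. axis k n + \<alpha>)"
  define S where "S = Inl ` {m. a m \<noteq> 0} \<union> range (Inr :: nat^'d \<Rightarrow> (nat^'d) + (nat^'d))"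
  have zero: "((\<lambda>i. c i * mpow w (N i)) has_sum 0) S" if w: "norm w < min \<delta> e'" for w
  proof -
    have 1: "((\<lambda>m. a m * mpow w (chart_exp A m)) has_sum g (monomial_map A w)) {m. a m \<noteq> 0}"
      using R(2)[of w] \<delta>(2)[of w] w by simp
    have "((\<lambda>\<alpha>. a' \<alpha> * mpow w \<alpha>) has_sum u w) UNIV"
      using u' w by (simp add: expands_def)
    then have 2: "((\<lambda>\<alpha>. - ((w $ k) ^ n) * (a' \<alpha> * mpow w \<alpha>)) has_sum - ((w $ k) ^ n) * u w) UNIV"
      by (rule has_sum_cmult_right)
    have "((\<lambda>i. c i * mpow w (N i)) has_sum g (monomial_map A w)) (Inl ` {m. a m \<noteq> 0})"
      using 1 by (subst has_sum_reindex) (auto simp: c_def N_def o_def)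
    moreover have "((\<lambda>i. c i * mpow w (N i)) has_sum - ((w $ k) ^ n) * u w) (range Inr)"
      using 2 by (subst has_sum_reindex) (auto simp: c_def N_def o_def mpow_add mpow_axis mult_ac)
    ultimately have "((\<lambda>i. c i * mpow w (N i)) has_sum (g (monomial_map A w) + - ((w $ k) ^ n) * u w)) S"
      unfolding S_def by (intro has_sum_Un_disjoint) auto
    then show ?thesis using \<delta>(2)[of w] w by simp
  qed
  have "c (Inl m) = 0"
  proof (rule monomial_series_identity[OF zero])
    show "0 < min \<delta> e'" using \<delta> u' by (simp add: expands_def)
    show "Inl m \<in> S" using m by (simp add: S_def)
    fix i assume i: "i \<in> S" "N i = N (Inl m)"
    show "i = Inl m"
    proof (cases i)
      case (Inl m')
      then show ?thesis
        using i inj_chart_exp[OF Z_unimodular[OF A(1)] Z_nonneg[OF A(1)]] by (auto simp: N_def dest: injD)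
    next
      case (Inr \<alpha>)
      then have "axis k n + \<alpha> = chart_exp A m" using i by (simp add: N_def)
      then have "(axis k n + \<alpha>) $ k = chart_exp A m $ k" by simp
      then have "n + \<alpha> $ k = wt j m" using A(2) by (simp add: chart_exp_ray)
      then show ?thesis using less by simp
    qed
  qed
  then show False using m by (simp add: c_def)
qed

lemma weight_le_order:
  assumes j: "j < r" and g: "expands g a e" and n: "\<And>m. a m \<noteq> 0 \<Longrightarrow> n \<le> wt j m"
    and A: "A \<in> Z_charts C" "A $ k = ray j" "y $ k = 0"
  shows "\<exists>u. holo_at u y \<and> (\<forall>\<^sub>F w in nhds y. g (monomial_map A w) = (w $ k) ^ n * u w)"
proof -
  have le: "axis k n $ l \<le> chart_exp A m $ l" if "a m \<noteq> 0" for m l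
    using n[OF that] chart_exp_ray[OF A(2), of m] by (auto simp: axis_def)
  obtain u and R :: "complex^'d" where u: "holo_at u y" "\<forall>k. norm (y $ k) < norm (R $ k)"
    "\<And>w. \<forall>k. norm (w $ k) \<le> norm (R $ k) \<Longrightarrow> g (monomial_map A w) = mpow w (axis k n) * u w"
    using pullback_factor[OF Z_nonneg[OF A(1)] monomial_map_exceptional[OF A(1) j A(2,3)] g le] by blast
  have "\<forall>\<^sub>F w in nhds y. g (monomial_map A w) = (w $ k) ^ n * u w"
    using eventually_polydisc[OF u(2)] by eventually_elim (use u(3) in \<open>simp add: mpow_axis\<close>)
  then show ?thesis using u(1) by blast
qed

text \<open>The form with an inequality also covers the zero germ, whose order is infinite.\<close>

lemma nu_ge_iff:
  assumes j: "j < r" and g: "expands g a e"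
  shows "enat n \<le> nu C j g \<longleftrightarrow> (\<forall>m. a m \<noteq> 0 \<longrightarrow> n \<le> wt j m)"
proof
  assume n: "enat n \<le> nu C j g"
  show "\<forall>m. a m \<noteq> 0 \<longrightarrow> n \<le> wt j m"
  proof (intro allI impI)
    fix m assume m: "a m \<noteq> 0"
    have "nu C j g \<le> enat (wt j m)"
      unfolding nu_def by (rule Sup_least) (use order_le_weight[OF j g m] in auto)
    with n have "enat n \<le> enat (wt j m)" by (rule order_trans)
    then show "n \<le> wt j m" by simp
  qed
next
  assume "\<forall>m. a m \<noteq> 0 \<longrightarrow> n \<le> wt j m"
  then show "enat n \<le> nu C j g"
    unfolding nu_def by (intro Sup_upper) (use weight_le_order[OF j g] in blast)
qed

lemma nu_eq_iff:
  assumes j: "j < r" and g: "expands g a e"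
  shows "nu C j g = enat n \<longleftrightarrow> (\<forall>m. a m \<noteq> 0 \<longrightarrow> n \<le> wt j m) \<and> (\<exists>m. a m \<noteq> 0 \<and> wt j m = n)"
proof -
  have "nu C j g = enat n \<longleftrightarrow> enat n \<le> nu C j g \<and> \<not> enat (Suc n) \<le> nu C j g"
    by (auto simp: Suc_ile_eq)
  also have "\<dots> \<longleftrightarrow> (\<forall>m. a m \<noteq> 0 \<longrightarrow> n \<le> wt j m) \<and> \<not> (\<forall>m. a m \<noteq> 0 \<longrightarrow> Suc n \<le> wt j m)"
    unfolding nu_ge_iff[OF assms] ..
  also have "\<dots> \<longleftrightarrow> (\<forall>m. a m \<noteq> 0 \<longrightarrow> n \<le> wt j m) \<and> (\<exists>m. a m \<noteq> 0 \<and> wt j m = n)"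
    by (auto simp: not_less_eq_eq intro: le_antisym)
  finally show ?thesis .
qed

end

section \<open>Sections on the exceptional divisor\<close>

context toric
begin

definition above :: "(nat \<Rightarrow> int) \<Rightarrow> (nat^'d) set" where
  "above v = {m. \<forall>j<r. v j \<le> int (wt j m)}"

text \<open>The monomials in \<open>I(v)\<close> but not in \<open>I(v + 1)\<close>. They index a
  basis of the quotient as well as the monomials visible on the exceptional divisor.\<close>

definition minimal :: "(nat \<Rightarrow> int) \<Rightarrow> (nat^'d) set" where
  "minimal v = {m \<in> above v. \<exists>j<r. int (wt j m) = v j}"

text \<open>Exponent left after division by the local generator \<open>E_gen\<close>. For
  \<open>m\<close> in \<open>above v\<close> the difference is nonnegative, so \<open>nat\<close>
  truncates nothing.\<close>

definition sec_exp :: "(nat \<Rightarrow> int) \<Rightarrow> 'd chart \<Rightarrow> nat^'d \<Rightarrow> nat^'d" where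
  "sec_exp v A m = (\<chi> k. nat (int (chart_exp A m $ k) - E_mult C v A k))"

definition mono_section :: "(nat \<Rightarrow> int) \<Rightarrow> nat^'d \<Rightarrow> 'd sect" where
  "mono_section v m = (\<lambda>A y. if A \<in> Z_charts C \<and> y \<in> D_in C A then mpow y (sec_exp v A m) else 0)"

definition comb :: "(nat \<Rightarrow> int) \<Rightarrow> (nat^'d \<Rightarrow> complex) \<Rightarrow> 'd sect" where
  "comb v c = (\<lambda>A y. \<Sum>m\<in>minimal v. c m * mono_section v m A y)"

lemma finite_weight_eq: "j < r \<Longrightarrow> finite {m. int (wt j m) = n}"
  by (rule finite_subset[OF _ finite_row_wt_le[of "ray j" "nat n"]]) (auto simp: ray_pos)

lemma finite_minimal: "finite (minimal v)"
proof (rule finite_subset)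
  show "minimal v \<subseteq> (\<Union>j\<in>{..<r}. {m. int (wt j m) = v j})" by (auto simp: minimal_def)
  show "finite (\<Union>j\<in>{..<r}. {m. int (wt j m) = v j})" using finite_weight_eq by blast
qed

text \<open>Different components have different rays, so only the summand of \<open>j\<close>
  remains.\<close>

lemma E_mult_ray:
  assumes "j < r" "A $ k = ray j"
  shows "E_mult C v A k = v j"
proof -
  have "E_mult C v A k = (\<Sum>i<r. if i = j then v j else 0)"
    unfolding E_mult_def using assms ray_inj by (intro sum.cong) auto
  then show ?thesis using assms(1) by simp
qed

lemma E_mult_cases:
  obtains j where "j < r" "A $ k = ray j" "E_mult C v A k = v j"
  | "\<forall>j<r. A $ k \<noteq> ray j" "E_mult C v A k = 0"
proof (cases "\<exists>j<r. A $ k = ray j")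
  case True
  then show ?thesis using that(1) E_mult_ray by blast
next
  case False
  then have "E_mult C v A k = 0" unfolding E_mult_def by (intro sum.neutral) auto
  then show ?thesis using that(2) False by blast
qed

lemma E_mult_le: "m \<in> above v \<Longrightarrow> E_mult C v A k \<le> int (chart_exp A m $ k)"
  by (rule E_mult_cases[of A k v]) (auto simp: above_def chart_exp_ray)

lemma int_sec_exp: "m \<in> above v \<Longrightarrow> int (sec_exp v A m $ k) = int (chart_exp A m $ k) - E_mult C v A k"
  using E_mult_le[of m v A k] by (simp add: sec_exp_def)

lemma sec_exp_ray:
  "m \<in> above v \<Longrightarrow> j < r \<Longrightarrow> A $ k = ray j \<Longrightarrow> int (sec_exp v A m $ k) = int (wt j m) - v j"
  by (simp add: int_sec_exp E_mult_ray chart_exp_ray)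

lemma inj_on_sec_exp:
  assumes "A \<in> Z_charts C"
  shows "inj_on (sec_exp v A) (above v)"
proof (rule inj_onI)
  fix m m' assume m: "m \<in> above v" "m' \<in> above v" "sec_exp v A m = sec_exp v A m'"
  have "chart_exp A m = chart_exp A m'"
    using m int_sec_exp[OF m(1), of A] int_sec_exp[OF m(2), of A] by (simp add: vec_eq_iff)
  then show "m = m'"
    using inj_chart_exp[OF Z_unimodular[OF assms] Z_nonneg[OF assms]] by (auto dest: injD)
qed

lemma D_inE:
  assumes "y \<in> D_in C A"
  obtains j k where "j < r" "A $ k = ray j" "y $ k = 0"
  using assms by (auto simp: D_in_def E_in_def)

text \<open>The excess of the weight over \<open>v j\<close> is a positive power of the local
  equation of the component.\<close>

lemma mono_section_vanish:
  assumes "m \<in> above v" "y \<in> E_in C j A" "j < r" "int (wt j m) \<noteq> v j"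
  shows "mpow y (sec_exp v A m) = 0"
proof -
  obtain k where k: "A $ k = ray j" "y $ k = 0" using assms(2) by (auto simp: E_in_def)
  have "v j < int (wt j m)" using assms by (auto simp: above_def order_less_le)
  then have "sec_exp v A m $ k > 0" using sec_exp_ray[OF assms(1,3) k(1)] by simp
  then show ?thesis using k by (auto simp: mpow_eq_0_iff)
qed

text \<open>Division by the generator leaves the series with exponents \<open>sec_exp v A m\<close>.
  Each point of the divisor lies on some component, where every monomial that is not minimal
  vanishes; a finite sum remains.\<close>

lemma restr_section_eq_comb:
  assumes g: "expands g a e" and a: "\<And>m. a m \<noteq> 0 \<Longrightarrow> m \<in> above v" and v: "\<And>j. j < r \<Longrightarrow> 0 \<le> v j"
  shows "restr_section C v g = comb v a"
proof (intro ext)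
  fix A :: "'d chart" and y :: "complex^'d"
  show "restr_section C v g A y = comb v a A y"
  proof (cases "A \<in> Z_charts C \<and> y \<in> D_in C A")
    case False
    then show ?thesis by (auto simp: restr_section_def comb_def mono_section_def)
  next
    case True
    then have A: "A \<in> Z_charts C" and y: "y \<in> D_in C A" by auto
    obtain j k where jk: "j < r" "A $ k = ray j" "y $ k = 0" using D_inE[OF y] .
    have y0: "monomial_map A y = 0" by (rule monomial_map_exceptional[OF A jk])
    define b where "b = (\<chi> k. nat (E_mult C v A k))"
    \<comment> \<open>For nonnegative \<open>v\<close> the generator is an ordinary monomial, so it
      can be divided out by \<open>pullback_factor\<close>.\<close>
    have Enn: "E_mult C v A k \<ge> 0" for k by (rule E_mult_cases[of A k v]) (auto simp: v)
    have gen: "E_gen C v A w = mpow w b" for w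
      using Enn by (simp add: E_gen_def mpow_def b_def power_int_def)
    have ble: "b $ k \<le> chart_exp A m $ k" if "a m \<noteq> 0" for m k
      using E_mult_le[OF a[OF that], of A k] by (simp add: b_def)
    have exp: "chart_exp A m - b = sec_exp v A m" for m
      using Enn by (simp add: vec_eq_iff sec_exp_def b_def nat_diff_distrib')
    obtain u and R :: "complex^'d" where u: "holo_at u y" "\<forall>k. norm (y $ k) < norm (R $ k)"
      "\<And>w. \<forall>k. norm (w $ k) \<le> norm (R $ k) \<Longrightarrow>
         ((\<lambda>m. a m * mpow w (chart_exp A m - b)) has_sum u w) {m. a m \<noteq> 0} \<and>
         g (monomial_map A w) = mpow w b * u w"
      using pullback_factor[OF Z_nonneg[OF A] y0 g ble] by blast
    have ev: "\<forall>\<^sub>F w in nhds y. g (monomial_map A w) = mpow w b * u w"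
      using eventually_polydisc[OF u(2)] by eventually_elim (use u(3) in blast)
    have "((\<lambda>m. a m * mpow y (sec_exp v A m)) has_sum u y) {m. a m \<noteq> 0}"
      using u(3)[of y] u(2) unfolding exp by (simp add: less_imp_le)
    also have "?this \<longleftrightarrow> ((\<lambda>m. a m * mpow y (sec_exp v A m)) has_sum u y) (minimal v)"
    proof (intro has_sum_cong_neutral)
      fix m assume "m \<in> {m. a m \<noteq> 0} - minimal v"
      then have "m \<in> above v" "int (wt j m) \<noteq> v j" using a jk(1) by (auto simp: minimal_def)
      then have "mpow y (sec_exp v A m) = 0"
        using mono_section_vanish[of m v y j A] jk by (auto simp: E_in_def)
      then show "a m * mpow y (sec_exp v A m) = 0" by simp
    qed auto
    finally have uy: "u y = comb v a A y"
      using A y finite_minimal by (simp add: has_sum_finite_iff comb_def mono_section_def)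
    have "(THE c. \<exists>u. holo_at u y \<and> u y = c \<and> (\<forall>\<^sub>F w in nhds y. g (monomial_map A w) = E_gen C v A w * u w)) = u y"
    proof (rule the_equality)
      fix c assume "\<exists>u. holo_at u y \<and> u y = c \<and> (\<forall>\<^sub>F w in nhds y. g (monomial_map A w) = E_gen C v A w * u w)"
      then obtain u' where u': "holo_at u' y" "u' y = c" "\<forall>\<^sub>F w in nhds y. g (monomial_map A w) = mpow w b * u' w"
        unfolding gen by blast
      have "\<forall>\<^sub>F w in nhds y. mpow w b * u' w = mpow w b * u w"
        using u'(3) ev by eventually_elim metis
      then show "c = u y" using holo_quotient_unique[OF u'(1) u(1)] u'(2) by simp
    qed (use u(1) ev gen in auto)
    then show ?thesis using True uy by (simp add: restr_section_def)
  qed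
qed

section \<open>Monomial sections on overlaps of charts\<close>

lemma transition_mult:
  assumes "B \<in> Z_charts C"
  shows "transition A B ** B = A" "B ** matrix_inv B = mat 1"
proof -
  have "B ** matrix_inv B = mat 1 \<and> matrix_inv B ** B = mat 1"
    using Z_unimodular[OF assms] unfolding unimodular_def matrix_inv_def by (rule someI_ex)
  then show "transition A B ** B = A" "B ** matrix_inv B = mat 1"
    by (simp_all add: transition_def flip: matrix_mul_assoc)
qed

text \<open>In the basis formed by the rows of \<open>B\<close>, a common ray is a unit
  vector.\<close>

lemma transition_common_ray:
  assumes "B \<in> Z_charts C" "B $ m = A $ k"
  shows "transition A B $ k $ i = (if i = m then 1 else 0)"
proof -
  have "transition A B $ k $ i = (\<Sum>l\<in>UNIV. A $ k $ l * matrix_inv B $ l $ i)"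
    by (simp add: transition_def matrix_matrix_mult_def)
  also have "\<dots> = (B ** matrix_inv B) $ m $ i"
    using assms(2) by (simp add: matrix_matrix_mult_def)
  also have "\<dots> = (if i = m then 1 else 0)"
    using transition_mult(2)[OF assms(1)] by (simp add: mat_def eq_commute)
  finally show ?thesis .
qed

text \<open>Exponents are compared for each coordinate of \<open>y\<close>. Where it is nonzero,
  integer powers are additive in the exponent and \<open>transition A B ** B = A\<close> gives the
  result. Where it is zero, additivity may fail, but gluing makes the ray common to both charts: the
  row of the transition matrix is a unit vector and the exponent in \<open>E_unit\<close> is
  0.\<close>

lemma mono_section_glued:
  assumes A: "A \<in> Z_charts C" and B: "B \<in> Z_charts C" and y: "y \<in> D_in C A"
    and gl: "glued A B y z" and m: "m \<in> above v"
  shows "mono_section v m B z = mono_section v m A y * E_unit C v A B y"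
proof -
  let ?T = "transition A B"
  have zero: "\<exists>l. B $ l = A $ k" if "y $ k = 0" for k using gl that by (auto simp: glued_def)
  have z: "z $ i = (\<Prod>k\<in>UNIV. (y $ k) powi (?T $ k $ i))" for i
    using gl by (simp add: glued_def monomial_map_def)
  have "z \<in> D_in C B"
  proof -
    obtain j k where jk: "j < r" "A $ k = ray j" "y $ k = 0" using D_inE[OF y] .
    obtain l where l: "B $ l = A $ k" using zero[OF jk(3)] by blast
    have "z $ l = 0" unfolding z
      using jk transition_common_ray[OF B l, of l] by (intro prod_zero) (auto intro!: bexI[of _ k])
    then show ?thesis using jk l by (auto simp: D_in_def E_in_def)
  qed
  then have "mono_section v m B z = mpow z (sec_exp v B m)"
    using B by (simp add: mono_section_def)
  also have "\<dots> = (\<Prod>i\<in>UNIV. \<Prod>k\<in>UNIV. ((y $ k) powi (?T $ k $ i)) ^ (sec_exp v B m $ i))"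
    unfolding mpow_def z by (simp add: prod_power_distrib)
  also have "\<dots> = (\<Prod>k\<in>UNIV. \<Prod>i\<in>UNIV. ((y $ k) powi (?T $ k $ i)) ^ (sec_exp v B m $ i))"
    by (rule prod.swap)
  also have "\<dots> = (\<Prod>k\<in>UNIV. (y $ k) ^ (sec_exp v A m $ k) *
      (y $ k) powi (E_mult C v A k - (\<Sum>i\<in>UNIV. ?T $ k $ i * E_mult C v B i)))"
  proof (intro prod.cong refl)
    fix k :: 'd
    show "(\<Prod>i\<in>UNIV. ((y $ k) powi (?T $ k $ i)) ^ (sec_exp v B m $ i)) =
      (y $ k) ^ (sec_exp v A m $ k) * (y $ k) powi (E_mult C v A k - (\<Sum>i\<in>UNIV. ?T $ k $ i * E_mult C v B i))"
    proof (cases "y $ k = 0")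
      case True
      obtain l where l: "B $ l = A $ k" using zero[OF True] by blast
      have T: "?T $ k $ i = (if i = l then 1 else 0)" for i by (rule transition_common_ray[OF B l])
      have "(\<Prod>i\<in>UNIV. ((y $ k) powi (?T $ k $ i)) ^ (sec_exp v B m $ i)) =
          (\<Prod>i\<in>UNIV. if i = l then (y $ k) ^ (sec_exp v B m $ l) else 1)"
        unfolding T by (intro prod.cong) auto
      also have "\<dots> = (y $ k) ^ (sec_exp v B m $ l)" by simp
      also have "sec_exp v B m $ l = sec_exp v A m $ k"
        using l by (simp add: sec_exp_def chart_exp_def E_mult_def)
      finally have 1: "(\<Prod>i\<in>UNIV. ((y $ k) powi (?T $ k $ i)) ^ (sec_exp v B m $ i)) = (y $ k) ^ (sec_exp v A m $ k)" .
      have "(\<Sum>i\<in>UNIV. ?T $ k $ i * E_mult C v B i) = (\<Sum>i\<in>UNIV. if i = l then E_mult C v B l else 0)"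
        unfolding T by (intro sum.cong) auto
      also have "\<dots> = E_mult C v A k" using l by (simp add: E_mult_def)
      finally show ?thesis using 1 by simp
    next
      case False
      have powi_sum: "(\<Prod>i\<in>I. (y $ k) powi f i) = (y $ k) powi (\<Sum>i\<in>I. f i)" if "finite I" for f :: "'d \<Rightarrow> int" and I
        using that by (induction I rule: finite_induct) (auto simp: power_int_add False)
      have "(\<Prod>i\<in>UNIV. ((y $ k) powi (?T $ k $ i)) ^ (sec_exp v B m $ i)) =
          (y $ k) powi (\<Sum>i\<in>UNIV. ?T $ k $ i * int (sec_exp v B m $ i))"
        by (subst powi_sum[symmetric]) (auto simp: power_int_mult)
      also have "(\<Sum>i\<in>UNIV. ?T $ k $ i * int (sec_exp v B m $ i)) =
          (\<Sum>i\<in>UNIV. ?T $ k $ i * int (chart_exp B m $ i)) - (\<Sum>i\<in>UNIV. ?T $ k $ i * E_mult C v B i)"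
        by (simp add: int_sec_exp[OF m] algebra_simps sum_subtractf)
      also have "(\<Sum>i\<in>UNIV. ?T $ k $ i * int (chart_exp B m $ i)) = int (chart_exp A m $ k)"
      proof -
        define w where "w = (\<chi> i. int (m $ i))"
        have e: "int (chart_exp A' m $ i) = (A' *v w) $ i" if "A' \<in> Z_charts C" for A' i
          using Z_nonneg[OF that] by (simp add: matrix_vector_mult_def w_def chart_exp_def row_wt_def)
        have "(\<Sum>i\<in>UNIV. ?T $ k $ i * int (chart_exp B m $ i)) = (?T *v (B *v w)) $ k"
          unfolding e[OF B] by (simp add: matrix_vector_mult_def[of ?T])
        also have "?T *v (B *v w) = A *v w"
          using transition_mult(1)[OF B] by (simp add: matrix_vector_mul_assoc)
        finally show ?thesis by (simp add: e[OF A])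
      qed
      also have "int (chart_exp A m $ k) - (\<Sum>i\<in>UNIV. ?T $ k $ i * E_mult C v B i) =
          int (sec_exp v A m $ k) + (E_mult C v A k - (\<Sum>i\<in>UNIV. ?T $ k $ i * E_mult C v B i))"
        by (simp add: int_sec_exp[OF m])
      finally show ?thesis using False by (simp add: power_int_add)
    qed
  qed
  also have "\<dots> = mono_section v m A y * E_unit C v A B y"
    using A y by (simp add: prod.distrib mono_section_def mpow_def E_unit_def)
  finally show ?thesis .
qed

lemma comb_in_H0: "comb v c \<in> H0 C v"
  unfolding H0_def
proof (intro CollectI conjI ballI allI impI)
  fix A y assume "\<not> (A \<in> Z_charts C \<and> y \<in> D_in C A)"
  then show "comb v c A y = 0" by (auto simp: comb_def mono_section_def)
next
  fix A y assume A: "A \<in> Z_charts C" and y: "y \<in> D_in C A"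
  \<comment> \<open>Any polyradius beyond \<open>y\<close> serves, since the sum is finite.\<close>
  define R where "R = (\<chi> k. complex_of_real (norm (y $ k) + 1))"
  have "norm (y $ k) < norm (R $ k)" for k
  proof -
    have "norm (R $ k) = \<bar>norm (y $ k) + 1\<bar>" by (simp only: R_def vec_lambda_beta norm_of_real)
    then show ?thesis by simp
  qed
  then have "holo_at (\<lambda>w. \<Sum>\<^sub>\<infinity>m\<in>minimal v. c m * mpow w (sec_exp v A m)) y"
    by (intro holo_at_monomial_series[where R = R]) (simp_all add: finite_minimal)
  then have "holo_at (\<lambda>w. \<Sum>m\<in>minimal v. c m * mpow w (sec_exp v A m)) y"
    by (simp add: finite_minimal)
  moreover have "\<forall>\<^sub>F w in nhds y. w \<in> D_in C A \<longrightarrow> comb v c A w = (\<Sum>m\<in>minimal v. c m * mpow w (sec_exp v A m))"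
    using A by (intro always_eventually) (simp add: comb_def mono_section_def)
  ultimately show "\<exists>u. holo_at u y \<and> (\<forall>\<^sub>F w in nhds y. w \<in> D_in C A \<longrightarrow> comb v c A w = u w)" by blast
next
  fix A B y z assume "A \<in> Z_charts C" "B \<in> Z_charts C" "y \<in> D_in C A" "glued A B y z"
  then have "mono_section v m B z = mono_section v m A y * E_unit C v A B y" if "m \<in> minimal v" for m
    using mono_section_glued that by (simp add: minimal_def)
  then show "comb v c B z = comb v c A y * E_unit C v A B y"
    by (simp add: comb_def sum_distrib_right mult.assoc)
qed

text \<open>Monomials exceeding \<open>v\<close> at \<open>a\<close> or \<open>b\<close> vanish on
  the intersection. In a chart showing both components, the others do not involve the two equations
  and stay distinct monomials in the remaining coordinates, so any nonzero coefficient is detected.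
  The case \<open>a = b\<close> treats a single component.\<close>

lemma comb_nonzero_on_intersection_iff:
  assumes ab: "a < r" "b < r" and ne: "E_int C a b \<noteq> {}"
  shows "(\<exists>(A, y)\<in>E_int C a b. comb v c A y \<noteq> 0) \<longleftrightarrow>
    (\<exists>m\<in>minimal v. c m \<noteq> 0 \<and> int (wt a m) = v a \<and> int (wt b m) = v b)"
proof
  assume "\<exists>(A, y)\<in>E_int C a b. comb v c A y \<noteq> 0"
  then obtain A y where A: "A \<in> Z_charts C" "y \<in> E_in C a A" "y \<in> E_in C b A" "comb v c A y \<noteq> 0"
    by (auto simp: E_int_def)
  have "y \<in> D_in C A" using A ab by (auto simp: D_in_def)
  then obtain m where m: "m \<in> minimal v" "c m * mpow y (sec_exp v A m) \<noteq> 0"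
    using A(1,4) unfolding comb_def mono_section_def by (auto elim: sum.not_neutral_contains_not_neutral)
  then have "m \<in> above v" by (simp add: minimal_def)
  then have "int (wt a m) = v a" "int (wt b m) = v b"
    using mono_section_vanish[of m v y _ A] A ab m(2) by fastforce+
  then show "\<exists>m\<in>minimal v. c m \<noteq> 0 \<and> int (wt a m) = v a \<and> int (wt b m) = v b" using m by auto
next
  assume "\<exists>m\<in>minimal v. c m \<noteq> 0 \<and> int (wt a m) = v a \<and> int (wt b m) = v b"
  then obtain m0 where m0: "m0 \<in> minimal v" "c m0 \<noteq> 0" "int (wt a m0) = v a" "int (wt b m0) = v b" by blast
  obtain A k l where A: "A \<in> Z_charts C" "A $ k = ray a" "A $ l = ray b"
    using ne by (auto simp: E_int_def E_in_def)
  define S where "S = {m \<in> minimal v. int (wt a m) = v a \<and> int (wt b m) = v b}"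
  show "\<exists>(A, y)\<in>E_int C a b. comb v c A y \<noteq> 0"
  proof (rule ccontr)
    assume no: "\<not> ?thesis"
    have zero: "((\<lambda>m. c m * mpow h (sec_exp v A m)) has_sum 0) S" for h :: "complex^'d"
    proof -
      \<comment> \<open>An arbitrary \<open>h\<close> is moved onto the intersection. The surviving
        monomials have exponent 0 at \<open>k\<close> and \<open>l\<close>, so the relation among
        them holds at \<open>h\<close> itself.\<close>
      define y where "y = (\<chi> i. if i = k \<or> i = l then 0 else h $ i)"
      have "y $ k = 0" "y $ l = 0" by (simp_all add: y_def)
      then have yE: "y \<in> E_in C a A" "y \<in> E_in C b A" unfolding E_in_def using A by blast+
      then have yD: "y \<in> D_in C A" using ab by (auto simp: D_in_def)
      have "comb v c A y = 0" using no A(1) yE by (auto simp: E_int_def)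
      then have "(\<Sum>m\<in>minimal v. c m * mpow y (sec_exp v A m)) = 0"
        using A(1) yD by (simp add: comb_def mono_section_def)
      also have "(\<Sum>m\<in>minimal v. c m * mpow y (sec_exp v A m)) = (\<Sum>m\<in>S. c m * mpow y (sec_exp v A m))"
      proof (rule sum.mono_neutral_right)
        show "\<forall>m\<in>minimal v - S. c m * mpow y (sec_exp v A m) = 0"
        proof
          fix m assume m: "m \<in> minimal v - S"
          then have "m \<in> above v" "int (wt a m) \<noteq> v a \<or> int (wt b m) \<noteq> v b"
            by (auto simp: minimal_def S_def)
          then have "mpow y (sec_exp v A m) = 0" using mono_section_vanish yE ab by blast
          then show "c m * mpow y (sec_exp v A m) = 0" by simp
        qed
      qed (auto simp: S_def finite_minimal)
      also have "\<dots> = (\<Sum>m\<in>S. c m * mpow h (sec_exp v A m))"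
      proof (intro sum.cong refl)
        fix m assume "m \<in> S"
        then have "m \<in> above v" "int (wt a m) = v a" "int (wt b m) = v b" by (auto simp: S_def minimal_def)
        then have "sec_exp v A m $ k = 0" "sec_exp v A m $ l = 0"
          using sec_exp_ray[of m v a A k] sec_exp_ray[of m v b A l] ab A by auto
        then have "mpow y (sec_exp v A m) = mpow h (sec_exp v A m)"
          unfolding mpow_def y_def by (intro prod.cong) auto
        then show "c m * mpow y (sec_exp v A m) = c m * mpow h (sec_exp v A m)" by simp
      qed
      finally show ?thesis by (intro has_sum_finiteI) (auto simp: S_def finite_minimal)
    qed
    have "c m0 = 0"
    proof (rule monomial_series_identity[where e = 1 and S = S and n = "sec_exp v A" and a = c])
      show "m0 \<in> S" using m0 by (simp add: S_def)
      fix m assume "m \<in> S" "sec_exp v A m = sec_exp v A m0"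
      then show "m = m0"
        using inj_on_sec_exp[OF A(1), of v] m0(1) by (auto simp: S_def minimal_def dest: inj_onD)
    qed (use zero in auto)
    then show False using m0(2) by simp
  qed
qed

lemma E_int_diag: "j < r \<Longrightarrow> E_int C j j \<noteq> {}"
proof -
  assume "j < r"
  then obtain A k where "A \<in> Z_charts C" "A $ k = ray j" using ray_in_chart by blast
  then have "(A, 0) \<in> E_int C j j" by (auto simp: E_int_def E_in_def)
  then show ?thesis by blast
qed

text \<open>Linear independence of the monomial sections: a minimal monomial attains equality on
  some component, and its coefficient is detected there.\<close>

lemma comb_eq_0_iff: "comb v c = (\<lambda>A y. 0) \<longleftrightarrow> (\<forall>m\<in>minimal v. c m = 0)"
proof
  assume z: "comb v c = (\<lambda>A y. 0)"
  show "\<forall>m\<in>minimal v. c m = 0"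
  proof
    fix m assume m: "m \<in> minimal v"
    then obtain j where j: "j < r" "int (wt j m) = v j" by (auto simp: minimal_def)
    show "c m = 0"
      using comb_nonzero_on_intersection_iff[OF j(1) j(1) E_int_diag[OF j(1)], of v c] z m j by auto
  qed
qed (auto simp: comb_def)

text \<open>The pairs with \<open>a = b\<close> require that each value \<open>v a\<close> is
  attained; those with \<open>a \<noteq> b\<close> exclude vanishing on a whole
  intersection.\<close>

definition admissible :: "(nat \<Rightarrow> int) \<Rightarrow> (nat^'d) set set" where
  "admissible v = {S. S \<subseteq> minimal v \<and> (\<forall>a<r. \<forall>b<r. E_int C a b \<noteq> {} \<longrightarrow>
     (\<exists>m\<in>S. int (wt a m) = v a \<and> int (wt b m) = v b))}"

lemma D_set_eq:
  "D_set C v = {proj_class (comb v c) | c. {m \<in> minimal v. c m \<noteq> 0} \<in> admissible v}"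
proof (intro equalityI subsetI)
  fix s assume "s \<in> D_set C v"
  then obtain g where g: "s = proj_class (restr_section C v g)" "holo_at g 0"
    "\<And>i. i < r \<Longrightarrow> 0 \<le> v i \<and> nu C i g = enat (nat (v i))"
    "\<And>a b. a < r \<Longrightarrow> b < r \<Longrightarrow> a \<noteq> b \<Longrightarrow> E_int C a b \<noteq> {} \<Longrightarrow> \<not> E_int C a b \<subseteq> strict_zeros C v g"
    unfolding D_set_def by blast
  obtain c e where c: "expands g c e" using g(2) holo_at_0_expands by blast
  have nu: "\<And>j m. j < r \<Longrightarrow> c m \<noteq> 0 \<Longrightarrow> nat (v j) \<le> wt j m" "\<And>j. j < r \<Longrightarrow> \<exists>m. c m \<noteq> 0 \<and> wt j m = nat (v j)"
    using nu_eq_iff[OF _ c] g(3) by blast+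
  have ab: "m \<in> above v" if "c m \<noteq> 0" for m using nu(1)[OF _ that] g(3) by (force simp: above_def)
  have eq: "restr_section C v g = comb v c"
    by (rule restr_section_eq_comb[OF c ab]) (use g(3) in auto)
  have "\<exists>m\<in>{m \<in> minimal v. c m \<noteq> 0}. int (wt a m) = v a \<and> int (wt b m) = v b"
    if ab': "a < r" "b < r" "E_int C a b \<noteq> {}" for a b
  proof (cases "a = b")
    case True
    obtain m where m: "c m \<noteq> 0" "wt a m = nat (v a)" using nu(2)[OF ab'(1)] by blast
    then have "m \<in> minimal v" "int (wt a m) = v a" using ab g(3)[OF ab'(1)] ab'(1) by (auto simp: minimal_def)
    then show ?thesis using True m by auto
  next
    case False
    obtain A y where "(A, y) \<in> E_int C a b" "(A, y) \<notin> strict_zeros C v g" using g(4)[OF ab'(1,2) False ab'(3)] by auto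
    then have "(A, y) \<in> E_int C a b \<and> comb v c A y \<noteq> 0"
      using ab' by (auto simp: strict_zeros_def eq E_int_def D_in_def)
    then show ?thesis using comb_nonzero_on_intersection_iff[OF ab', of v c] by blast
  qed
  then have "{m \<in> minimal v. c m \<noteq> 0} \<in> admissible v" by (auto simp: admissible_def)
  then show "s \<in> {proj_class (comb v c) | c. {m \<in> minimal v. c m \<noteq> 0} \<in> admissible v}" using g(1) eq by auto
next
  fix s assume "s \<in> {proj_class (comb v c) | c. {m \<in> minimal v. c m \<noteq> 0} \<in> admissible v}"
  then obtain c where c: "s = proj_class (comb v c)" "{m \<in> minimal v. c m \<noteq> 0} \<in> admissible v" by blast
  define a where "a m = (if m \<in> minimal v then c m else 0)" for m
  \<comment> \<open>Prescribed coefficients on \<open>minimal v\<close> are realised by a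
    polynomial.\<close>
  define g where "g x = (\<Sum>m\<in>minimal v. a m * mpow x m)" for x :: "complex^'d"
  have exp: "expands g a 1"
    unfolding expands_def g_def
    by (intro conjI allI impI has_sum_finite_neutralI[OF finite_minimal]) (auto simp: a_def)
  have adm: "\<exists>m\<in>minimal v. c m \<noteq> 0 \<and> int (wt a m) = v a \<and> int (wt b m) = v b" if "a < r" "b < r" "E_int C a b \<noteq> {}" for a b
    using c(2) that unfolding admissible_def by blast
  \<comment> \<open>Nonnegativity is forced, as each \<open>v j\<close> is the weight of some
    monomial.\<close>
  have v: "0 \<le> v j" if "j < r" for j using adm[OF that that E_int_diag[OF that]] by auto
  have ab: "m \<in> above v" if "a m \<noteq> 0" for m using that by (auto simp: a_def minimal_def split: if_splits)
  have eq: "restr_section C v g = comb v a" by (rule restr_section_eq_comb[OF exp ab v])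
  have eq': "comb v a = comb v c" by (simp add: comb_def a_def)
  have "nu C j g = enat (nat (v j))" if j: "j < r" for j
    unfolding nu_eq_iff[OF j exp]
  proof
    show "\<forall>m. a m \<noteq> 0 \<longrightarrow> nat (v j) \<le> wt j m" using ab j by (force simp: above_def)
    obtain m where "m \<in> minimal v" "c m \<noteq> 0" "int (wt j m) = v j" using adm[OF j j E_int_diag[OF j]] by blast
    then show "\<exists>m. a m \<noteq> 0 \<and> wt j m = nat (v j)" by (intro exI[of _ m]) (auto simp: a_def)
  qed
  moreover have "\<not> E_int C i j \<subseteq> strict_zeros C v g" if ij: "i < r" "j < r" "E_int C i j \<noteq> {}" for i j
  proof -
    obtain A y where "(A, y) \<in> E_int C i j" "comb v c A y \<noteq> 0"
      using comb_nonzero_on_intersection_iff[OF ij, of v c] adm[OF ij] by blast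
    then have "(A, y) \<notin> strict_zeros C v g" by (simp add: strict_zeros_def eq eq')
    then show ?thesis using \<open>(A, y) \<in> E_int C i j\<close> by blast
  qed
  moreover have "holo_at g 0" using exp holo_at_0_expands by blast
  ultimately show "s \<in> D_set C v"
    unfolding D_set_def c(1) eq'[symmetric] eq[symmetric] using v by blast
qed

end

section \<open>The Poincare series counts monomials\<close>

text \<open>
  Independence of the basis is a trace argument: the transition matrices satisfy \<open>P Q = 1\<close> and
  \<open>Q P = 1\<close>, and \<open>tr (P Q) = tr (Q P)\<close>.
\<close>

lemma quot_dim_eqI:
  fixes V W :: "('a \<Rightarrow> complex) set" and \<kappa> :: "('a \<Rightarrow> complex) \<Rightarrow> 'm \<Rightarrow> complex"
  assumes M: "finite M"
    and lin: "\<And>g B c. g \<in> V \<Longrightarrow> finite B \<Longrightarrow> B \<subseteq> V \<Longrightarrow> (\<lambda>x. g x - (\<Sum>b\<in>B. c b * b x)) \<in> V \<and>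
       (\<forall>m\<in>M. \<kappa> (\<lambda>x. g x - (\<Sum>b\<in>B. c b * b x)) m = \<kappa> g m - (\<Sum>b\<in>B. c b * \<kappa> b m))"
    and ker: "\<And>g. g \<in> V \<Longrightarrow> g \<in> W \<longleftrightarrow> (\<forall>m\<in>M. \<kappa> g m = 0)"
    and e: "\<And>m. m \<in> M \<Longrightarrow> e m \<in> V" "\<And>m m'. m \<in> M \<Longrightarrow> m' \<in> M \<Longrightarrow> \<kappa> (e m) m' = of_bool (m = m')"
  shows "quot_dim V W = card M"
proof -
  define P where "P B \<longleftrightarrow> finite B \<and> B \<subseteq> V \<and>
     (\<forall>g\<in>V. \<exists>!c. (\<forall>b. b \<notin> B \<longrightarrow> c b = 0) \<and> (\<lambda>x. g x - (\<Sum>b\<in>B. c b * b x)) \<in> W)" for B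
  have inW: "(\<lambda>x. g x - (\<Sum>b\<in>B. c b * b x)) \<in> W \<longleftrightarrow> (\<forall>m\<in>M. \<kappa> g m = (\<Sum>b\<in>B. c b * \<kappa> b m))"
    if "g \<in> V" "finite B" "B \<subseteq> V" for g B c
    using ker lin[OF that, of c] by simp
  have inj: "inj_on e M"
  proof (rule inj_onI)
    fix m m' assume "m \<in> M" "m' \<in> M" "e m = e m'"
    then show "m = m'" using e(2)[of m m'] e(2)[of m' m'] by (auto split: if_splits)
  qed
  have eM: "finite (e ` M)" "e ` M \<subseteq> V" using M e(1) by auto
  have sum_e: "(\<Sum>b\<in>e ` M. c b * \<kappa> b m) = c (e m)" if "m \<in> M" for c m
  proof -
    have "(\<Sum>b\<in>e ` M. c b * \<kappa> b m) = (\<Sum>m'\<in>M. c (e m') * \<kappa> (e m') m)"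
      using inj by (simp add: sum.reindex)
    also have "\<dots> = (\<Sum>m'\<in>M. if m' = m then c (e m') else 0)"
      using e(2) that by (intro sum.cong) auto
    finally show ?thesis using M that by simp
  qed
  have "P (e ` M)"
    unfolding P_def
  proof (intro conjI ballI eM)
    fix g assume g: "g \<in> V"
    show "\<exists>!c. (\<forall>b. b \<notin> e ` M \<longrightarrow> c b = 0) \<and> (\<lambda>x. g x - (\<Sum>b\<in>e ` M. c b * b x)) \<in> W"
      unfolding inW[OF g eM]
    proof (rule ex1I)
      show "(\<forall>b. b \<notin> e ` M \<longrightarrow> (if b \<in> e ` M then \<kappa> g (inv_into M e b) else 0) = 0) \<and>
        (\<forall>m\<in>M. \<kappa> g m = (\<Sum>b\<in>e ` M. (if b \<in> e ` M then \<kappa> g (inv_into M e b) else 0) * \<kappa> b m))"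
        using sum_e[of _ "\<lambda>b. if b \<in> e ` M then \<kappa> g (inv_into M e b) else 0"] inj by simp
      fix c assume c: "(\<forall>b. b \<notin> e ` M \<longrightarrow> c b = 0) \<and> (\<forall>m\<in>M. \<kappa> g m = (\<Sum>b\<in>e ` M. c b * \<kappa> b m))"
      then show "c = (\<lambda>b. if b \<in> e ` M then \<kappa> g (inv_into M e b) else 0)"
        using sum_e[of _ c] inj by (auto simp: fun_eq_iff)
    qed
  qed
  moreover have "card B = card M" if "P B" for B
  proof -
    have B: "finite B" "B \<subseteq> V" using that by (auto simp: P_def)
    have un: "\<exists>!c. (\<forall>b. b \<notin> B \<longrightarrow> c b = 0) \<and> (\<forall>m\<in>M. \<kappa> g m = (\<Sum>b\<in>B. c b * \<kappa> b m))" if "g \<in> V" for g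
    proof -
      have "\<exists>!c. (\<forall>b. b \<notin> B \<longrightarrow> c b = 0) \<and> (\<lambda>x. g x - (\<Sum>b\<in>B. c b * b x)) \<in> W"
        using \<open>P B\<close> that unfolding P_def by blast
      then show ?thesis unfolding inW[OF that B] .
    qed
    have "\<exists>c. \<forall>m'\<in>M. \<kappa> (e m) m' = (\<Sum>b\<in>B. c b * \<kappa> b m')" if "m \<in> M" for m
      using un[OF e(1)[OF that]] by blast
    then obtain d where d: "\<And>m m'. m \<in> M \<Longrightarrow> m' \<in> M \<Longrightarrow> \<kappa> (e m) m' = (\<Sum>b\<in>B. d m b * \<kappa> b m')"
      by metis
    have d1: "(\<Sum>m\<in>M. \<kappa> b m * d m b') = of_bool (b = b')" if b: "b \<in> B" "b' \<in> B" for b b'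
    proof -
      \<comment> \<open>\<open>?c1\<close> and \<open>?c2\<close> are both coordinate vectors of
        \<open>b\<close> with respect to \<open>B\<close>, one the trivial one and one obtained by
        passing through the \<open>e m\<close>. Uniqueness of coordinates yields the second of the
        two matrix identities.\<close>
      let ?c1 = "\<lambda>b'. of_bool (b' = b) :: complex"
      let ?c2 = "\<lambda>b'. if b' \<in> B then \<Sum>m\<in>M. \<kappa> b m * d m b' else 0"
      have 1: "\<kappa> b m = (\<Sum>b'\<in>B. ?c1 b' * \<kappa> b' m)" for m
      proof -
        have "(\<Sum>b'\<in>B. ?c1 b' * \<kappa> b' m) = (\<Sum>b'\<in>B. if b' = b then \<kappa> b' m else 0)"
          by (intro sum.cong) auto
        then show ?thesis using b B by simp
      qed
      have 2: "\<kappa> b m' = (\<Sum>b'\<in>B. ?c2 b' * \<kappa> b' m')" if "m' \<in> M" for m'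
      proof -
        have "(\<Sum>b'\<in>B. ?c2 b' * \<kappa> b' m') = (\<Sum>b'\<in>B. \<Sum>m\<in>M. \<kappa> b m * (d m b' * \<kappa> b' m'))"
          by (simp add: sum_distrib_right mult.assoc)
        also have "\<dots> = (\<Sum>m\<in>M. \<kappa> b m * (\<Sum>b'\<in>B. d m b' * \<kappa> b' m'))"
          by (subst sum.swap) (simp add: sum_distrib_left)
        also have "\<dots> = (\<Sum>m\<in>M. if m = m' then \<kappa> b m else 0)"
        proof (intro sum.cong refl)
          fix m assume m: "m \<in> M"
          have "(\<Sum>b'\<in>B. d m b' * \<kappa> b' m') = of_bool (m = m')"
            using d[OF m that] e(2)[OF m that] by simp
          then show "\<kappa> b m * (\<Sum>b'\<in>B. d m b' * \<kappa> b' m') = (if m = m' then \<kappa> b m else 0)" by simp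
        qed
        finally show ?thesis using M that by simp
      qed
      have "?c1 = ?c2"
      proof -
        define Q where "Q c \<longleftrightarrow> (\<forall>b. b \<notin> B \<longrightarrow> c b = 0) \<and> (\<forall>m\<in>M. \<kappa> b m = (\<Sum>b'\<in>B. c b' * \<kappa> b' m))" for c
        have "\<exists>!c. Q c" unfolding Q_def using un[of b] b B(2) by blast
        then have eq: "c = c'" if "Q c" "Q c'" for c c' using that by blast
        have "Q ?c1" unfolding Q_def using 1 b by auto
        moreover have "Q ?c2" unfolding Q_def by (intro conjI ballI) (simp, rule 2)
        ultimately show ?thesis by (rule eq)
      qed
      then have "?c1 b' = ?c2 b'" by (rule fun_cong)
      then show ?thesis using b by (simp add: eq_commute)
    qed
    have "of_nat (card M) = (\<Sum>m\<in>M. \<kappa> (e m) m)" using e(2) by simp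
    also have "\<dots> = (\<Sum>m\<in>M. \<Sum>b\<in>B. d m b * \<kappa> b m)" using d by simp
    also have "\<dots> = (\<Sum>b\<in>B. \<Sum>m\<in>M. \<kappa> b m * d m b)" by (subst sum.swap) (simp add: mult.commute)
    also have "\<dots> = (of_nat (card B) :: complex)" using d1 by simp
    finally show ?thesis by (simp only: of_nat_eq_iff)
  qed
  moreover have "card (e ` M) = card M" using inj by (rule card_image)
  ultimately have "(THE n. \<exists>B. card B = n \<and> P B) = card M" by (intro the_equality) auto
  then show ?thesis unfolding quot_dim_def P_def by (simp add: conj_ac)
qed

section \<open>Taylor coefficients at the origin\<close>

lemma expands_unique:
  fixes g :: "complex^'d::finite \<Rightarrow> complex"
  assumes "expands g a e" "expands g a' e'"
  shows "a = a'"
proof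
  fix m
  have "a m - a' m = 0"
  proof (rule monomial_series_identity[where S = UNIV and n = "\<lambda>m. m" and a = "\<lambda>m. a m - a' m" and e = "min e e'"])
    fix h :: "complex^'d" assume "norm h < min e e'"
    then have 1: "((\<lambda>m. a m * mpow h m) has_sum g h) UNIV" and 2: "((\<lambda>m. a' m * mpow h m) has_sum g h) UNIV"
      using assms by (auto simp: expands_def)
    show "((\<lambda>m. (a m - a' m) * mpow h m) has_sum 0) UNIV"
      using has_sum_add[OF 1 has_sum_cmult_right[OF 2, of "-1"]] by (simp add: algebra_simps)
  qed (use assms in \<open>auto simp: expands_def\<close>)
  then show "a m = a' m" by simp
qed

definition taylor :: "(complex^'d \<Rightarrow> complex) \<Rightarrow> nat^'d \<Rightarrow> complex" where
  "taylor g = (SOME a. \<exists>e. expands g a e)"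

lemma taylor_eqI: "expands (g :: complex^'d::finite \<Rightarrow> complex) a e \<Longrightarrow> taylor g = a"
  unfolding taylor_def by (rule some_equality) (auto dest: expands_unique)

lemma expands_taylor:
  assumes "holo_at (g :: complex^'d::finite \<Rightarrow> complex) 0"
  obtains e where "expands g (taylor g) e"
  using assms taylor_eqI by (metis holo_at_0_expands)

lemma expands_sub_scale:
  fixes f g :: "complex^'d::finite \<Rightarrow> complex"
  assumes "expands f a e" "expands g b e'"
  shows "expands (\<lambda>x. f x - c * g x) (\<lambda>m. a m - c * b m) (min e e')"
  unfolding expands_def
proof (intro conjI allI impI)
  fix h :: "complex^'d" assume h: "norm h < min e e'"
  have 1: "((\<lambda>m. a m * mpow h m) has_sum f h) UNIV" and 2: "((\<lambda>m. b m * mpow h m) has_sum g h) UNIV"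
    using assms h by (auto simp: expands_def)
  show "((\<lambda>m. (a m - c * b m) * mpow h m) has_sum (f h - c * g h)) UNIV"
    using has_sum_add[OF 1 has_sum_cmult_right[OF 2, of "- c"]] by (simp add: algebra_simps)
qed (use assms in \<open>auto simp: expands_def\<close>)

lemma expands_sub_sum:
  fixes g :: "complex^'d::finite \<Rightarrow> complex"
  assumes "finite B" "holo_at g 0" "\<And>b. b \<in> B \<Longrightarrow> holo_at b 0"
  shows "\<exists>e. expands (\<lambda>x. g x - (\<Sum>b\<in>B. c b * b x)) (\<lambda>m. taylor g m - (\<Sum>b\<in>B. c b * taylor b m)) e"
  using assms(1,3)
proof (induction B rule: finite_induct)
  case empty
  then show ?case using assms(2) by (auto elim: expands_taylor)
next
  case (insert b B)
  obtain e where e: "expands (\<lambda>x. g x - (\<Sum>b\<in>B. c b * b x)) (\<lambda>m. taylor g m - (\<Sum>b\<in>B. c b * taylor b m)) e"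
    using insert by auto
  obtain e' where e': "expands b (taylor b) e'" using insert.prems[of b] by (auto elim: expands_taylor)
  show ?case
    using expands_sub_scale[OF e e', of "c b"] insert.hyps by (auto simp: algebra_simps)
qed

section \<open>Difference operators on formal series\<close>

lemma fold_mult_diff:
  "fold mult_t_minus_1 xs (\<lambda>v. f v - g v) = (\<lambda>v. fold mult_t_minus_1 xs f v - fold mult_t_minus_1 xs g v)"
proof (induction xs arbitrary: f g)
  case (Cons x xs)
  have "mult_t_minus_1 x (\<lambda>v. f v - g v) = (\<lambda>v. mult_t_minus_1 x f v - mult_t_minus_1 x g v)"
    by (simp add: mult_t_minus_1_def fun_eq_iff)
  then show ?case by (simp add: Cons.IH)
qed simp

lemma fold_mult_zero: "fold mult_t_minus_1 xs (\<lambda>v. 0) = (\<lambda>v. 0)"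
  by (induction xs) (auto simp: mult_t_minus_1_def[abs_def])

lemma fold_mult_sum:
  "finite T \<Longrightarrow> fold mult_t_minus_1 xs (\<lambda>v. \<Sum>m\<in>T. f m v) = (\<lambda>v. \<Sum>m\<in>T. fold mult_t_minus_1 xs (f m) v)"
proof (induction xs arbitrary: f)
  case (Cons x xs)
  then show ?case by (simp add: mult_t_minus_1_def[abs_def] flip: sum_subtractf)
qed simp

lemma fold_mult_Suc:
  "fold mult_t_minus_1 [0..<Suc n] f = mult_t_minus_1 n (fold mult_t_minus_1 [0..<n] f)"
  by simp

text \<open>The operators only look downwards, and only in the first \<open>n\<close> coordinates. A
  formula for the coefficients valid below \<open>v\<close> is therefore enough, and there finitely
  many monomials matter.\<close>

lemma fold_mult_local:
  assumes "\<And>w. (\<forall>i. w i \<le> v i) \<Longrightarrow> (\<forall>i\<ge>n. w i = v i) \<Longrightarrow> f w = g w"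
  shows "fold mult_t_minus_1 [0..<n] f v = fold mult_t_minus_1 [0..<n] g v"
  using assms
proof (induction n arbitrary: v)
  case (Suc n)
  have "fold mult_t_minus_1 [0..<n] f (v(n := v n - 1)) = fold mult_t_minus_1 [0..<n] g (v(n := v n - 1))"
  proof (rule Suc.IH)
    fix w assume w: "\<forall>i. w i \<le> (v(n := v n - 1)) i" "\<forall>i\<ge>n. w i = (v(n := v n - 1)) i"
    show "f w = g w"
    proof (rule Suc.prems)
      show "\<forall>i. w i \<le> v i"
      proof
        fix i show "w i \<le> v i" using w(1)[rule_format, of i] by (cases "i = n") auto
      qed
      show "\<forall>i\<ge>Suc n. w i = v i" using w(2) by auto
    qed
  qed
  moreover have "fold mult_t_minus_1 [0..<n] f v = fold mult_t_minus_1 [0..<n] g v"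
    by (rule Suc.IH) (use Suc.prems in auto)
  ultimately show ?case unfolding fold_mult_Suc by (simp add: mult_t_minus_1_def)
qed simp

text \<open>The operators belong to separate variables, so each acts on its own factor; the factors
  from \<open>n\<close> on are still untouched.\<close>

lemma fold_mult_prod:
  assumes "n \<le> R"
  shows "fold mult_t_minus_1 [0..<n] (\<lambda>v. \<Prod>i<R. F i (v i)) =
    (\<lambda>v. (\<Prod>i<n. F i (v i - 1) - F i (v i)) * (\<Prod>i\<in>{n..<R}. F i (v i)))"
  using assms
proof (induction n)
  case 0
  then show ?case by (simp add: lessThan_atLeast0)
next
  case (Suc n)
  show ?case
  proof
    fix v
    have "(\<Prod>i<n. F i ((v(n := v n - 1)) i - 1) - F i ((v(n := v n - 1)) i)) = (\<Prod>i<n. F i (v i - 1) - F i (v i))"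
      by (intro prod.cong) auto
    moreover have "(\<Prod>i\<in>{n..<R}. F i ((v(n := v n - 1)) i)) = F n (v n - 1) * (\<Prod>i\<in>{Suc n..<R}. F i (v i))"
      using Suc.prems by (subst prod.atLeast_Suc_lessThan) (auto intro!: prod.cong)
    moreover have "(\<Prod>i\<in>{n..<R}. F i (v i)) = F n (v n) * (\<Prod>i\<in>{Suc n..<R}. F i (v i))"
      using Suc.prems by (subst prod.atLeast_Suc_lessThan) auto
    moreover have "fold mult_t_minus_1 [0..<Suc n] (\<lambda>v. \<Prod>i<R. F i (v i)) v =
       (\<Prod>i<n. F i ((v(n := v n - 1)) i - 1) - F i ((v(n := v n - 1)) i)) * (\<Prod>i\<in>{n..<R}. F i ((v(n := v n - 1)) i)) -
       (\<Prod>i<n. F i (v i - 1) - F i (v i)) * (\<Prod>i\<in>{n..<R}. F i (v i))"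
    proof -
      have "fold mult_t_minus_1 [0..<n] (\<lambda>v. \<Prod>i<R. F i (v i)) =
          (\<lambda>v. (\<Prod>i<n. F i (v i - 1) - F i (v i)) * (\<Prod>i\<in>{n..<R}. F i (v i)))"
        using Suc by simp
      then show ?thesis by (simp only: fold_mult_Suc mult_t_minus_1_def)
    qed
    ultimately show "fold mult_t_minus_1 [0..<Suc n] (\<lambda>v. \<Prod>i<R. F i (v i)) v =
       (\<Prod>i<Suc n. F i (v i - 1) - F i (v i)) * (\<Prod>i\<in>{Suc n..<R}. F i (v i))"
      by (simp add: algebra_simps)
  qed
qed

context toric
begin

lemma I_filt_iff:
  assumes "expands g a e"
  shows "g \<in> I_filt C v \<longleftrightarrow> (\<forall>m. a m \<noteq> 0 \<longrightarrow> m \<in> above v)"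
proof -
  have "holo_at g 0" using assms holo_at_0_expands by blast
  then have "g \<in> I_filt C v \<longleftrightarrow> (\<forall>j<r. \<forall>m. a m \<noteq> 0 \<longrightarrow> nat (v j) \<le> wt j m)"
    using nu_ge_iff[OF _ assms] by (simp add: I_filt_def)
  also have "\<dots> \<longleftrightarrow> (\<forall>m. a m \<noteq> 0 \<longrightarrow> m \<in> above v)"
    by (auto simp: above_def nat_le_iff)
  finally show ?thesis .
qed

lemma above_plus_one: "above (plus_one r v) = above v - minimal v"
  by (force simp: above_def minimal_def plus_one_def)

text \<open>The Taylor coefficients at minimal monomials are coordinates on the quotient, dual to
  the monomials themselves.\<close>

lemma quot_dim_I_filt: "quot_dim (I_filt C v) (I_filt C (plus_one r v)) = card (minimal v)"
proof (rule quot_dim_eqI[where \<kappa> = taylor and e = "\<lambda>m x. mpow x m"])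
  have hol: "holo_at g 0" if "g \<in> I_filt C w" for g w using that by (simp add: I_filt_def)
  have tay: "taylor g m \<noteq> 0 \<Longrightarrow> m \<in> above w" if g: "g \<in> I_filt C w" for g m w
  proof -
    obtain e where "expands g (taylor g) e" using expands_taylor hol[OF g] by blast
    then show "taylor g m \<noteq> 0 \<Longrightarrow> m \<in> above w" using I_filt_iff g by blast
  qed
  show "finite (minimal v)" by (rule finite_minimal)
  fix g assume g: "g \<in> I_filt C v"
  show "g \<in> I_filt C (plus_one r v) \<longleftrightarrow> (\<forall>m\<in>minimal v. taylor g m = 0)"
  proof -
    obtain e where "expands g (taylor g) e" using expands_taylor hol[OF g] by blast
    then show ?thesis using I_filt_iff tay[OF g] by (auto simp: above_plus_one)
  qed
  fix B :: "(complex^'d \<Rightarrow> complex) set" and c assume B: "finite B" "B \<subseteq> I_filt C v"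
  let ?h = "\<lambda>x. g x - (\<Sum>b\<in>B. c b * b x)" and ?a = "\<lambda>m. taylor g m - (\<Sum>b\<in>B. c b * taylor b m)"
  obtain e where e: "expands ?h ?a e" using expands_sub_sum[of B g c] B hol g by blast
  have "m \<in> above v" if "?a m \<noteq> 0" for m
  proof (rule ccontr)
    assume "m \<notin> above v"
    then have "taylor g m = 0" "\<And>b. b \<in> B \<Longrightarrow> taylor b m = 0" using tay g B by blast+
    then show False using that by simp
  qed
  then have "?h \<in> I_filt C v" using I_filt_iff[OF e] by blast
  then show "?h \<in> I_filt C v \<and> (\<forall>m\<in>minimal v. taylor ?h m = ?a m)" using taylor_eqI[OF e] by simp
next
  have exp: "expands (\<lambda>x. mpow x m) (\<lambda>m'. of_bool (m = m')) 1" for m :: "nat^'d"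
    unfolding expands_def by (auto intro!: has_sum_finite_neutralI[of "{m}"])
  show "(\<lambda>x. mpow x m) \<in> I_filt C v" if "m \<in> minimal v" for m
    using that I_filt_iff[OF exp] by (auto simp: minimal_def)
  show "taylor (\<lambda>x. mpow x m) m' = of_bool (m = m')" for m m' :: "nat^'d"
  proof -
    have t: "taylor (\<lambda>x. mpow x m) = (\<lambda>m'. of_bool (m = m'))" by (rule taylor_eqI[OF exp])
    show ?thesis unfolding t ..
  qed
qed

definition exact_weight :: "(nat \<Rightarrow> int) \<Rightarrow> (nat^'d) set" where
  "exact_weight v = {m. \<forall>j<r. int (wt j m) = v j}"

definition weight_count :: "(nat \<Rightarrow> int) \<Rightarrow> int" where
  "weight_count v = (if v \<in> int_vecs r then int (card (exact_weight v)) else 0)"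

text \<open>The indicator of \<open>minimal w\<close> is that of \<open>above w\<close> minus that
  of \<open>above (plus_one r w)\<close>. Each is a product of step functions in one variable, and a
  difference operator turns a step into the indicator of a point.\<close>

lemma weight_count_recursion:
  "mult_prod_t_minus_1 r weight_count = fold mult_t_minus_1 [0..<r] (L_series C)"
proof
  fix v :: "nat \<Rightarrow> int"
  show "mult_prod_t_minus_1 r weight_count v = fold mult_t_minus_1 [0..<r] (L_series C) v"
  proof (cases "v \<in> int_vecs r")
    case False
    have "fold mult_t_minus_1 [0..<r] (L_series C) v = fold mult_t_minus_1 [0..<r] (\<lambda>v. 0) v"
    proof (rule fold_mult_local)
      fix w assume "\<forall>i\<ge>r. w i = v i"
      then have "w \<notin> int_vecs r" using False by (auto simp: int_vecs_def)
      then show "L_series C w = 0" by (simp add: L_series_def)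
    qed
    moreover have "minus_one r v \<notin> int_vecs r" using False by (auto simp: int_vecs_def minus_one_def)
    ultimately show ?thesis using False by (simp add: fold_mult_zero mult_prod_t_minus_1_def weight_count_def)
  next
    case True
    \<comment> \<open>Contains every monomial that is minimal for some \<open>w \<le> v\<close>, so
      one finite index set serves for all coefficients that enter at \<open>v\<close>.\<close>
    define T where "T = {m. \<exists>j<r. int (wt j m) \<le> v j}"
    have "T \<subseteq> (\<Union>j<r. {m. wt j m \<le> nat (v j)})" by (auto simp: T_def)
    moreover have "finite (\<Union>j<r. {m. wt j m \<le> nat (v j)})"
      by (intro finite_UN_I finite_row_wt_le) (auto simp: ray_pos)
    ultimately have T: "finite T" by (rule finite_subset)
    define F where "F m w = (\<Prod>i<r. of_bool (w i \<le> int (wt i m)) :: int)" for m and w :: "nat \<Rightarrow> int"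
    define G where "G m w = (\<Prod>i<r. of_bool (w i + 1 \<le> int (wt i m)) :: int)" for m and w :: "nat \<Rightarrow> int"
    have of_bool_prod: "(\<Prod>i<r. of_bool (Q i)) = (of_bool (\<forall>i<r. Q i) :: int)" for Q
      by (cases "\<forall>i<r. Q i") (auto intro!: prod_zero)
    have L: "L_series C w = (\<Sum>m\<in>T. F m w) - (\<Sum>m\<in>T. G m w)"
      if w: "\<forall>i. w i \<le> v i" "\<forall>i\<ge>r. w i = v i" for w
    proof -
      have "w \<in> int_vecs r" using True w by (auto simp: int_vecs_def)
      then have "L_series C w = int (card (minimal w))" by (simp add: L_series_def quot_dim_I_filt)
      also have "minimal w = {m\<in>T. m \<in> minimal w}" using w(1) by (auto simp: minimal_def T_def)
      also have "int (card \<dots>) = (\<Sum>m\<in>T. of_bool (m \<in> minimal w))"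
        using T by (simp add: sum.If_cases Int_def of_bool_def)
      also have "\<dots> = (\<Sum>m\<in>T. F m w - G m w)"
      proof (intro sum.cong refl)
        fix m
        have "F m w = of_bool (m \<in> above w)" by (simp add: F_def above_def of_bool_prod)
        moreover have "G m w = of_bool (m \<in> above (plus_one r w))"
          by (simp add: G_def above_def of_bool_prod plus_one_def)
        moreover have "minimal w \<subseteq> above w" by (auto simp: minimal_def)
        ultimately show "of_bool (m \<in> minimal w) = F m w - G m w" by (auto simp: above_plus_one)
      qed
      finally show ?thesis by (simp add: sum_subtractf)
    qed
    have "fold mult_t_minus_1 [0..<r] (L_series C) v =
        fold mult_t_minus_1 [0..<r] (\<lambda>w. (\<Sum>m\<in>T. F m w) - (\<Sum>m\<in>T. G m w)) v"
      by (rule fold_mult_local) (rule L)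
    also have "\<dots> = (\<Sum>m\<in>T. fold mult_t_minus_1 [0..<r] (F m) v) - (\<Sum>m\<in>T. fold mult_t_minus_1 [0..<r] (G m) v)"
      by (simp add: fold_mult_diff fold_mult_sum T)
    also have "(\<Sum>m\<in>T. fold mult_t_minus_1 [0..<r] (F m) v) = int (card (exact_weight (minus_one r v)))"
    proof -
      have "fold mult_t_minus_1 [0..<r] (F m) v = of_bool (m \<in> exact_weight (minus_one r v))" for m
      proof -
        have "fold mult_t_minus_1 [0..<r] (F m) v =
            (\<Prod>i<r. of_bool (v i - 1 \<le> int (wt i m)) - of_bool (v i \<le> int (wt i m)))"
          unfolding F_def using fold_mult_prod[OF order_refl, of r "\<lambda>i x. of_bool (x \<le> int (wt i m))"] by simp
        also have "\<dots> = (\<Prod>i<r. of_bool (int (wt i m) = v i - 1))" by (intro prod.cong) auto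
        finally show ?thesis by (simp add: of_bool_prod exact_weight_def minus_one_def)
      qed
      moreover have "exact_weight (minus_one r v) \<subseteq> T"
        using length_pos by (auto simp: exact_weight_def T_def minus_one_def intro!: exI[of _ 0])
      ultimately show ?thesis using T by (simp add: sum.If_cases of_bool_def Int_absorb1)
    qed
    also have "(\<Sum>m\<in>T. fold mult_t_minus_1 [0..<r] (G m) v) = int (card (exact_weight v))"
    proof -
      have "fold mult_t_minus_1 [0..<r] (G m) v = of_bool (m \<in> exact_weight v)" for m
      proof -
        have "fold mult_t_minus_1 [0..<r] (G m) v =
            (\<Prod>i<r. of_bool (v i - 1 + 1 \<le> int (wt i m)) - of_bool (v i + 1 \<le> int (wt i m)))"
          unfolding G_def using fold_mult_prod[OF order_refl, of r "\<lambda>i x. of_bool (x + 1 \<le> int (wt i m))"] by simp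
        also have "\<dots> = (\<Prod>i<r. of_bool (int (wt i m) = v i))" by (intro prod.cong) auto
        finally show ?thesis by (simp add: of_bool_prod exact_weight_def)
      qed
      moreover have "exact_weight v \<subseteq> T"
        using length_pos by (auto simp: exact_weight_def T_def intro!: exI[of _ 0])
      ultimately show ?thesis using T by (simp add: sum.If_cases of_bool_def Int_absorb1)
    qed
    finally have "fold mult_t_minus_1 [0..<r] (L_series C) v =
      int (card (exact_weight (minus_one r v))) - int (card (exact_weight v))" .
    moreover have "minus_one r v \<in> int_vecs r" using True by (auto simp: int_vecs_def minus_one_def)
    ultimately show ?thesis using True by (simp add: mult_prod_t_minus_1_def weight_count_def)
  qed
qed

text \<open>For uniqueness, the difference of two solutions is invariant under the shift by (1, ...,
  1), and shifting down far enough leaves the support of a power series.\<close>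

lemma poincare_series_eq: "poincare_series C = weight_count"
  unfolding poincare_series_def
proof (rule the_equality, intro conjI)
  show P0: "weight_count \<in> power_series r"
    unfolding power_series_def
  proof (intro CollectI allI impI)
    fix v assume "weight_count v \<noteq> 0"
    then have v: "v \<in> int_vecs r" "exact_weight v \<noteq> {}" by (auto simp: weight_count_def split: if_splits)
    then obtain m where "\<forall>j<r. int (wt j m) = v j" by (auto simp: exact_weight_def)
    then show "v \<in> int_vecs r \<and> (\<forall>i<r. 0 \<le> v i)" using v(1) by (metis of_nat_0_le_iff)
  qed
  show "mult_prod_t_minus_1 r weight_count = fold mult_t_minus_1 [0..<r] (L_series C)"
    by (rule weight_count_recursion)
  fix P assume P: "P \<in> power_series r \<and> mult_prod_t_minus_1 r P = fold mult_t_minus_1 [0..<r] (L_series C)"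
  define f where "f v = P v - weight_count v" for v
  have step: "f (minus_one r v) = f v" for v
  proof -
    have "mult_prod_t_minus_1 r P v = mult_prod_t_minus_1 r weight_count v"
      using P weight_count_recursion by simp
    then show ?thesis by (simp add: f_def mult_prod_t_minus_1_def)
  qed
  have "f v = 0" for v
  proof -
    have "f ((minus_one r ^^ k) v) = f v" for k by (induction k) (auto simp: step)
    moreover have "((minus_one r ^^ k) v) 0 = v 0 - int k" for k
      using length_pos by (induction k) (auto simp: minus_one_def)
    \<comment> \<open>For \<open>v 0 \<ge> 0\<close> these steps lead to -1; a negative
      \<open>v 0\<close> needs none.\<close>
    then have "((minus_one r ^^ nat (v 0 + 1)) v) 0 < 0" by simp
    then have "P ((minus_one r ^^ nat (v 0 + 1)) v) = 0" "weight_count ((minus_one r ^^ nat (v 0 + 1)) v) = 0"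
      using P P0 length_pos unfolding power_series_def by (metis (mono_tags, lifting) mem_Collect_eq not_le)+
    ultimately show ?thesis by (metis f_def diff_0_right)
  qed
  then show "P = weight_count" by (auto simp: f_def fun_eq_iff)
qed

end

section \<open>The Euler characteristic counts monomials\<close>

definition cont_functional :: "(('a \<Rightarrow> 'b \<Rightarrow> complex) \<Rightarrow> complex) \<Rightarrow> bool" where
  "cont_functional \<psi> \<longleftrightarrow> continuous_on UNIV \<psi> \<and>
     (\<forall>s t. \<psi> (\<lambda>x y. s x y + t x y) = \<psi> s + \<psi> t) \<and> (\<forall>c s. \<psi> (\<lambda>x y. c * s x y) = c * \<psi> s)"

lemma cont_functional_eval: "cont_functional (\<lambda>s. s p q)"
proof -
  have "continuous_on UNIV (\<lambda>s :: 'a \<Rightarrow> 'b \<Rightarrow> complex. s p)" by (rule continuous_on_product_coordinates)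
  from continuous_on_product_then_coordinatewise[OF this, of q] show ?thesis
    by (simp add: cont_functional_def)
qed

lemma cont_functional_add: "cont_functional \<psi> \<Longrightarrow> cont_functional \<phi> \<Longrightarrow> cont_functional (\<lambda>s. \<psi> s + \<phi> s)"
  by (simp add: cont_functional_def continuous_on_add algebra_simps)

lemma cont_functional_scale: "cont_functional \<psi> \<Longrightarrow> cont_functional (\<lambda>s. c * \<psi> s)"
  by (simp add: cont_functional_def continuous_on_mult_left algebra_simps)

lemma cont_functional_sum:
  assumes "finite M" "\<And>m. m \<in> M \<Longrightarrow> cont_functional (\<psi> m)"
  shows "cont_functional (\<lambda>s. \<Sum>m\<in>M. \<psi> m s)"
  using assms
proof (induction M rule: finite_induct)
  case empty
  show ?case by (simp add: cont_functional_def)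
next
  case (insert m M)
  have "cont_functional (\<lambda>s. \<psi> m s + (\<Sum>m\<in>M. \<psi> m s))"
    by (rule cont_functional_add) (use insert in simp_all)
  then show ?case using insert.hyps by simp
qed

lemma cont_functional_lincomb:
  assumes "cont_functional \<psi>" "finite M"
  shows "\<psi> (\<lambda>x y. \<Sum>m\<in>M. c m * f m x y) = (\<Sum>m\<in>M. c m * \<psi> (f m))"
  using assms(2)
proof (induction M rule: finite_induct)
  case empty
  show ?case
    using assms(1)[unfolded cont_functional_def, THEN conjunct2, THEN conjunct2, rule_format, of 0 "\<lambda>x y. 0"] by simp
next
  case (insert m M)
  have "\<psi> (\<lambda>x y. c m * f m x y + (\<Sum>m\<in>M. c m * f m x y)) = c m * \<psi> (f m) + \<psi> (\<lambda>x y. \<Sum>m\<in>M. c m * f m x y)"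
    using assms(1) unfolding cont_functional_def by simp
  then show ?case using insert by simp
qed

text \<open>Point evaluations separate functions and are continuous for pointwise convergence, so
  combinations of finitely many of them are dual to an independent family. They live on the whole
  function space and hence on all of \<open>H0\<close>, whatever its dimension.\<close>

lemma dual_functionals_exist:
  fixes f :: "'m \<Rightarrow> 'a \<Rightarrow> 'b \<Rightarrow> complex"
  assumes "finite M"
    and "\<And>c. (\<lambda>x y. \<Sum>m\<in>M. c m * f m x y) = (\<lambda>x y. 0) \<Longrightarrow> \<forall>m\<in>M. c m = 0"
  shows "\<exists>\<psi>. (\<forall>m\<in>M. cont_functional (\<psi> m)) \<and> (\<forall>m\<in>M. \<forall>m'\<in>M. \<psi> m (f m') = of_bool (m = m'))"
  using assms
proof (induction M rule: finite_induct)
  case (insert n M)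
  have "\<forall>m\<in>M. c m = 0" if "(\<lambda>x y. \<Sum>m\<in>M. c m * f m x y) = (\<lambda>x y. 0)" for c
  proof -
    have "(\<Sum>m\<in>M. (if m = n then 0 else c m) * f m x y) = (\<Sum>m\<in>M. c m * f m x y)" for x y
      using insert.hyps by (intro sum.cong) auto
    then have "(\<lambda>x y. \<Sum>m\<in>insert n M. (if m = n then 0 else c m) * f m x y) = (\<lambda>x y. 0)"
      using insert.hyps fun_cong[OF fun_cong[OF that]] by simp
    then have z: "\<forall>m\<in>insert n M. (if m = n then 0 else c m) = 0" by (rule insert.prems)
    show ?thesis
    proof
      fix m assume "m \<in> M"
      then have "m \<noteq> n" using insert.hyps by blast
      then show "c m = 0" using bspec[OF z, of m] \<open>m \<in> M\<close> by simp
    qed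
  qed
  then obtain \<psi> where \<psi>: "\<And>m. m \<in> M \<Longrightarrow> cont_functional (\<psi> m)"
    "\<And>m m'. m \<in> M \<Longrightarrow> m' \<in> M \<Longrightarrow> \<psi> m (f m') = of_bool (m = m')"
    using insert.IH by blast
  \<comment> \<open>The part of \<open>f n\<close> not accounted for by the earlier functions;
    independence makes it nonzero at some point.\<close>
  define \<rho> where "\<rho> x y = f n x y - (\<Sum>m\<in>M. \<psi> m (f n) * f m x y)" for x y
  have "\<exists>p q. \<rho> p q \<noteq> 0"
  proof (rule ccontr)
    assume no: "\<not> ?thesis"
    let ?c = "\<lambda>m. if m = n then 1 else - \<psi> m (f n)"
    have "(\<Sum>m\<in>M. ?c m * f m x y) = - (\<Sum>m\<in>M. \<psi> m (f n) * f m x y)" for x y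
      unfolding sum_negf[symmetric] using insert.hyps by (intro sum.cong) auto
    then have "(\<Sum>m\<in>insert n M. ?c m * f m x y) = \<rho> x y" for x y
      using insert.hyps by (simp add: \<rho>_def)
    then have "(\<lambda>x y. \<Sum>m\<in>insert n M. ?c m * f m x y) = (\<lambda>x y. 0)" using no by simp
    then have "\<forall>m\<in>insert n M. ?c m = 0" by (rule insert.prems)
    then show False by simp
  qed
  then obtain p q where pq: "\<rho> p q \<noteq> 0" by blast
  \<comment> \<open>Evaluation at that point, corrected to vanish on the earlier functions and
    divided by the value \<open>\<rho> p q\<close> which it then takes on
    \<open>f n\<close>.\<close>
  define \<phi> where "\<phi> s = (1 / \<rho> p q) * (s p q + (\<Sum>m\<in>M. (- f m p q) * \<psi> m s))" for s
  have \<phi>c: "cont_functional \<phi>"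
    unfolding \<phi>_def
    by (intro cont_functional_scale cont_functional_add cont_functional_eval cont_functional_sum \<psi> insert.hyps)
  have \<phi>M: "\<phi> (f m') = 0" if "m' \<in> M" for m'
  proof -
    have "(\<Sum>m\<in>M. (- f m p q) * \<psi> m (f m')) = (\<Sum>m\<in>M. if m = m' then - f m p q else 0)"
      using \<psi>(2)[OF _ that] by (intro sum.cong) auto
    then show ?thesis using that insert.hyps by (simp add: \<phi>_def)
  qed
  have \<phi>n: "\<phi> (f n) = 1"
    using pq by (simp add: \<phi>_def \<rho>_def sum_negf mult.commute)
  \<comment> \<open>A multiple of the new functional is subtracted from each old one to make it
    vanish on \<open>f n\<close>.\<close>
  define \<psi>' where "\<psi>' m = (if m = n then \<phi> else (\<lambda>s. \<psi> m s + (- \<psi> m (f n)) * \<phi> s))" for m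
  show ?case
  proof (intro exI[of _ \<psi>'] conjI ballI)
    fix m assume m: "m \<in> insert n M"
    show "cont_functional (\<psi>' m)"
    proof (cases "m = n")
      case False
      then have "cont_functional (\<lambda>s. \<psi> m s + (- \<psi> m (f n)) * \<phi> s)"
        using m by (intro cont_functional_add cont_functional_scale \<psi>(1) \<phi>c) simp
      then show ?thesis using False by (simp only: \<psi>'_def if_False)
    qed (simp add: \<psi>'_def \<phi>c)
    fix m' assume m': "m' \<in> insert n M"
    show "\<psi>' m (f m') = of_bool (m = m')"
      using m m' insert.hyps \<psi>(2) \<phi>M \<phi>n by (auto simp: \<psi>'_def)
  qed
qed auto

lemma proj_class_eq_iff: "proj_class s = proj_class t \<longleftrightarrow> (\<exists>k. k \<noteq> 0 \<and> s = (\<lambda>A y. k * t A y))"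
proof
  assume eq: "proj_class s = proj_class t"
  have "s \<in> proj_class s" unfolding proj_class_def by (auto intro!: exI[of _ 1])
  then show "\<exists>k. k \<noteq> 0 \<and> s = (\<lambda>A y. k * t A y)" unfolding eq by (auto simp: proj_class_def)
next
  assume "\<exists>k. k \<noteq> 0 \<and> s = (\<lambda>A y. k * t A y)"
  then obtain k where k: "k \<noteq> 0" "s = (\<lambda>A y. k * t A y)" by blast
  show "proj_class s = proj_class t"
  proof (intro equalityI subsetI)
    fix u assume "u \<in> proj_class s"
    then obtain c where "c \<noteq> 0" "u = (\<lambda>A y. c * s A y)" by (auto simp: proj_class_def)
    then show "u \<in> proj_class t" using k unfolding proj_class_def by (auto simp: mult.assoc intro!: exI[of _ "c * k"])
  next
    fix u assume "u \<in> proj_class t"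
    then obtain c where "c \<noteq> 0" "u = (\<lambda>A y. c * t A y)" by (auto simp: proj_class_def)
    then show "u \<in> proj_class s" using k unfolding proj_class_def by (auto intro!: exI[of _ "c / k"])
  qed
qed

section \<open>Cells in the projective space of sections\<close>

context toric
begin

definition nonzero_sections :: "(nat \<Rightarrow> int) \<Rightarrow> 'd sect set" where
  "nonzero_sections v = H0 C v - {\<lambda>A y. 0}"

text \<open>The set \<open>N_S\<close>. The condition includes membership in
  \<open>minimal v\<close>, so the cell is empty for any other \<open>S\<close> and the intersection
  law holds for all nonempty index sets.\<close>

definition cell :: "(nat \<Rightarrow> int) \<Rightarrow> (nat^'d) set \<Rightarrow> 'd sect set set" where
  "cell v S = {proj_class (comb v c) | c. \<forall>m\<in>S. m \<in> minimal v \<and> c m \<noteq> 0}"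

lemma comb_scale: "comb v (\<lambda>m. k * c m) = (\<lambda>A y. k * comb v c A y)"
  by (simp add: comb_def sum_distrib_left mult.assoc)

lemma comb_cong: "(\<And>m. m \<in> minimal v \<Longrightarrow> c m = c' m) \<Longrightarrow> comb v c = comb v c'"
  by (simp add: comb_def)

lemma comb_eqD:
  assumes "comb v c = (\<lambda>A y. k * comb v c' A y)" "m \<in> minimal v"
  shows "c m = k * c' m"
proof -
  have "comb v (\<lambda>m. c m - k * c' m) = (\<lambda>A y. comb v c A y - k * comb v c' A y)"
    by (simp add: comb_def sum_distrib_left sum_subtractf[symmetric] left_diff_distrib mult.assoc)
  then have "comb v (\<lambda>m. c m - k * c' m) = (\<lambda>A y. 0)" using assms(1) by simp
  then show ?thesis using comb_eq_0_iff[of v "\<lambda>m. c m - k * c' m"] assms(2) by auto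
qed

lemma comb_nonzero: "m \<in> minimal v \<Longrightarrow> c m \<noteq> 0 \<Longrightarrow> comb v c \<in> nonzero_sections v"
  unfolding nonzero_sections_def Diff_iff singleton_iff comb_eq_0_iff using comb_in_H0[of v c] by blast

text \<open>By linear independence a class determines its coefficients up to one common factor, so
  their vanishing does not depend on the representative.\<close>

lemma cell_Int:
  assumes "S \<noteq> {}" "T \<noteq> {}"
  shows "cell v S \<inter> cell v T = cell v (S \<union> T)"
proof (intro equalityI subsetI)
  fix x assume "x \<in> cell v S \<inter> cell v T"
  then obtain c c' where c: "x = proj_class (comb v c)" "\<forall>m\<in>S. m \<in> minimal v \<and> c m \<noteq> 0"
    and c': "x = proj_class (comb v c')" "\<forall>m\<in>T. m \<in> minimal v \<and> c' m \<noteq> 0"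
    by (auto simp: cell_def)
  obtain k where k: "k \<noteq> 0" "comb v c' = (\<lambda>A y. k * comb v c A y)"
    using c(1) c'(1) proj_class_eq_iff by metis
  have "\<forall>m\<in>S \<union> T. m \<in> minimal v \<and> c m \<noteq> 0"
    using c(2) c'(2) comb_eqD[OF k(2)] by auto
  then show "x \<in> cell v (S \<union> T)" using c(1) by (auto simp: cell_def)
next
  fix x assume "x \<in> cell v (S \<union> T)"
  then obtain c where c: "x = proj_class (comb v c)" "\<forall>m\<in>S \<union> T. m \<in> minimal v \<and> c m \<noteq> 0"
    by (auto simp: cell_def)
  then have "x \<in> cell v S" "x \<in> cell v T" unfolding cell_def by blast+
  then show "x \<in> cell v S \<inter> cell v T" by blast
qed

end

text \<open>The dual functionals \<open>\<psi>\<close> serve as homogeneous coordinates.\<close>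

locale toric_weight = toric C for C :: "('d::finite) chart list" +
  fixes v :: "nat \<Rightarrow> int" and \<psi> :: "nat^'d \<Rightarrow> 'd sect \<Rightarrow> complex"
  assumes \<psi>_functional: "\<And>m. m \<in> minimal v \<Longrightarrow> cont_functional (\<psi> m)"
    and \<psi>_dual: "\<And>m m'. m \<in> minimal v \<Longrightarrow> m' \<in> minimal v \<Longrightarrow> \<psi> m (mono_section v m') = of_bool (m = m')"
begin

abbreviation M where "M \<equiv> minimal v"
abbreviation H where "H \<equiv> nonzero_sections v"
text \<open>The projective space spanned by the monomial sections; it contains all cells of nonempty
  sets and the space \<open>D_set C v\<close>.\<close>

abbreviation X where "X \<equiv> subtopology (PH0 C v) {proj_class (comb v c) | c. \<exists>m\<in>M. c m \<noteq> 0}"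

lemma \<psi>_comb: "m \<in> M \<Longrightarrow> \<psi> m (comb v c) = c m"
proof -
  assume m: "m \<in> M"
  have "\<psi> m (comb v c) = (\<Sum>m'\<in>M. c m' * \<psi> m (mono_section v m'))"
    unfolding comb_def by (rule cont_functional_lincomb[OF \<psi>_functional[OF m] finite_minimal])
  also have "\<dots> = (\<Sum>m'\<in>M. if m' = m then c m' else 0)"
    using \<psi>_dual[OF m] by (intro sum.cong) auto
  finally show ?thesis using m finite_minimal by simp
qed

lemma \<psi>_scale: "m \<in> M \<Longrightarrow> \<psi> m (\<lambda>A y. k * s A y) = k * \<psi> m s"
  using \<psi>_functional by (simp add: cont_functional_def)

lemma \<psi>_continuous: "m \<in> M \<Longrightarrow> continuous_on S (\<psi> m)"
  by (rule continuous_on_subset[of UNIV]) (use \<psi>_functional in \<open>simp_all add: cont_functional_def\<close>)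

text \<open>Taken among all nonzero sections, not only combinations of monomial ones, so that
  openness passes through the quotient map. Intersecting its image with the points of
  \<open>X\<close> gives back \<open>cell v S\<close> for nonempty
  \<open>S \<subseteq> M\<close>.\<close>

definition open_cell :: "(nat^'d) set \<Rightarrow> 'd sect set" where
  "open_cell S = {s \<in> H. \<forall>m\<in>S. \<psi> m s \<noteq> 0}"

lemma quotient: "quotient_map (top_of_set H) (PH0 C v) proj_class"
  unfolding PH0_def nonzero_sections_def by (rule quotient_map_quotient_top)

lemma open_cell_saturated:
  assumes "S \<subseteq> M"
  shows "{s \<in> topspace (top_of_set H). proj_class s \<in> proj_class ` open_cell S} = open_cell S"
proof (intro equalityI subsetI)
  fix s assume "s \<in> {s \<in> topspace (top_of_set H). proj_class s \<in> proj_class ` open_cell S}"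
  then obtain t where t: "s \<in> H" "t \<in> open_cell S" "proj_class s = proj_class t" by auto
  then obtain k where "k \<noteq> 0" "s = (\<lambda>A y. k * t A y)" using proj_class_eq_iff by blast
  then show "s \<in> open_cell S" using t \<psi>_scale assms by (auto simp: open_cell_def)
next
  fix s assume s: "s \<in> open_cell S"
  then have "s \<in> H" by (simp add: open_cell_def)
  then show "s \<in> {s \<in> topspace (top_of_set H). proj_class s \<in> proj_class ` open_cell S}"
    using s by simp
qed

lemma openin_open_cell:
  assumes "finite S" "S \<subseteq> M"
  shows "openin (top_of_set H) (open_cell S)"
  using assms
proof (induction S rule: finite_induct)
  case empty
  have "open_cell {} = H" by (simp add: open_cell_def)
  then show ?case by simp
next
  case (insert m S)
  have "openin (top_of_set H) (H \<inter> \<psi> m -` (- {0}))"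
    using insert by (intro continuous_openin_preimage_gen \<psi>_continuous) auto
  moreover have "open_cell (insert m S) = open_cell S \<inter> (H \<inter> \<psi> m -` (- {0}))"
    by (auto simp: open_cell_def)
  ultimately show ?case using insert by auto
qed

lemma openin_proj_open_cell:
  assumes "finite S" "S \<subseteq> M"
  shows "openin (PH0 C v) (proj_class ` open_cell S)"
proof -
  have "proj_class ` open_cell S \<subseteq> topspace (PH0 C v)"
    using quotient by (auto simp: quotient_map_def open_cell_def)
  moreover have "openin (top_of_set H) {s \<in> topspace (top_of_set H). proj_class s \<in> proj_class ` open_cell S}"
    unfolding open_cell_saturated[OF assms(2)] by (rule openin_open_cell[OF assms])
  ultimately show ?thesis using quotient unfolding quotient_map_def by blast
qed

lemma cell_subset: "S \<noteq> {} \<Longrightarrow> cell v S \<subseteq> {proj_class (comb v c) | c. \<exists>m\<in>M. c m \<noteq> 0}"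
  by (auto simp: cell_def)

lemma cell_subset_open_cell: "S \<noteq> {} \<Longrightarrow> cell v S \<subseteq> proj_class ` open_cell S"
proof
  fix x assume S: "S \<noteq> {}" "x \<in> cell v S"
  then obtain c where c: "x = proj_class (comb v c)" "\<forall>m\<in>S. m \<in> M \<and> c m \<noteq> 0" by (auto simp: cell_def)
  obtain m where "m \<in> S" using S by blast
  then have "comb v c \<in> H" using comb_nonzero c(2) by blast
  then show "x \<in> proj_class ` open_cell S" using c \<psi>_comb by (auto simp: open_cell_def)
qed

lemma openin_cell:
  assumes "finite S" "S \<subseteq> M" "S \<noteq> {}"
  shows "openin X (cell v S)"
proof -
  have "cell v S = proj_class ` open_cell S \<inter> {proj_class (comb v c) | c. \<exists>m\<in>M. c m \<noteq> 0}"
  proof (intro equalityI subsetI IntI)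
    fix x assume "x \<in> proj_class ` open_cell S \<inter> {proj_class (comb v c) | c. \<exists>m\<in>M. c m \<noteq> 0}"
    then obtain s c where s: "s \<in> open_cell S" "x = proj_class s" "x = proj_class (comb v c)" by auto
    then obtain k where k: "k \<noteq> 0" "s = (\<lambda>A y. k * comb v c A y)" using proj_class_eq_iff by blast
    have "c m \<noteq> 0" if "m \<in> S" for m
    proof -
      have "m \<in> M" using that assms by blast
      then have "\<psi> m s = k * c m" using \<psi>_scale \<psi>_comb k(2) by simp
      then show ?thesis using s(1) that by (auto simp: open_cell_def)
    qed
    then show "x \<in> cell v S" using s(3) assms by (auto simp: cell_def)
  qed (use cell_subset[OF assms(3)] cell_subset_open_cell[OF assms(3)] in auto)
  then show ?thesis
    using openin_proj_open_cell[OF assms(1,2)] by (auto simp: openin_subtopology)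
qed

text \<open>Dividing by the coefficient at some \<open>m0\<close> in \<open>S\<close> identifies the
  cell with a product: a point at \<open>m0\<close>, a punctured plane at each other element of
  \<open>S\<close>, a plane elsewhere. Continuity of these affine coordinates is checked before
  passing to the quotient.\<close>

lemma has_euler_cell:
  assumes "finite S" "S \<subseteq> M" "S \<noteq> {}"
  shows "has_euler (subtopology X (cell v S)) {} (if card S = 1 then 1 else 0)"
proof -
  obtain m0 where m0: "m0 \<in> S" using assms by blast
  then have m0M: "m0 \<in> M" using assms by blast
  define K where "K m = (if m = m0 then {1} else if m \<in> S then - {0} else UNIV :: complex set)" for m
  define B where "B = product_topology (\<lambda>m. top_of_set (K m)) M"
  define U where "U = proj_class ` open_cell {m0}"
  define g where "g s = restrict (\<lambda>m. \<psi> m s / \<psi> m0 s) M" for s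
  \<comment> \<open>The choice of representative is immaterial: \<open>g_inv\<close> shows that
    ratios of coordinates are invariant under scaling.\<close>
  define h where "h x = g (SOME s. s \<in> open_cell {m0} \<and> proj_class s = x)" for x
  have box: "has_euler B {} (if S - {m0} = {} then 1 else 0)"
    unfolding B_def
    by (rule has_euler_box[OF finite_minimal]) (use assms in \<open>auto simp: K_def finite_subset\<close>)
  have g_inv: "g s = g t" if st: "s \<in> open_cell {m0}" "t \<in> open_cell {m0}" "proj_class s = proj_class t" for s t
  proof -
    obtain k where "k \<noteq> 0" "s = (\<lambda>A y. k * t A y)" using st(3) proj_class_eq_iff by blast
    then have "\<psi> m s = k * \<psi> m t" if "m \<in> M" for m using \<psi>_scale[OF that] by simp
    then show ?thesis using m0M \<open>k \<noteq> 0\<close> by (auto simp: g_def fun_eq_iff)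
  qed
  have hq: "h (proj_class s) = g s" if "s \<in> open_cell {m0}" for s
  proof -
    have "\<exists>t. t \<in> open_cell {m0} \<and> proj_class t = proj_class s" using that by blast
    from someI_ex[OF this] show ?thesis unfolding h_def by (intro g_inv) (use that in auto)
  qed
  have hU: "continuous_map (subtopology (PH0 C v) U) (product_topology (\<lambda>m. euclidean) M) h"
  proof (rule continuous_compose_quotient_map)
    \<comment> \<open>A quotient map restricts to a quotient map on an open saturated set, here the
      locus where the coordinate at \<open>m0\<close> is nonzero.\<close>
    show "quotient_map (subtopology (top_of_set H) (open_cell {m0})) (subtopology (PH0 C v) U) proj_class"
      unfolding U_def using m0M
      by (intro quotient_map_restriction[OF quotient] open_cell_saturated disjI1 openin_proj_open_cell) auto
    have sub: "subtopology (top_of_set H) (open_cell {m0}) = top_of_set (open_cell {m0})"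
      by (auto simp: subtopology_subtopology open_cell_def Int_absorb1 Collect_conj_eq)
    have "continuous_map (top_of_set (open_cell {m0})) (product_topology (\<lambda>m. euclidean) M) g"
    proof (rule continuous_map_coordinatewise_then_product)
      fix m assume m: "m \<in> M"
      have "continuous_on (open_cell {m0}) (\<lambda>s. \<psi> m s / \<psi> m0 s)"
        using m m0M by (intro continuous_on_divide \<psi>_continuous) (auto simp: open_cell_def)
      then show "continuous_map (top_of_set (open_cell {m0})) euclidean (\<lambda>s. g s m)"
        using m by (simp add: g_def)
    qed (simp add: g_def)
    then show "continuous_map (subtopology (top_of_set H) (open_cell {m0})) (product_topology (\<lambda>m. euclidean) M) (h \<circ> proj_class)"
      unfolding sub by (rule continuous_map_eq) (simp add: hq)
  qed
  have comb_cell: "comb v c \<in> open_cell {m0}" if "c m0 \<noteq> 0" for c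
    using that comb_nonzero[OF m0M] \<psi>_comb[OF m0M] by (simp add: open_cell_def)
  have h_comb: "h (proj_class (comb v c)) = restrict (\<lambda>m. c m / c m0) M" if "c m0 \<noteq> 0" for c
    unfolding hq[OF comb_cell[of c, OF that]] g_def using \<psi>_comb m0M by (auto simp: fun_eq_iff)
  have cellU: "cell v S \<subseteq> U"
  proof
    fix x assume "x \<in> cell v S"
    then obtain c where "x = proj_class (comb v c)" "\<forall>m\<in>S. m \<in> M \<and> c m \<noteq> 0" by (auto simp: cell_def)
    then show "x \<in> U" using comb_cell m0 by (auto simp: U_def)
  qed
  have Btop: "B = subtopology (product_topology (\<lambda>m. euclidean) M) (PiE M K)"
    unfolding B_def by (simp add: subtopology_product_topology)
  have topB: "topspace B = PiE M K" by (simp add: B_def)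
  have hB: "continuous_map (subtopology (PH0 C v) (cell v S)) B h"
    unfolding Btop
  proof (rule continuous_map_into_subtopology)
    show "continuous_map (subtopology (PH0 C v) (cell v S)) (product_topology (\<lambda>m. euclidean) M) h"
      using hU cellU by (rule continuous_map_from_subtopology_mono)
    show "h \<in> topspace (subtopology (PH0 C v) (cell v S)) \<rightarrow> PiE M K"
    proof
      fix x assume "x \<in> topspace (subtopology (PH0 C v) (cell v S))"
      then obtain c where c: "x = proj_class (comb v c)" "\<forall>m\<in>S. m \<in> M \<and> c m \<noteq> 0" by (auto simp: cell_def)
      then show "h x \<in> PiE M K" using m0 by (auto simp: h_comb K_def)
    qed
  qed
  have b_props: "b m0 = 1" "\<forall>m\<in>S. m \<in> M \<and> b m \<noteq> 0" if "b \<in> PiE M K" for b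
  proof -
    have bK: "b m \<in> K m" if "m \<in> M" for m using that \<open>b \<in> PiE M K\<close> by (rule PiE_mem[rotated])
    show "b m0 = 1" using bK[OF m0M] by (simp add: K_def)
    show "\<forall>m\<in>S. m \<in> M \<and> b m \<noteq> 0"
    proof
      fix m assume m: "m \<in> S"
      then have "m \<in> M" using assms(2) by blast
      then show "m \<in> M \<and> b m \<noteq> 0" using bK[of m] m by (auto simp: K_def split: if_split_asm)
    qed
  qed
  have combB: "continuous_map B (top_of_set H) (comb v)"
  proof -
    \<comment> \<open>Points of \<open>B\<close> are functions on \<open>M\<close> with value
      \<open>undefined\<close> outside. These outer coordinates are constant, so the inclusion into
      the full function space is continuous.\<close>
    have idB: "continuous_map B euclidean (\<lambda>b. b)"
      unfolding euclidean_product_topology[symmetric] continuous_map_componentwise_UNIV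
    proof
      fix m
      show "continuous_map B euclidean (\<lambda>b. b m)"
      proof (cases "m \<in> M")
        case True
        have "continuous_map B (top_of_set (K m)) (\<lambda>b. b m)"
          unfolding B_def using continuous_map_product_projection[OF True, of "\<lambda>m. top_of_set (K m)"] .
        then show ?thesis by (rule continuous_map_into_fulltopology)
      next
        case False
        have "continuous_map B euclidean (\<lambda>b. undefined :: complex)" by simp
        then show ?thesis
        proof (rule continuous_map_eq)
          fix b assume "b \<in> topspace B"
          then have "b \<in> PiE M K" by (simp add: topB)
          from PiE_arb[OF this False] show "undefined = b m" by (rule sym)
        qed
      qed
    qed
    have "continuous_on UNIV (comb v)"
      unfolding comb_def
      by (intro continuous_on_coordinatewise_then_product continuous_on_sum continuous_on_mult_right) simp
    then have "continuous_map euclidean euclidean (comb v)" by simp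
    then have "continuous_map B euclidean (comb v)"
      using continuous_map_compose[OF idB, of euclidean "comb v"] by (simp add: o_def)
    then show ?thesis
    proof (rule continuous_map_into_subtopology)
      show "comb v \<in> topspace B \<rightarrow> H"
      proof
        fix b assume "b \<in> topspace B"
        then have "b m0 = 1" by (intro b_props(1)) (simp add: topB)
        then show "comb v b \<in> H" by (intro comb_nonzero[OF m0M]) simp
      qed
    qed
  qed
  have "continuous_map B (PH0 C v) (proj_class \<circ> comb v)"
    by (rule continuous_map_compose[OF combB quotient_imp_continuous_map[OF quotient]])
  then have \<Phi>: "continuous_map B (subtopology (PH0 C v) (cell v S)) (proj_class \<circ> comb v)"
  proof (rule continuous_map_into_subtopology)
    show "proj_class \<circ> comb v \<in> topspace B \<rightarrow> cell v S"
    proof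
      fix b assume "b \<in> topspace B"
      then have "\<forall>m\<in>S. m \<in> M \<and> b m \<noteq> 0" by (intro b_props(2)) (simp add: topB)
      then show "(proj_class \<circ> comb v) b \<in> cell v S" unfolding cell_def by auto
    qed
  qed
  have "homeomorphic_maps B (subtopology (PH0 C v) (cell v S)) (proj_class \<circ> comb v) h"
    unfolding homeomorphic_maps_def
  proof (intro conjI ballI \<Phi> hB)
    fix b assume "b \<in> topspace B"
    then have b: "b \<in> PiE M K" by (simp add: topB)
    have "restrict (\<lambda>m. b m / b m0) M m = b m" for m
      using b_props(1)[OF b] PiE_arb[OF b, of m] by (cases "m \<in> M") simp_all
    then have "restrict (\<lambda>m. b m / b m0) M = b" by (rule ext)
    then show "h ((proj_class \<circ> comb v) b) = b" using h_comb[of b] b_props(1)[OF b] by simp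
  next
    fix x assume "x \<in> topspace (subtopology (PH0 C v) (cell v S))"
    then obtain c where c: "x = proj_class (comb v c)" "\<forall>m\<in>S. m \<in> M \<and> c m \<noteq> 0" by (auto simp: cell_def)
    then have "c m0 \<noteq> 0" using m0 by blast
    have "comb v (restrict (\<lambda>m. c m / c m0) M) = comb v (\<lambda>m. (1 / c m0) * c m)" by (rule comb_cong) simp
    then have "proj_class (comb v (restrict (\<lambda>m. c m / c m0) M)) = proj_class (comb v c)"
      unfolding proj_class_eq_iff comb_scale using \<open>c m0 \<noteq> 0\<close> by (intro exI[of _ "1 / c m0"]) simp
    then show "(proj_class \<circ> comb v) (h x) = x" using h_comb[of c, OF \<open>c m0 \<noteq> 0\<close>] c(1) by simp
  qed
  then have "B homeomorphic_space subtopology (PH0 C v) (cell v S)" unfolding homeomorphic_space_def by blast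
  then have "has_euler (subtopology (PH0 C v) (cell v S)) {} (if S - {m0} = {} then 1 else 0)"
    using has_euler_homotopy_equivalent[OF homeomorphic_imp_homotopy_equivalent_space box] by blast
  moreover have "subtopology X (cell v S) = subtopology (PH0 C v) (cell v S)"
    using cell_subset[OF assms(3)] by (simp add: subtopology_subtopology Int_absorb1)
  moreover have "S - {m0} = {} \<longleftrightarrow> card S = 1"
    using m0 by (auto simp: card_1_singleton_iff)
  ultimately show ?thesis by simp
qed

lemma euler_char_D_space: "euler_char (D_space C v) = int (card (exact_weight v))"
proof -
  have adm: "S \<noteq> {} \<and> finite S \<and> S \<subseteq> M" if "S \<in> admissible v" for S
  proof -
    \<comment> \<open>The pair \<open>(0, 0)\<close> alone forces an admissible set to be
      nonempty.\<close>
    have "E_int C 0 0 \<noteq> {}" using E_int_diag length_pos by blast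
    then show ?thesis using that length_pos finite_minimal by (auto simp: admissible_def intro: finite_subset)
  qed
  have fin: "finite (admissible v)"
    by (rule finite_subset[of _ "Pow M"]) (auto simp: admissible_def finite_minimal)
  have "has_euler (subtopology X (\<Union>S\<in>admissible v. cell v S)) {} (int (card {S \<in> admissible v. card S = 1}))"
    by (rule has_euler_UN_lattice[where M = M])
      (use openin_cell cell_Int has_euler_cell fin adm in auto)
  \<comment> \<open>A class belongs to a cell if its support contains \<open>S\<close>, and to
    \<open>D_set\<close> if its support is admissible. The two unions agree because admissibility
    passes to larger subsets of \<open>M\<close>.\<close>
  moreover have "(\<Union>S\<in>admissible v. cell v S) = D_set C v"
  proof (intro equalityI subsetI)
    fix x assume "x \<in> (\<Union>S\<in>admissible v. cell v S)"
    then obtain S c where S: "S \<in> admissible v" "x = proj_class (comb v c)" "\<forall>m\<in>S. m \<in> M \<and> c m \<noteq> 0"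
      by (auto simp: cell_def)
    then have "S \<subseteq> {m \<in> M. c m \<noteq> 0}" by blast
    then have "{m \<in> M. c m \<noteq> 0} \<in> admissible v" using S(1) unfolding admissible_def by blast
    then show "x \<in> D_set C v" using S(2) by (auto simp: D_set_eq)
  next
    fix x assume "x \<in> D_set C v"
    then obtain c where "x = proj_class (comb v c)" "{m \<in> M. c m \<noteq> 0} \<in> admissible v" by (auto simp: D_set_eq)
    then show "x \<in> (\<Union>S\<in>admissible v. cell v S)" by (intro UN_I[of "{m \<in> M. c m \<noteq> 0}"]) (auto simp: cell_def)
  qed
  moreover have "(\<Union>S\<in>admissible v. cell v S) \<subseteq> {proj_class (comb v c) | c. \<exists>m\<in>M. c m \<noteq> 0}"
    by (rule UN_least, rule cell_subset) (use adm in blast)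
  ultimately have "has_euler (D_space C v) {} (int (card {S \<in> admissible v. card S = 1}))"
    by (simp add: D_space_def subtopology_subtopology Int_absorb1)
  \<comment> \<open>For a singleton the pairs \<open>(j, j)\<close> force equality in every
    component, and this implies the condition for all other pairs.\<close>
  moreover have "{S \<in> admissible v. card S = 1} = (\<lambda>m. {m}) ` exact_weight v"
  proof (intro equalityI subsetI)
    fix S assume "S \<in> {S \<in> admissible v. card S = 1}"
    then obtain m where m: "S = {m}" "{m} \<in> admissible v" by (auto simp: card_1_singleton_iff)
    then have "m \<in> exact_weight v" using E_int_diag by (auto simp: admissible_def exact_weight_def)
    then show "S \<in> (\<lambda>m. {m}) ` exact_weight v" using m by blast
  next
    fix S assume "S \<in> (\<lambda>m. {m}) ` exact_weight v"
    then obtain m where m: "S = {m}" "m \<in> exact_weight v" by blast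
    then have "m \<in> minimal v" using length_pos by (auto simp: exact_weight_def minimal_def above_def)
    then show "S \<in> {S \<in> admissible v. card S = 1}" using m by (auto simp: admissible_def exact_weight_def)
  qed
  moreover have "card ((\<lambda>m. {m}) ` exact_weight v) = card (exact_weight v)" by (rule card_image) simp
  ultimately show ?thesis using euler_char_eqI by metis
qed

end

theorem theorem2:
  fixes C :: "('d::finite) chart list"
  assumes "CARD('d) \<ge> 2"
    and "toric_constellation C"
  shows "\<forall>v \<in> int_vecs (length C). poincare_series C v = euler_char (D_space C v)"
proof
  fix v assume v: "v \<in> int_vecs (length C)"
  interpret toric C by unfold_locales (fact assms)+
  \<comment> \<open>Independence of the monomial sections is \<open>comb_eq_0_iff\<close> with
    \<open>comb\<close> unfolded.\<close>
  obtain \<psi> where \<psi>: "\<forall>m\<in>minimal v. cont_functional (\<psi> m)"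
    "\<forall>m\<in>minimal v. \<forall>m'\<in>minimal v. \<psi> m (mono_section v m') = of_bool (m = m')"
    using dual_functionals_exist[where M = "minimal v" and f = "mono_section v"] finite_minimal
      comb_eq_0_iff[of v, unfolded comb_def] by blast
  interpret toric_weight C v \<psi>
    by unfold_locales (rule \<psi>(1)[rule_format], assumption, rule \<psi>(2)[rule_format], assumption+)
  show "poincare_series C v = euler_char (D_space C v)"
    using v by (simp add: poincare_series_eq weight_count_def euler_char_D_space)
qed

end
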